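(* Let $F\subset\mathrm{Sym}^2(\mathbb{R}^n)$ be a cone subequation with finite Riesz characteristic $p\ge2$ such that $-P_e\notin F$ for every unit vector $e$, and let $\Omega\subset\mathbb{R}^n$ be a bounded domain with smooth strictly $F$-convex boundary. (a) For each $\varphi\in C(\partial\Omega)$, $x_0\in\Omega$ and $\Theta>0$ there exists a unique $H\in C(\overline\Omega\setminus\{x_0\})$, $F$-harmonic on $\Omega\setminus\{x_0\}$, with $H|_{\partial\Omega}=\varphi$ and such that $|H(x)-\Theta K_p(x-x_0)|$ is bounded near $x_0$. (b) If in addition $F$ is convex, then for each $\varphi\in C(\partial\Omega)$, distinct $x_1,\dots,x_k\in\Omega$ and $\Theta_1,\dots,\Theta_k>0$ there exists a unique $H\in C(\overline\Omega\setminus\{x_1,\dots,x_k\})$, $F$-harmonic on $\Omega\setminus\{x_1,\dots,x_k\}$, with $H|_{\partial\Omega}=\varphi$ and such that $|H(x)-\Theta_jK_p(x-x_j)|$ is bounded near $x_j$ for each $j$. In particular, taking $\varphi\equiv0$, there exists a unique such $H$ (a nonlinear Green's function) with $H\approx\Theta K_p(x-x_0)$ at $x_0$, and, if $F$ is convex, a unique such $H$ with $H\approx\Theta_jK_p(x-x_j)$ at each $x_j$.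
   Context: A cone subequation is a closed $F\subset\mathrm{Sym}^2(\mathbb{R}^n)$ with $A\in F,P\ge0\Rightarrow A+P\in F$ and $tF=F$ for $t>0$; $\tilde F=\{A:-A\notin\mathrm{Int}F\}$. An upper semicontinuous $u:X\to[-\infty,\infty)$ is $F$-subharmonic if every $C^2$ test function $\phi$ at any $x_0$ ($u\le\phi$ near $x_0$, equality at $x_0$) has $D^2\phi(x_0)\in F$; $u$ is $F$-harmonic if finite, continuous, $F$-subharmonic with $-u$ $\tilde F$-subharmonic. $P_e$, $P_{e^\perp}$ are orthogonal projections onto $\mathbb{R}e$ and $e^\perp$. $F$ has finite Riesz characteristic $p$ if $P_{e^\perp}-(p-1)P_e\in\partial F$ for all unit $e$. The Riesz kernel is $K_p(x)=-\frac{1}{p-2}|x|^{2-p}$ for $p\ne2$ and $K_2(x)=\log|x|$. Smooth boundary strictly $F$-convex: for each $x\in\partial\Omega$ and local defining function $\rho$ ($\Omega=\{\rho<0\}$, $\nabla\rho\neq0$), $D^2\rho(x)+tP_\nu\in\mathrm{Int}F$ for all large $t$, $\nu$ the unit normal. $H\approx g$ at $x_0$ means $H-g$ is bounded near $x_0$. *)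

theory Defs
  imports "HOL-Analysis.Analysis"
begin

definition Sym :: "(real^'n^'n) set" where
  "Sym = {A. transpose A = A}"

definition psd :: "real^'n^'n \<Rightarrow> bool" where
  "psd P \<longleftrightarrow> transpose P = P \<and> (\<forall>x. 0 \<le> x \<bullet> (P *v x))"

definition sym_interior :: "(real^'n^'n) set \<Rightarrow> (real^'n^'n) set" where
  "sym_interior F = {A \<in> Sym. \<exists>e>0. \<forall>B\<in>Sym. dist B A < e \<longrightarrow> B \<in> F}"

definition sym_boundary :: "(real^'n^'n) set \<Rightarrow> (real^'n^'n) set" where
  "sym_boundary F = closure F - sym_interior F"

definition cone_subequation :: "(real^'n^'n) set \<Rightarrow> bool" where
  "cone_subequation F \<longleftrightarrow> F \<subseteq> Sym \<and> closed F \<and>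
     (\<forall>A\<in>F. \<forall>P. psd P \<longrightarrow> A + P \<in> F) \<and>
     (\<forall>t>0. (\<lambda>A. t *\<^sub>R A) ` F = F)"

definition dual_subeq :: "(real^'n^'n) set \<Rightarrow> (real^'n^'n) set" where
  "dual_subeq F = {A \<in> Sym. - A \<notin> sym_interior F}"

definition proj_line :: "real^'n \<Rightarrow> real^'n^'n" where
  "proj_line e = (\<chi> i j. e$i * e$j)"

definition proj_perp :: "real^'n \<Rightarrow> real^'n^'n" where
  "proj_perp e = mat 1 - proj_line e"

definition finite_riesz_char :: "(real^'n^'n) set \<Rightarrow> real \<Rightarrow> bool" where
  "finite_riesz_char F p \<longleftrightarrow>
     (\<forall>e::real^'n. norm e = 1 \<longrightarrow> proj_perp e - (p - 1) *\<^sub>R proj_line e \<in> sym_boundary F)"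

definition C2_hessian_at :: "(real^'n \<Rightarrow> real) \<Rightarrow> real^'n \<Rightarrow> real^'n^'n \<Rightarrow> bool" where
  "C2_hessian_at phi x0 A \<longleftrightarrow>
     (\<exists>r>0. \<exists>g Hf.
        (\<forall>y\<in>ball x0 r. (phi has_derivative (\<lambda>h. g y \<bullet> h)) (at y)) \<and>
        (\<forall>y\<in>ball x0 r. (g has_derivative (\<lambda>h. Hf y *v h)) (at y)) \<and>
        continuous_on (ball x0 r) Hf \<and> A = Hf x0)"

definition usc_on :: "(real^'n) set \<Rightarrow> (real^'n \<Rightarrow> ereal) \<Rightarrow> bool" where
  "usc_on X u \<longleftrightarrow> (\<forall>x\<in>X. \<forall>c. u x < c \<longrightarrow> (\<forall>\<^sub>F y in at x within X. u y < c))"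

definition F_subharmonic :: "(real^'n^'n) set \<Rightarrow> (real^'n) set \<Rightarrow> (real^'n \<Rightarrow> ereal) \<Rightarrow> bool" where
  "F_subharmonic F X u \<longleftrightarrow>
     (\<forall>x\<in>X. u x \<noteq> \<infinity>) \<and> usc_on X u \<and>
     (\<forall>x0\<in>X. \<forall>phi A. C2_hessian_at phi x0 A \<and>
         (\<exists>r>0. \<forall>y\<in>ball x0 r \<inter> X. u y \<le> ereal (phi y)) \<and> u x0 = ereal (phi x0)
         \<longrightarrow> A \<in> F)"

definition F_harmonic :: "(real^'n^'n) set \<Rightarrow> (real^'n) set \<Rightarrow> (real^'n \<Rightarrow> real) \<Rightarrow> bool" where
  "F_harmonic F X u \<longleftrightarrow> continuous_on X u \<and>
     F_subharmonic F X (\<lambda>x. ereal (u x)) \<and>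
     F_subharmonic (dual_subeq F) X (\<lambda>x. ereal (- u x))"

definition riesz_kernel :: "real \<Rightarrow> real^'n \<Rightarrow> real" where
  "riesz_kernel p x = (if p = 2 then ln (norm x) else - (1 / (p - 2)) * norm x powr (2 - p))"

text \<open>C^infinity on an open set U: a family D of all iterated partial derivatives,
  D (i # ks) = partial derivative in direction i of D ks, all continuous.\<close>
definition C_inf_on :: "(real^'n) set \<Rightarrow> (real^'n \<Rightarrow> real) \<Rightarrow> bool" where
  "C_inf_on U f \<longleftrightarrow> (\<exists>D :: 'n list \<Rightarrow> real^'n \<Rightarrow> real.
     (\<forall>x\<in>U. D [] x = f x) \<and> (\<forall>ks. continuous_on U (D ks)) \<and>
     (\<forall>ks. \<forall>x\<in>U. (D ks has_derivative (\<lambda>h. \<Sum>i\<in>UNIV. h$i * D (i # ks) x)) (at x)))"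

definition grad_at :: "(real^'n \<Rightarrow> real) \<Rightarrow> real^'n \<Rightarrow> real^'n \<Rightarrow> bool" where
  "grad_at f x g \<longleftrightarrow> (f has_derivative (\<lambda>h. g \<bullet> h)) (at x)"

definition hess_at :: "(real^'n \<Rightarrow> real) \<Rightarrow> real^'n \<Rightarrow> real^'n^'n \<Rightarrow> bool" where
  "hess_at f x A \<longleftrightarrow> (\<exists>r>0. \<exists>g. (\<forall>y\<in>ball x r. grad_at f y (g y)) \<and>
       (g has_derivative (\<lambda>h. A *v h)) (at x))"

definition local_defining_fn :: "(real^'n) set \<Rightarrow> real^'n \<Rightarrow> (real^'n \<Rightarrow> real) \<Rightarrow> bool" where
  "local_defining_fn \<Omega> x rho \<longleftrightarrow> (\<exists>U. open U \<and> x \<in> U \<and> C_inf_on U rho \<and>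
      \<Omega> \<inter> U = {y\<in>U. rho y < 0} \<and>
      (\<forall>y\<in>U. \<forall>g. grad_at rho y g \<longrightarrow> g \<noteq> 0))"

definition smooth_boundary :: "(real^'n) set \<Rightarrow> bool" where
  "smooth_boundary \<Omega> \<longleftrightarrow> (\<forall>x\<in>frontier \<Omega>. \<exists>rho. local_defining_fn \<Omega> x rho)"

definition strictly_F_convex_boundary :: "(real^'n^'n) set \<Rightarrow> (real^'n) set \<Rightarrow> bool" where
  "strictly_F_convex_boundary F \<Omega> \<longleftrightarrow>
     (\<forall>x\<in>frontier \<Omega>. \<forall>rho g A. local_defining_fn \<Omega> x rho \<and> grad_at rho x g \<and> hess_at rho x A \<longrightarrow>
        (\<exists>T. \<forall>t\<ge>T. A + t *\<^sub>R proj_line (g /\<^sub>R norm g) \<in> sym_interior F))"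

end

theory Submission
  imports Defs
begin

text \<open>Existence is Perron's method. Subsolutions with the given boundary values and at most the given
  poles lie below \<open>\<Theta>\<^sub>s K(x - s) + C\<close> for every pole \<open>s\<close>, with \<open>C\<close> independent of the subsolution, and
  \<open>\<Sum>\<^sub>s \<Theta>\<^sub>s K(x - s) - c\<close> is one of them; convexity of \<open>F\<close> matters only for the latter when there are
  several poles. In comparisons the poles are harmless: \<open>F\<close> is a cone, so \<open>(1 + \<epsilon>) u\<close> is subharmonic
  along with \<open>u\<close>, and \<open>(1 + \<epsilon>) u + v\<close> tends to \<open>-\<infinity>\<close> at a pole if the singularities of \<open>u\<close> and \<open>v\<close>
  cancel up to a bounded term. The boundary is also strictly convex for the dual
  subequation, because \<open>-P\<^sub>e \<notin> F\<close> puts \<open>P\<^sub>e\<close> into the interior of the dual.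

  Comparison of semicontinuous functions \<open>u\<close> and \<open>v\<close> passes to their sup-convolutions \<open>U\<close> and \<open>V\<close>. If
  \<open>U + V\<close> has an interior maximum, its contact set with its concave envelope has positive
  measure, and there is a \<open>C\<^sup>1\<^sup>,\<^sup>1\<close> function \<open>G\<close> with \<open>U \<le> G\<close> and \<open>V \<le> envelope - G\<close>, with equality on the contact set.
  Alexandrov's theorem is not needed: it suffices that at some contact point and some small scale \<open>r\<close>
  the function \<open>G\<close> is within \<open>\<eta> r\<^sup>2\<close> of a quadratic polynomial, which can then be slid until it touches.\<close>

section \<open>Second-order approximation at a single scale\<close>

text \<open>The characteristic \<open>p\<close> enters through the Hessian of the kernel, off the
  pole a positive multiple of \<open>proj_perp e - (p - 1) *\<^sub>R proj_line e\<close>: it lies in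
  \<open>F\<close> but not in the interior, so the kernel is subharmonic for \<open>F\<close> and
  its negative for the dual. With p >= 2 the kernel tends to minus infinity at the pole. The
  obstacle in comparison is that a closed set of matrices offers no equation to linearise. A
  contradiction needs a single matrix A with A + \<eta> I a test Hessian for u and - A + \<eta> I
  one for v. Hence one function is squeezed between U and the envelope minus V, and A is read off
  from its second differences on a lattice of mesh s. The resulting polynomial is accurate if the
  third differences are o(s^2); two-sided second-order bounds give only O(s^2). The gain is an L^2
  fact: second difference quotients at step 2s average those at step s, so their energy is monotone,
  and third differences are small off sets of small measure. Such sets cannot cover the contact set,
  whose measure is positive because the slopes of its touching planes fill a ball and depend on the
  contact point in a Lipschitz way.\<close>

definition diff2 :: "('a::real_vector \<Rightarrow> real) \<Rightarrow> 'a \<Rightarrow> 'a \<Rightarrow> 'a \<Rightarrow> real" where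
  "diff2 G a b x = G (x + a + b) - G (x + a) - G (x + b) + G x"

lemma set_integrable_cball:
  fixes f :: "'a::euclidean_space \<Rightarrow> real"
  assumes "continuous_on UNIV f"
  shows "integrable lborel (\<lambda>x. indicator (cball z r) x * f x)"
proof -
  have "integrable lborel (\<lambda>x. indicator (cball z r) x *\<^sub>R f x)"
    by (rule borel_integrable_compact) (use assms continuous_on_subset in auto)
  then show ?thesis by simp
qed

text \<open>Translation invariance of Lebesgue measure: the shifted ball of radius \<open>r\<close>
  still lies in the ball of radius \<open>r'\<close>. This compares energies at translated base
  points with one energy on a slightly larger ball.\<close>

lemma integral_cball_translate_le:
  fixes f :: "'a::euclidean_space \<Rightarrow> real"
  assumes f: "continuous_on UNIV f" and nn: "\<And>x. 0 \<le> f x" and c: "r + norm c \<le> r'"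
  shows "(\<integral>x. indicator (cball 0 r) x * f (x + c) \<partial>lborel) \<le> (\<integral>x. indicator (cball 0 r') x * f x \<partial>lborel)"
proof -
  have fm: "(\<lambda>x. indicator (cball 0 r') x * f x) \<in> borel_measurable borel"
    by (intro borel_measurable_times borel_measurable_indicator borel_measurable_continuous_onI f) auto
  have "(\<integral>x. indicator (cball 0 r') x * f x \<partial>lborel) = (\<integral>x. indicator (cball 0 r') x * f x \<partial>(distr lborel borel ((+) c)))"
    by (simp add: lborel_distr_plus)
  also have "\<dots> = (\<integral>x. indicator (cball 0 r') (c + x) * f (c + x) \<partial>lborel)"
    by (rule integral_distr) (use fm in auto)
  finally have eq: "(\<integral>x. indicator (cball 0 r') x * f x \<partial>lborel) = (\<integral>x. indicator (cball (-c) r') x * f (x + c) \<partial>lborel)"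
    by (simp add: add.commute indicator_def dist_norm norm_minus_commute)
  show ?thesis unfolding eq
  proof (rule integral_mono)
    have cont: "continuous_on UNIV (\<lambda>x. f (x + c))"
      by (intro continuous_on_compose2[OF f] continuous_intros) auto
    show "integrable lborel (\<lambda>x. indicator (cball 0 r) x * f (x + c))"
      "integrable lborel (\<lambda>x. indicator (cball (-c) r') x * f (x + c))"
      by (intro set_integrable_cball cont)+
    fix x :: 'a
    have "x \<in> cball 0 r \<Longrightarrow> x \<in> cball (-c) r'"
      using c norm_triangle_ineq[of x c] by (simp add: dist_norm norm_minus_commute[of "-c" x])
    then show "indicator (cball 0 r) x * f (x + c) \<le> indicator (cball (-c) r') x * f (x + c)"
      using nn by (auto simp: indicator_def)
  qed
qed

lemma average4_le:
  fixes p :: real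
  shows "p \<le> J \<Longrightarrow> q \<le> J \<Longrightarrow> r \<le> J \<Longrightarrow> t \<le> J \<Longrightarrow> (p + q + r + t) / 4 \<le> J"
  by simp

text \<open>The parallelogram with sides 2a, 2b splits into four translates of the one with sides a,
  b, and second differences add up over the pieces. After division by the squared step this is an
  average of four values.\<close>

lemma diff2_refine:
  "diff2 G (2 *\<^sub>R a) (2 *\<^sub>R b) x =
     diff2 G a b x + diff2 G a b (x + a) + diff2 G a b (x + b) + diff2 G a b (x + a + b)"
  by (simp add: diff2_def scaleR_2 algebra_simps)

text \<open>Jensen's inequality for a mean of four numbers with part of the variance kept: the
  variance is the sum of the six squared pairwise differences over 16, and one of them is
  retained.\<close>

lemma four_point_variance:
  fixes p q r t :: real
  shows "((p + q + r + t) / 4)\<^sup>2 + (q - p)\<^sup>2 / 16 \<le> (p\<^sup>2 + q\<^sup>2 + r\<^sup>2 + t\<^sup>2) / 4"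
proof -
  have "(p\<^sup>2 + q\<^sup>2 + r\<^sup>2 + t\<^sup>2) / 4 - ((p + q + r + t) / 4)\<^sup>2 =
    ((q - p)\<^sup>2 + (r - p)\<^sup>2 + (t - p)\<^sup>2 + (r - q)\<^sup>2 + (t - q)\<^sup>2 + (t - r)\<^sup>2) / 16"
    by (simp add: power2_eq_square field_simps)
  moreover have "\<dots> \<ge> (q - p)\<^sup>2 / 16" by simp
  ultimately show ?thesis by linarith
qed

text \<open>The difference quotients at step \<open>2s\<close> are averages of four translates of those at step \<open>s\<close>,
  so their \<open>L\<^sup>2\<close> energy grows under refinement; being bounded it stabilises, which forces the
  translates to agree asymptotically.\<close>

lemma third_difference_small:
  fixes G :: "'a::euclidean_space \<Rightarrow> real"
  assumes G: "continuous_on UNIV G"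
    and bd: "\<And>s x. 0 < s \<Longrightarrow> \<bar>diff2 G (s *\<^sub>R a) (s *\<^sub>R b) x\<bar> \<le> C * s\<^sup>2"
    and t: "0 < \<tau>" and e: "0 < e"
  defines "s \<equiv> (\<lambda>k::nat. (1/2::real) ^ k)"
  shows "\<forall>\<^sub>F k in sequentially. \<exists>T. T \<in> lmeasurable \<and> measure lebesgue T < e \<and>
     (\<forall>x\<in>cball 0 R - T. \<bar>diff2 G (s k *\<^sub>R a) (s k *\<^sub>R b) (x + s k *\<^sub>R a) - diff2 G (s k *\<^sub>R a) (s k *\<^sub>R b) x\<bar> \<le> \<tau> * (s k)\<^sup>2)"
proof -
  define q where "q k x = diff2 G (s k *\<^sub>R a) (s k *\<^sub>R b) x / (s k)\<^sup>2" for k x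
  define M where "M = norm a + norm b"
  \<comment> \<open>The radius grows with \<open>k\<close> by \<open>2 * M * s (Suc k)\<close>,
    enough for the translations in \<open>ref\<close>, so translated balls stay inside the next one;
    all radii remain below \<open>R + 2 * M\<close>.\<close>
  define J where "J k = (\<integral>x. indicator (cball 0 (R + 2 * M * (1 - s k))) x * (q k x)\<^sup>2 \<partial>lborel)" for k
  define D where "D k = (\<integral>x. indicator (cball 0 R) x * (q k (x + s k *\<^sub>R a) - q k x)\<^sup>2 \<partial>lborel)" for k
  have s0: "0 < s k" "s k \<le> 1" "s k = 2 * s (Suc k)" for k by (auto simp: s_def power_le_one)
  have M0: "M \<ge> 0" by (simp add: M_def)
  have cq: "continuous_on UNIV (\<lambda>x. q k (x + c))" for k c
    unfolding q_def diff2_def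
    by (intro continuous_intros continuous_on_compose2[OF G]) (use s0[of k] in auto)
  have cq0: "continuous_on UNIV (q k)" for k using cq[of k 0] by simp
  have bq: "\<bar>q k x\<bar> \<le> C" for k x
    using bd[OF s0(1)[of k], of x] s0(1)[of k] by (simp add: q_def abs_mult divide_le_eq)
  have C0: "C \<ge> 0" using bq[of 0 0] by linarith
  have ref: "q k x = (q (Suc k) x + q (Suc k) (x + s (Suc k) *\<^sub>R a) + q (Suc k) (x + s (Suc k) *\<^sub>R b)
      + q (Suc k) (x + s (Suc k) *\<^sub>R a + s (Suc k) *\<^sub>R b)) / 4" for k x
    using diff2_refine[of G "s (Suc k) *\<^sub>R a" "s (Suc k) *\<^sub>R b" x] s0(1)[of "Suc k"]
    by (simp add: q_def s0(3)[of k] field_simps power2_eq_square)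
  \<comment> \<open>Integrated form of \<open>four_point_variance\<close>: the energy gained by
    halving the step dominates the squared L^2 norm \<open>D\<close> of the translation
    defect.\<close>
  have step: "J k + D (Suc k) / 16 \<le> J (Suc k)" for k
  proof -
    let ?s = "s (Suc k)" let ?r = "R + 2 * M * (1 - s k)" let ?r' = "R + 2 * M * (1 - s (Suc k))"
    let ?q = "q (Suc k)"
    have rr: "R \<le> ?r" using M0 s0(2)[of k] by simp
    have r': "?r + 2 * (?s * M) = ?r'" by (simp add: s0(3)[of k] algebra_simps)
    have nb: "norm (?s *\<^sub>R a) \<le> 2 * (?s * M)" "norm (?s *\<^sub>R b) \<le> 2 * (?s * M)" "norm (?s *\<^sub>R a + ?s *\<^sub>R b) \<le> 2 * (?s * M)" "norm (0::'a) \<le> 2 * (?s * M)"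
    proof -
      have "norm (?s *\<^sub>R a) = ?s * norm a" "norm (?s *\<^sub>R b) = ?s * norm b" using s0(1)[of "Suc k"] by auto
      moreover have "norm (?s *\<^sub>R a + ?s *\<^sub>R b) \<le> norm (?s *\<^sub>R a) + norm (?s *\<^sub>R b)" by (rule norm_triangle_ineq)
      moreover have "2 * (?s * M) = 2 * (?s * norm a) + 2 * (?s * norm b)" by (simp add: M_def algebra_simps)
      moreover have "0 \<le> ?s * norm a" "0 \<le> ?s * norm b" using s0(1)[of "Suc k"] by auto
      ultimately show "norm (?s *\<^sub>R a) \<le> 2 * (?s * M)" "norm (?s *\<^sub>R b) \<le> 2 * (?s * M)" "norm (?s *\<^sub>R a + ?s *\<^sub>R b) \<le> 2 * (?s * M)" "norm (0::'a) \<le> 2 * (?s * M)"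
        by auto
    qed
    have c2: "continuous_on UNIV (\<lambda>x. (?q x)\<^sup>2)" by (intro continuous_intros cq0)
    have tr: "(\<integral>x. indicator (cball 0 ?r) x * (?q (x + c))\<^sup>2 \<partial>lborel) \<le> J (Suc k)" if "norm c \<le> 2 * (?s * M)" for c
      unfolding J_def using integral_cball_translate_le[OF c2, of ?r c ?r'] that r' by simp
    have I: "integrable lborel (\<lambda>x. indicator (cball 0 ?r) x * (?q (x + c))\<^sup>2)" for c
      by (intro set_integrable_cball continuous_intros cq)
    have I': "integrable lborel (\<lambda>x. indicator (cball 0 ?r) x * (q k x)\<^sup>2)"
      by (intro set_integrable_cball continuous_intros cq0)
    have I2: "integrable lborel (\<lambda>x. indicator (cball 0 R) x * (?q (x + ?s *\<^sub>R a) - ?q x)\<^sup>2)"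
      by (intro set_integrable_cball continuous_intros cq cq0)
    have "J k + D (Suc k) / 16 = (\<integral>x. indicator (cball 0 ?r) x * (q k x)\<^sup>2 + indicator (cball 0 R) x * (?q (x + ?s *\<^sub>R a) - ?q x)\<^sup>2 / 16 \<partial>lborel)"
      unfolding J_def D_def using I' I2 by (simp add: Bochner_Integration.integral_add)
    also have "\<dots> \<le> (\<integral>x. (indicator (cball 0 ?r) x * (?q (x + 0))\<^sup>2 + indicator (cball 0 ?r) x * (?q (x + ?s *\<^sub>R a))\<^sup>2
        + indicator (cball 0 ?r) x * (?q (x + ?s *\<^sub>R b))\<^sup>2 + indicator (cball 0 ?r) x * (?q (x + (?s *\<^sub>R a + ?s *\<^sub>R b)))\<^sup>2) / 4 \<partial>lborel)"
    proof (rule integral_mono)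
      fix x :: 'a
      have v: "(q k x)\<^sup>2 + (?q (x + ?s *\<^sub>R a) - ?q x)\<^sup>2 / 16 \<le>
         ((?q (x + 0))\<^sup>2 + (?q (x + ?s *\<^sub>R a))\<^sup>2 + (?q (x + ?s *\<^sub>R b))\<^sup>2 + (?q (x + (?s *\<^sub>R a + ?s *\<^sub>R b)))\<^sup>2) / 4"
        using four_point_variance[of "?q x" "?q (x + ?s *\<^sub>R a)" "?q (x + ?s *\<^sub>R b)" "?q (x + ?s *\<^sub>R a + ?s *\<^sub>R b)"]
        by (simp add: ref[of k x] add.assoc)
      have m: "indicator (cball 0 R) x \<le> (indicator (cball 0 ?r) x :: real)"
        using rr by (auto simp: indicator_def)
      have "indicator (cball 0 R) x * (?q (x + ?s *\<^sub>R a) - ?q x)\<^sup>2 / 16 \<le> indicator (cball 0 ?r) x * (?q (x + ?s *\<^sub>R a) - ?q x)\<^sup>2 / 16"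
        using m by (intro divide_right_mono mult_right_mono) auto
      then show "indicator (cball 0 ?r) x * (q k x)\<^sup>2 + indicator (cball 0 R) x * (?q (x + ?s *\<^sub>R a) - ?q x)\<^sup>2 / 16 \<le>
        (indicator (cball 0 ?r) x * (?q (x + 0))\<^sup>2 + indicator (cball 0 ?r) x * (?q (x + ?s *\<^sub>R a))\<^sup>2
        + indicator (cball 0 ?r) x * (?q (x + ?s *\<^sub>R b))\<^sup>2 + indicator (cball 0 ?r) x * (?q (x + (?s *\<^sub>R a + ?s *\<^sub>R b)))\<^sup>2) / 4"
        using v by (cases "x \<in> cball 0 ?r") (auto simp: indicator_def)
    qed (use I I' I2 in \<open>auto intro!: Bochner_Integration.integrable_add integrable_divide simp del: add_0_right\<close>)
    also have "\<dots> = ((\<integral>x. indicator (cball 0 ?r) x * (?q (x + 0))\<^sup>2 \<partial>lborel) + (\<integral>x. indicator (cball 0 ?r) x * (?q (x + ?s *\<^sub>R a))\<^sup>2 \<partial>lborel)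
        + (\<integral>x. indicator (cball 0 ?r) x * (?q (x + ?s *\<^sub>R b))\<^sup>2 \<partial>lborel) + (\<integral>x. indicator (cball 0 ?r) x * (?q (x + (?s *\<^sub>R a + ?s *\<^sub>R b)))\<^sup>2 \<partial>lborel)) / 4"
      using I[of 0] I[of "?s *\<^sub>R a"] I[of "?s *\<^sub>R b"] I[of "?s *\<^sub>R a + ?s *\<^sub>R b"]
      by (simp add: Bochner_Integration.integral_add)
    also have "\<dots> \<le> J (Suc k)"
      by (intro average4_le tr nb)
    finally show ?thesis .
  qed
  have Dnn: "0 \<le> D k" for k unfolding D_def by (rule Bochner_Integration.integral_nonneg) auto
  have inc: "incseq J"
  proof (rule incseq_SucI)
    show "J k \<le> J (Suc k)" for k using step[of k] Dnn[of "Suc k"] by simp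
  qed
  have Jb: "J k \<le> (\<integral>x. indicator (cball 0 (R + 2 * M)) (x::'a) * C\<^sup>2 \<partial>lborel)" for k
    unfolding J_def
  proof (rule integral_mono)
    show "integrable lborel (\<lambda>x. indicator (cball 0 (R + 2 * M * (1 - s k))) x * (q k x)\<^sup>2)"
      by (intro set_integrable_cball continuous_intros cq0)
    show "integrable lborel (\<lambda>x. indicator (cball 0 (R + 2 * M)) (x::'a) * C\<^sup>2)"
      by (intro set_integrable_cball continuous_intros)
    fix x :: 'a
    have "(q k x)\<^sup>2 \<le> C\<^sup>2" using bq[of k x] C0 by (metis abs_of_nonneg power2_abs power_mono abs_ge_zero)
    moreover have "x \<in> cball 0 (R + 2 * M * (1 - s k)) \<Longrightarrow> x \<in> cball 0 (R + 2 * M)"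
    proof -
      have "0 \<le> M * s k" using M0 s0(1)[of k] by simp
      then show "x \<in> cball 0 (R + 2 * M * (1 - s k)) \<Longrightarrow> x \<in> cball 0 (R + 2 * M)"
        by (simp add: algebra_simps)
    qed
    ultimately show "indicator (cball 0 (R + 2 * M * (1 - s k))) x * (q k x)\<^sup>2 \<le> indicator (cball 0 (R + 2 * M)) x * C\<^sup>2"
      by (auto simp: indicator_def)
  qed
  obtain L where L: "J \<longlonglongrightarrow> L" using incseq_convergent[OF inc] Jb by metis
  have "(\<lambda>k. 16 * (J (Suc k) - J k)) \<longlonglongrightarrow> 16 * (L - L)"
    by (intro tendsto_intros LIMSEQ_Suc L)
  then have lim16: "(\<lambda>k. 16 * (J (Suc k) - J k)) \<longlonglongrightarrow> 0" by simp
  \<comment> \<open>Increments of a bounded increasing sequence tend to 0, and \<open>step\<close>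
    bounds \<open>D\<close> by 16 times an increment.\<close>
  have lim: "(\<lambda>k. D (Suc k)) \<longlonglongrightarrow> 0"
  proof (rule tendsto_sandwich[OF _ _ tendsto_const lim16])
    show "\<forall>\<^sub>F n in sequentially. 0 \<le> D (Suc n)" using Dnn by simp
    show "\<forall>\<^sub>F n in sequentially. D (Suc n) \<le> 16 * (J (Suc n) - J n)"
      using step by (intro always_eventually allI) (simp add: field_simps)
  qed
  then have lim: "D \<longlonglongrightarrow> 0" by (simp add: filterlim_sequentially_Suc)
  have "\<forall>\<^sub>F k in sequentially. D k < e * \<tau>\<^sup>2"
    using order_tendstoD(2)[OF lim, of "e * \<tau>\<^sup>2"] t e by simp
  then show ?thesis
  proof eventually_elim
    case (elim k)
    let ?f = "\<lambda>x. q k (x + s k *\<^sub>R a) - q k x"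
    \<comment> \<open>Chebyshev's inequality: \<open>\<tau>\<^sup>2\<close> times the measure of
      \<open>T\<close> is at most \<open>D k\<close>, which is below
      \<open>e * \<tau>\<^sup>2\<close>.\<close>
    define T where "T = cball 0 R \<inter> {x. \<tau> < \<bar>?f x\<bar>}"
    have cf: "continuous_on UNIV ?f" by (intro continuous_intros cq cq0)
    have "open {x. \<tau> < \<bar>?f x\<bar>}" by (intro open_Collect_less continuous_intros cf)
    then have Tb: "T \<in> sets borel" unfolding T_def by auto
    have Tl: "T \<in> lmeasurable" unfolding T_def
      by (rule bounded_set_imp_lmeasurable) (use Tb bounded_subset[OF bounded_cball, of T 0 R] in \<open>auto simp: T_def intro!: bounded_Int sets_completionI_sets\<close>)
    have fin: "emeasure lborel T < \<infinity>"
      using emeasure_bounded_finite[of T] bounded_subset[OF bounded_cball, of T 0 R] unfolding T_def by auto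
    have "\<tau>\<^sup>2 * measure lborel T = (\<integral>x. indicator T x * \<tau>\<^sup>2 \<partial>lborel)" by simp
    also have "\<dots> \<le> D k" unfolding D_def
    proof (rule integral_mono)
      show "integrable lborel (\<lambda>x. indicator T x * \<tau>\<^sup>2)" using fin Tb by simp
      show "integrable lborel (\<lambda>x. indicator (cball 0 R) x * (?f x)\<^sup>2)"
        by (intro set_integrable_cball continuous_intros cf)
      fix x
      have "x \<in> T \<Longrightarrow> \<tau>\<^sup>2 \<le> (?f x)\<^sup>2" using t unfolding T_def
        by (metis (mono_tags, lifting) IntD2 abs_le_square_iff abs_of_pos less_imp_le mem_Collect_eq)
      then show "indicator T x * \<tau>\<^sup>2 \<le> indicator (cball 0 R) x * (?f x)\<^sup>2"
        by (auto simp: indicator_def T_def)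
    qed
    finally have "measure lborel T < e" using elim t
      by (smt (verit) mult.commute mult_le_cancel_left_pos zero_less_power)
    then have "measure lebesgue T < e" using Tb by (simp add: measure_completion)
    moreover have "\<bar>diff2 G (s k *\<^sub>R a) (s k *\<^sub>R b) (x + s k *\<^sub>R a) - diff2 G (s k *\<^sub>R a) (s k *\<^sub>R b) x\<bar> \<le> \<tau> * (s k)\<^sup>2"
      if "x \<in> cball 0 R - T" for x
    proof -
      have "\<bar>?f x\<bar> \<le> \<tau>" using that by (auto simp: T_def)
      then show ?thesis using s0(1)[of k] unfolding q_def
        by (simp add: diff_divide_distrib[symmetric] abs_divide divide_le_eq)
    qed
    ultimately show ?case using Tl by blast
  qed
qed

section \<open>Third differences on a lattice of small mesh\<close>

definition diff3 :: "('a::real_vector \<Rightarrow> real) \<Rightarrow> 'a \<Rightarrow> 'a \<Rightarrow> 'a \<Rightarrow> 'a \<Rightarrow> real" where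
  "diff3 G a b c x = diff2 G a b (x + c) - diff2 G a b x"

text \<open>\<open>third_difference_small\<close> controls only third differences whose shift
  repeats another direction. Third differences are symmetric in the directions and additive up to
  shifts of the base point, so three distinct directions follow from the repeated direction
  \<open>a + c\<close>.\<close>

lemma diff3_polarize:
  "2 * diff3 G a b c x = diff3 G (a + c) b (a + c) (x - c) - diff3 G a b a (x + c) - diff3 G c b c (x - c)"
  by (simp add: diff3_def diff2_def algebra_simps)

text \<open>Lattice points are indexed by functions into the naturals, so that a walk from the
  corner along coordinate steps is an induction on the sum of the coordinates.\<close>

definition lattice_vec :: "('n::finite \<Rightarrow> nat) \<Rightarrow> real^'n" where
  "lattice_vec f = (\<chi> i. real (f i))"

lemma lattice_vec_upd:
  assumes "f i = Suc k"
  shows "lattice_vec f = lattice_vec (f(i := k)) + axis i 1"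
  using assms by (auto simp: lattice_vec_def vec_eq_iff axis_def)

lemma finite_bounded_nat_funs: "finite {f::'n::finite \<Rightarrow> nat. \<forall>j. f j \<le> N}"
proof -
  have "{f::'n::finite \<Rightarrow> nat. \<forall>j. f j \<le> N} \<subseteq> PiE UNIV (\<lambda>_. {..N})" by auto
  then show ?thesis by (rule finite_subset) (auto intro: finite_PiE)
qed

text \<open>Every lattice point of the box is reached from the corner by at most
  \<open>CARD('n) * M\<close> unit steps inside the box, and each step changes \<open>g\<close> by
  at most \<open>\<beta>\<close>.\<close>

lemma lattice_walk:
  fixes g :: "real^'n \<Rightarrow> real"
  assumes st: "\<And>f i. (\<forall>j. f j \<le> M) \<Longrightarrow> \<bar>g (z + s *\<^sub>R lattice_vec f + s *\<^sub>R axis i 1) - g (z + s *\<^sub>R lattice_vec f)\<bar> \<le> \<beta>"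
    and f: "\<forall>j. f j \<le> M" and z: "g z = 0" and b: "0 \<le> \<beta>"
  shows "\<bar>g (z + s *\<^sub>R lattice_vec f)\<bar> \<le> real CARD('n) * real M * \<beta>"
proof -
  have main: "\<lbrakk>sum f UNIV = n; \<forall>j. f j \<le> M\<rbrakk> \<Longrightarrow> \<bar>g (z + s *\<^sub>R lattice_vec f)\<bar> \<le> real n * \<beta>" for n f
  proof (induction n arbitrary: f)
    case 0
    then have "lattice_vec f = 0" by (simp add: lattice_vec_def vec_eq_iff)
    then show ?case using z by simp
  next
    case (Suc n)
    then obtain i where "f i \<noteq> 0" by (metis Suc_neq_Zero sum.neutral)
    then obtain k where k: "f i = Suc k" by (cases "f i") auto
    let ?f = "f(i := k)"
    have "sum f UNIV = f i + sum f (UNIV - {i})" by (simp add: sum.remove)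
    moreover have "sum ?f UNIV = k + sum ?f (UNIV - {i})" by (subst sum.remove[of _ i]) auto
    moreover have "sum ?f (UNIV - {i}) = sum f (UNIV - {i})" by (rule sum.cong) auto
    ultimately have s: "sum ?f UNIV = n" using Suc.prems(1) k by simp
    have le: "\<forall>j. ?f j \<le> M" using Suc.prems(2) k by (auto simp: fun_upd_def dest: spec[of _ i])
    have eq: "z + s *\<^sub>R lattice_vec f = z + s *\<^sub>R lattice_vec ?f + s *\<^sub>R axis i 1"
      by (simp add: lattice_vec_upd[where f=f and i=i and k=k, OF k] scaleR_add_right)
    have "\<bar>g (z + s *\<^sub>R lattice_vec ?f)\<bar> \<le> real n * \<beta>" by (rule Suc.IH[OF s le])
    moreover have "\<bar>g (z + s *\<^sub>R lattice_vec f) - g (z + s *\<^sub>R lattice_vec ?f)\<bar> \<le> \<beta>"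
      unfolding eq by (rule st[OF le])
    ultimately show ?case by (simp add: algebra_simps)
  qed
  have "sum f UNIV \<le> CARD('n) * M" using sum_bounded_above[of UNIV f M] f by simp
  then have "real (sum f UNIV) * \<beta> \<le> real (CARD('n) * M) * \<beta>" using b by (intro mult_right_mono of_nat_mono)
  then show ?thesis using main[OF refl f] by simp
qed

text \<open>At every small enough dyadic step, finitely many third-difference conditions fail only
  on a set of small measure. A set \<open>E\<close> that is not negligible therefore contains a
  point where all of them hold at once.\<close>

lemma third_differences_small_somewhere:
  fixes G :: "real^'n \<Rightarrow> real" and c :: "real^'n"
  assumes G: "continuous_on UNIV G"
    and bd: "\<And>a b s x. 0 < s \<Longrightarrow> \<bar>diff2 G (s *\<^sub>R a) (s *\<^sub>R b) x\<bar> \<le> C a b * s\<^sup>2"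
    and E: "bounded E" "\<not> negligible E" and t: "0 < \<tau>" and r0: "0 < r0"
  obtains x s where "x \<in> E" "0 < s" "s < r0"
    "\<And>f i j l. (\<forall>j. f j \<le> N) \<Longrightarrow>
      \<bar>diff3 G (s *\<^sub>R axis i 1) (s *\<^sub>R axis j 1) (s *\<^sub>R axis l 1) (x + s *\<^sub>R c + s *\<^sub>R lattice_vec f)\<bar> \<le> \<tau> * s\<^sup>2"
proof -
  define \<sigma> where "\<sigma> k = (1/2::real) ^ k" for k :: nat
  have s0: "0 < \<sigma> k" "\<sigma> k \<le> 1" for k by (auto simp: \<sigma>_def power_le_one)
  \<comment> \<open>These are the directions and base points that \<open>diff3_polarize\<close> asks
    for: sums of two axis vectors for the polarised direction, and shifts by plus or minus an axis
    vector for the base points.\<close>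
  define A where "A = range (\<lambda>i::'n. axis i (1::real)) \<union> range (\<lambda>(i::'n, l::'n). axis i (1::real) + axis l 1)"
  define U where "U = range (\<lambda>i::'n. axis i (1::real)) \<union> range (\<lambda>i::'n. - axis i (1::real))"
  define P where "P = (\<lambda>(f, u). c + lattice_vec f + u) ` ({f::'n \<Rightarrow> nat. \<forall>j. f j \<le> N} \<times> U)"
  define W where "W = (A \<times> A) \<times> P"
  have fP: "finite P" unfolding P_def U_def by (intro finite_imageI finite_cartesian_product finite_bounded_nat_funs) auto
  have fW: "finite W" unfolding W_def A_def by (intro finite_cartesian_product fP) auto
  obtain B where B: "\<And>p. p \<in> P \<Longrightarrow> norm p \<le> B"
    using finite_imp_bounded[OF fP] by (auto simp: bounded_iff)
  obtain R where R: "\<And>x. x \<in> E \<Longrightarrow> norm x \<le> R" using E(1) by (auto simp: bounded_iff)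
  define R' where "R' = R + B"
  have good: "\<forall>\<^sub>F k in sequentially. \<exists>T. T \<in> lmeasurable \<and> measure lebesgue T < e \<and>
     (\<forall>x\<in>cball 0 R' - T. \<bar>diff3 G (\<sigma> k *\<^sub>R a) (\<sigma> k *\<^sub>R b) (\<sigma> k *\<^sub>R a) x\<bar> \<le> \<tau> / 2 * (\<sigma> k)\<^sup>2)" if "0 < e" for a b e
    unfolding diff3_def \<sigma>_def by (rule third_difference_small[OF G bd]) (use t that in auto)
  have "\<exists>k. \<sigma> k < r0 \<and> (\<exists>x\<in>E. \<forall>((a, b), p)\<in>W. \<bar>diff3 G (\<sigma> k *\<^sub>R a) (\<sigma> k *\<^sub>R b) (\<sigma> k *\<^sub>R a) (x + \<sigma> k *\<^sub>R p)\<bar> \<le> \<tau> / 2 * (\<sigma> k)\<^sup>2)"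
  proof (rule ccontr)
    assume no: "\<not> ?thesis"
    \<comment> \<open>If at one scale every point of \<open>E\<close> violates a condition in
      \<open>W\<close>, then finitely many translated exceptional sets cover \<open>E\<close>, and
      their total measure is below \<open>e\<close>.\<close>
    have "negligible E" unfolding negligible_outer
    proof (intro allI impI)
      fix e :: real assume e: "0 < e"
      define e' where "e' = e / (real (card W) + 1)"
      have e': "0 < e'" using e by (simp add: e'_def add_nonneg_pos)
      have "\<forall>\<^sub>F k in sequentially. \<forall>w\<in>W. \<exists>T. T \<in> lmeasurable \<and> measure lebesgue T < e' \<and>
        (\<forall>x\<in>cball 0 R' - T. \<bar>diff3 G (\<sigma> k *\<^sub>R fst (fst w)) (\<sigma> k *\<^sub>R snd (fst w)) (\<sigma> k *\<^sub>R fst (fst w)) x\<bar> \<le> \<tau> / 2 * (\<sigma> k)\<^sup>2)"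
        by (rule eventually_ball_finite[OF fW]) (use good[OF e'] in blast)
      moreover have "\<forall>\<^sub>F k in sequentially. \<sigma> k < r0"
      proof -
        have "\<sigma> \<longlonglongrightarrow> 0" unfolding \<sigma>_def by (rule LIMSEQ_realpow_zero) auto
        then show ?thesis using order_tendstoD(2) r0 by blast
      qed
      ultimately have "\<forall>\<^sub>F k in sequentially. (\<forall>w\<in>W. \<exists>T. T \<in> lmeasurable \<and> measure lebesgue T < e' \<and>
        (\<forall>x\<in>cball 0 R' - T. \<bar>diff3 G (\<sigma> k *\<^sub>R fst (fst w)) (\<sigma> k *\<^sub>R snd (fst w)) (\<sigma> k *\<^sub>R fst (fst w)) x\<bar> \<le> \<tau> / 2 * (\<sigma> k)\<^sup>2)) \<and> \<sigma> k < r0"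
        by (rule eventually_conj)
      from eventually_happens'[OF sequentially_bot this]
      obtain k where k: "\<sigma> k < r0" "\<forall>w\<in>W. \<exists>T. T \<in> lmeasurable \<and> measure lebesgue T < e' \<and>
        (\<forall>x\<in>cball 0 R' - T. \<bar>diff3 G (\<sigma> k *\<^sub>R fst (fst w)) (\<sigma> k *\<^sub>R snd (fst w)) (\<sigma> k *\<^sub>R fst (fst w)) x\<bar> \<le> \<tau> / 2 * (\<sigma> k)\<^sup>2)"
        by (elim exE conjE)
      then obtain T where T: "\<And>w. w \<in> W \<Longrightarrow> T w \<in> lmeasurable \<and> measure lebesgue (T w) < e' \<and>
        (\<forall>x\<in>cball 0 R' - T w. \<bar>diff3 G (\<sigma> k *\<^sub>R fst (fst w)) (\<sigma> k *\<^sub>R snd (fst w)) (\<sigma> k *\<^sub>R fst (fst w)) x\<bar> \<le> \<tau> / 2 * (\<sigma> k)\<^sup>2)"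
        by metis
      \<comment> \<open>The translation turns the exceptional set for base points
        \<open>x + \<sigma> k *\<^sub>R p\<close> into an exceptional set for \<open>x\<close>
        itself.\<close>
      define S where "S w = (+) (- (\<sigma> k *\<^sub>R snd w)) ` T w" for w
      have S: "S w \<in> lmeasurable" "measure lebesgue (S w) < e'" if "w \<in> W" for w
        using T[OF that] unfolding S_def
        by (metis measurable_translation, metis measure_translation)
      have "E \<subseteq> (\<Union>w\<in>W. S w)"
      proof
        fix x assume x: "x \<in> E"
        then obtain a b p where w: "((a, b), p) \<in> W" and
          n: "\<not> \<bar>diff3 G (\<sigma> k *\<^sub>R a) (\<sigma> k *\<^sub>R b) (\<sigma> k *\<^sub>R a) (x + \<sigma> k *\<^sub>R p)\<bar> \<le> \<tau> / 2 * (\<sigma> k)\<^sup>2"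
          using no k(1) by fast
        have "p \<in> P" using w by (auto simp: W_def)
        have "norm (x + \<sigma> k *\<^sub>R p) \<le> norm x + \<sigma> k * norm p"
          using norm_triangle_ineq[of x "\<sigma> k *\<^sub>R p"] s0[of k] by simp
        also have "\<dots> \<le> R + 1 * B"
          using R[OF x] B[OF \<open>p \<in> P\<close>] s0[of k] by (intro add_mono mult_mono) auto
        finally have "x + \<sigma> k *\<^sub>R p \<in> cball 0 R'" by (simp add: R'_def)
        then have "x + \<sigma> k *\<^sub>R p \<in> T ((a, b), p)" using T[OF w] n by auto
        then have "- (\<sigma> k *\<^sub>R p) + (x + \<sigma> k *\<^sub>R p) \<in> S ((a, b), p)" unfolding S_def by force
        then show "x \<in> (\<Union>w\<in>W. S w)" using w by auto
      qed
      moreover have "(\<Union>w\<in>W. S w) \<in> lmeasurable" using S fW by (intro fmeasurable.finite_UN) auto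
      moreover have "measure lebesgue (\<Union>w\<in>W. S w) < e"
      proof -
        have "measure lebesgue (\<Union>w\<in>W. S w) \<le> (\<Sum>w\<in>W. measure lebesgue (S w))"
          by (rule measure_UNION_le[OF fW]) (use S in auto)
        also have "\<dots> \<le> (\<Sum>w\<in>W. e')" by (rule sum_mono) (use S(2) in force)
        also have "\<dots> = e * (real (card W) / (real (card W) + 1))" by (simp add: e'_def)
        also have "\<dots> < e * 1" using e by (intro mult_strict_left_mono) auto
        finally show ?thesis by simp
      qed
      ultimately show "\<exists>T. E \<subseteq> T \<and> T \<in> lmeasurable \<and> measure lebesgue T < e" by blast
    qed
    then show False using E(2) by simp
  qed
  then obtain k x where k: "\<sigma> k < r0" and x: "x \<in> E" and
    ok: "\<And>a b p. a \<in> A \<Longrightarrow> b \<in> A \<Longrightarrow> p \<in> P \<Longrightarrow> \<bar>diff3 G (\<sigma> k *\<^sub>R a) (\<sigma> k *\<^sub>R b) (\<sigma> k *\<^sub>R a) (x + \<sigma> k *\<^sub>R p)\<bar> \<le> \<tau> / 2 * (\<sigma> k)\<^sup>2"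
    unfolding W_def by fast
  show thesis
  proof (rule that[OF x s0(1) k])
    fix f :: "'n \<Rightarrow> nat" and i j l :: 'n assume f: "\<forall>j. f j \<le> N"
    let ?e = "\<lambda>i::'n. axis i (1::real)" let ?y = "x + \<sigma> k *\<^sub>R c + \<sigma> k *\<^sub>R lattice_vec f"
    have p: "c + lattice_vec f + ?e l \<in> P" "c + lattice_vec f + - ?e l \<in> P"
    proof -
      show "c + lattice_vec f + ?e l \<in> P"
        unfolding P_def by (rule image_eqI[where x="(f, ?e l)"]) (use f in \<open>auto simp: U_def\<close>)
      show "c + lattice_vec f + - ?e l \<in> P"
        unfolding P_def by (rule image_eqI[where x="(f, - ?e l)"]) (use f in \<open>auto simp: U_def\<close>)
    qed
    have a: "?e i \<in> A" "?e j \<in> A" "?e l \<in> A" "?e i + ?e l \<in> A" unfolding A_def by auto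
    have y: "x + \<sigma> k *\<^sub>R (c + lattice_vec f + ?e l) = ?y + \<sigma> k *\<^sub>R ?e l" "x + \<sigma> k *\<^sub>R (c + lattice_vec f + - ?e l) = ?y - \<sigma> k *\<^sub>R ?e l"
      by (auto simp: algebra_simps)
    note 1 = ok[OF a(4) a(2) p(2), unfolded y, unfolded scaleR_add_right]
    note 2 = ok[OF a(1) a(2) p(1), unfolded y]
    note 3 = ok[OF a(3) a(2) p(2), unfolded y]
    have "0 \<le> \<tau> / 2 * (\<sigma> k)\<^sup>2" using t by simp
    then have "2 * \<bar>diff3 G (\<sigma> k *\<^sub>R ?e i) (\<sigma> k *\<^sub>R ?e j) (\<sigma> k *\<^sub>R ?e l) ?y\<bar> \<le> 4 * (\<tau> / 2 * (\<sigma> k)\<^sup>2)"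
      using 1 2 3 diff3_polarize[of G "\<sigma> k *\<^sub>R ?e i" "\<sigma> k *\<^sub>R ?e j" "\<sigma> k *\<^sub>R ?e l" ?y] by linarith
    then show "\<bar>diff3 G (\<sigma> k *\<^sub>R ?e i) (\<sigma> k *\<^sub>R ?e j) (\<sigma> k *\<^sub>R ?e l) ?y\<bar> \<le> \<tau> * (\<sigma> k)\<^sup>2" by simp
  qed
qed

section \<open>Semiconvex functions and quadratic forms\<close>

definition semiconvex :: "real \<Rightarrow> ('a::real_inner \<Rightarrow> real) \<Rightarrow> bool" where
  "semiconvex k f \<longleftrightarrow> (\<forall>a b t. 0 \<le> t \<and> t \<le> 1 \<longrightarrow>
     f ((1 - t) *\<^sub>R a + t *\<^sub>R b) \<le> (1 - t) * f a + t * f b + k / 2 * (t * (1 - t) * (norm (a - b))\<^sup>2))"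

lemma norm_sq_convex_comb:
  fixes a b :: "'a::real_inner"
  shows "(norm ((1 - t) *\<^sub>R a + t *\<^sub>R b))\<^sup>2 = (1 - t) * (norm a)\<^sup>2 + t * (norm b)\<^sup>2 - t * (1 - t) * (norm (a - b))\<^sup>2"
  by (simp add: power2_norm_eq_inner inner_simps inner_commute algebra_simps)

text \<open>The squared distance to any centre \<open>v\<close> has exactly the convexity defect
  that \<open>semiconvex\<close> allows, since changing the centre adds an affine function. So
  \<open>v\<close> can be chosen to suit each application.\<close>

lemma semiconvex_iff_convex_on:
  "semiconvex k f \<longleftrightarrow> convex_on UNIV (\<lambda>x. f x + k / 2 * (norm (x - v))\<^sup>2)"
proof -
  have n: "(norm ((1 - t) *\<^sub>R a + t *\<^sub>R b - v))\<^sup>2 = (1 - t) * (norm (a - v))\<^sup>2 + t * (norm (b - v))\<^sup>2 - t * (1 - t) * (norm (a - b))\<^sup>2" for a b t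
  proof -
    have "(1 - t) *\<^sub>R a + t *\<^sub>R b - v = (1 - t) *\<^sub>R (a - v) + t *\<^sub>R (b - v)" by (simp add: algebra_simps)
    then show ?thesis using norm_sq_convex_comb[of t "a - v" "b - v"] by simp
  qed
  have e: "(f ((1 - t) *\<^sub>R a + t *\<^sub>R b) + k / 2 * (norm ((1 - t) *\<^sub>R a + t *\<^sub>R b - v))\<^sup>2
       \<le> (1 - t) * (f a + k / 2 * (norm (a - v))\<^sup>2) + t * (f b + k / 2 * (norm (b - v))\<^sup>2)) \<longleftrightarrow>
     f ((1 - t) *\<^sub>R a + t *\<^sub>R b) \<le> (1 - t) * f a + t * f b + k / 2 * (t * (1 - t) * (norm (a - b))\<^sup>2)" for a b t
  proof -
    have "X + \<kappa> * (p * A + q * B - C) \<le> p * (F + \<kappa> * A) + q * (H + \<kappa> * B) \<longleftrightarrow> X \<le> p * F + q * H + \<kappa> * C"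
      for X \<kappa> p q A B C F H :: real by (simp add: algebra_simps)
    then show ?thesis unfolding n .
  qed
  show ?thesis
  proof
    assume s: "semiconvex k f"
    show "convex_on UNIV (\<lambda>x. f x + k / 2 * (norm (x - v))\<^sup>2)"
    proof (rule convex_onI)
      fix t :: real and a b :: 'a assume "0 < t" "t < 1"
      then show "f ((1 - t) *\<^sub>R a + t *\<^sub>R b) + k / 2 * (norm ((1 - t) *\<^sub>R a + t *\<^sub>R b - v))\<^sup>2
       \<le> (1 - t) * (f a + k / 2 * (norm (a - v))\<^sup>2) + t * (f b + k / 2 * (norm (b - v))\<^sup>2)"
        unfolding e using s by (simp add: semiconvex_def)
    qed simp
  next
    assume c: "convex_on UNIV (\<lambda>x. f x + k / 2 * (norm (x - v))\<^sup>2)"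
    show "semiconvex k f" unfolding semiconvex_def
    proof (intro allI impI)
      fix a b :: 'a and t :: real assume t: "0 \<le> t \<and> t \<le> 1"
      have "f ((1 - t) *\<^sub>R a + t *\<^sub>R b) + k / 2 * (norm ((1 - t) *\<^sub>R a + t *\<^sub>R b - v))\<^sup>2
       \<le> (1 - t) * (f a + k / 2 * (norm (a - v))\<^sup>2) + t * (f b + k / 2 * (norm (b - v))\<^sup>2)"
        using convex_onD[OF c, of t a b] t by simp
      then show "f ((1 - t) *\<^sub>R a + t *\<^sub>R b) \<le> (1 - t) * f a + t * f b + k / 2 * (t * (1 - t) * (norm (a - b))\<^sup>2)"
        unfolding e .
    qed
  qed
qed

lemma semiconvex_add:
  assumes "semiconvex k f" "semiconvex l g"
  shows "semiconvex (k + l) (\<lambda>x. f x + g x)"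
  unfolding semiconvex_def
proof (intro allI impI)
  fix a b :: 'a and t :: real assume t: "0 \<le> t \<and> t \<le> 1"
  have "f ((1 - t) *\<^sub>R a + t *\<^sub>R b) \<le> (1 - t) * f a + t * f b + k / 2 * (t * (1 - t) * (norm (a - b))\<^sup>2)"
    "g ((1 - t) *\<^sub>R a + t *\<^sub>R b) \<le> (1 - t) * g a + t * g b + l / 2 * (t * (1 - t) * (norm (a - b))\<^sup>2)"
    using assms t by (auto simp: semiconvex_def)
  then show "f ((1 - t) *\<^sub>R a + t *\<^sub>R b) + g ((1 - t) *\<^sub>R a + t *\<^sub>R b)
    \<le> (1 - t) * (f a + g a) + t * (f b + g b) + (k + l) / 2 * (t * (1 - t) * (norm (a - b))\<^sup>2)"
    unfolding add_divide_distrib distrib_right distrib_left by linarith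
qed

lemma semiconvex_continuous:
  fixes f :: "'a::euclidean_space \<Rightarrow> real"
  assumes "semiconvex k f"
  shows "continuous_on S f"
proof -
  have "continuous_on UNIV (\<lambda>x. f x + k / 2 * (norm (x - 0))\<^sup>2)"
    using semiconvex_iff_convex_on[of k f 0] assms by (intro convex_on_continuous) auto
  then have "continuous_on UNIV (\<lambda>x. (f x + k / 2 * (norm (x - 0))\<^sup>2) - k / 2 * (norm (x - 0))\<^sup>2)"
    by (rule continuous_on_diff) (intro continuous_intros)
  then have "continuous_on UNIV f" by simp
  then show ?thesis using continuous_on_subset by blast
qed

lemma sym_dot:
  fixes A :: "real^'n^'n"
  assumes "transpose A = A"
  shows "x \<bullet> (A *v y) = y \<bullet> (A *v x)"
  by (metis assms dot_lmul_matrix inner_commute transpose_matrix_vector)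

lemma quad_form_add:
  fixes A :: "real^'n^'n"
  assumes "transpose A = A"
  shows "(x + y) \<bullet> (A *v (x + y)) = x \<bullet> (A *v x) + 2 * (x \<bullet> (A *v y)) + y \<bullet> (A *v y)"
  using sym_dot[OF assms, of y x] by (simp add: matrix_vector_right_distrib inner_simps)

lemma quad_form_convex_comb:
  fixes A :: "real^'n^'n"
  assumes "transpose A = A"
  shows "((1 - t) *\<^sub>R a + t *\<^sub>R b) \<bullet> (A *v ((1 - t) *\<^sub>R a + t *\<^sub>R b)) =
     (1 - t) * (a \<bullet> (A *v a)) + t * (b \<bullet> (A *v b)) - t * (1 - t) * ((a - b) \<bullet> (A *v (a - b)))"
  using sym_dot[OF assms, of b a]
  by (simp add: matrix_vector_right_distrib matrix_vector_mult_diff_distrib matrix_vector_mult_scaleR inner_simps algebra_simps)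

lemma quad_form_entry_bound:
  fixes A :: "real^'n^'n"
  assumes "\<And>i j. \<bar>A $ i $ j\<bar> \<le> c"
  shows "\<bar>h \<bullet> (A *v h)\<bar> \<le> real CARD('n) ^ 2 * c * (norm h)\<^sup>2"
proof -
  have c0: "0 \<le> c" using assms[of undefined undefined] by linarith
  have "h \<bullet> (A *v h) = (\<Sum>i\<in>UNIV. \<Sum>j\<in>UNIV. h $ i * (A $ i $ j * h $ j))"
    by (simp add: inner_vec_def matrix_vector_mult_def sum_distrib_left)
  then have "\<bar>h \<bullet> (A *v h)\<bar> \<le> (\<Sum>i\<in>UNIV. \<Sum>j\<in>UNIV. \<bar>h $ i * (A $ i $ j * h $ j)\<bar>)"
    by (simp only:) (intro order_trans[OF sum_abs] sum_mono sum_abs)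
  also have "\<dots> \<le> (\<Sum>i::'n\<in>UNIV. \<Sum>j::'n\<in>UNIV. norm h * (c * norm h))"
    unfolding abs_mult using assms c0 component_le_norm_cart[of h]
    by (intro sum_mono mult_mono) auto
  also have "\<dots> = real CARD('n) ^ 2 * c * (norm h)\<^sup>2" by (simp add: power2_eq_square)
  finally show ?thesis .
qed

lemma semiconvex_midpoint:
  assumes "semiconvex c f"
  shows "2 * f (midpoint u v) \<le> f u + f v + c / 4 * (norm (u - v))\<^sup>2"
proof -
  have "f ((1 - 1/2) *\<^sub>R u + (1/2) *\<^sub>R v) \<le> (1 - 1/2) * f u + (1/2) * f v + c / 2 * ((1/2) * (1 - 1/2) * (norm (u - v))\<^sup>2)"
    using assms unfolding semiconvex_def by (metis divide_le_eq_1 half_gt_zero_iff less_eq_real_def one_le_numeral zero_less_one zero_less_numeral order_refl zero_le_divide_1_iff zero_le_numeral)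
  moreover have "(1 - 1/2) *\<^sub>R u + (1/2) *\<^sub>R v = midpoint u v" by (simp add: midpoint_def scaleR_add_right)
  ultimately show ?thesis by (simp add: algebra_simps)
qed

text \<open>The two diagonals of the parallelogram share their midpoint. The mixed difference is the
  second difference along one diagonal minus that along the other, and semiconvexity of
  \<open>f\<close> and of \<open>- f\<close> bounds each of them.\<close>

lemma diff2_bound:
  assumes "semiconvex c f" "semiconvex c (\<lambda>x. - f x)"
  shows "\<bar>diff2 f a b x\<bar> \<le> c * ((norm a)\<^sup>2 + (norm b)\<^sup>2) / 2"
proof -
  have m: "midpoint (x + a + b) x = midpoint (x + a) (x + b)" by (simp add: midpoint_def algebra_simps)
  have p: "(norm (a + b))\<^sup>2 + (norm (a - b))\<^sup>2 = 2 * ((norm a)\<^sup>2 + (norm b)\<^sup>2)"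
    by (simp add: power2_norm_eq_inner inner_simps)
  let ?m = "f (midpoint (x + a) (x + b))"
  have "2 * ?m \<le> f (x + a + b) + f x + c / 4 * (norm (a + b))\<^sup>2" "- (2 * ?m) \<le> - f (x + a + b) - f x + c / 4 * (norm (a + b))\<^sup>2"
    using semiconvex_midpoint[OF assms(1), of "x + a + b" x] semiconvex_midpoint[OF assms(2), of "x + a + b" x] unfolding m by auto
  moreover have "2 * ?m \<le> f (x + a) + f (x + b) + c / 4 * (norm (a - b))\<^sup>2" "- (2 * ?m) \<le> - f (x + a) - f (x + b) + c / 4 * (norm (a - b))\<^sup>2"
    using semiconvex_midpoint[OF assms(1), of "x + a" "x + b"] semiconvex_midpoint[OF assms(2), of "x + a" "x + b"] by auto
  moreover have "c * ((norm a)\<^sup>2 + (norm b)\<^sup>2) / 2 = c / 4 * (norm (a + b))\<^sup>2 + c / 4 * (norm (a - b))\<^sup>2"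
    unfolding distrib_left[symmetric] p by simp
  ultimately show ?thesis unfolding diff2_def by linarith
qed

text \<open>A convex function on a cube is bounded by its values at the vertices. The quadratic that
  makes \<open>D\<close> convex is centred at the corner \<open>v\<close>, where it costs nothing,
  and is at most \<open>\<kappa> / 2 * s\<^sup>2 * CARD('n)\<close> at the vertices.\<close>

lemma semiconvex_cell_bound:
  fixes D :: "real^'n \<Rightarrow> real"
  assumes D: "semiconvex \<kappa> D" "0 \<le> \<kappa>" and s: "0 < s"
    and v: "\<And>w. \<forall>i. w $ i = 0 \<or> w $ i = 1 \<Longrightarrow> D (v + s *\<^sub>R w) \<le> \<beta>"
    and y: "\<And>i. 0 \<le> (y - v) $ i \<and> (y - v) $ i \<le> s"
  shows "D y \<le> \<beta> + \<kappa> / 2 * s\<^sup>2 * real CARD('n)"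
proof -
  define h where "h = (1 / s) *\<^sub>R (y - v)"
  define \<phi> where "\<phi> h = D (v + s *\<^sub>R h) + \<kappa> / 2 * (norm (v + s *\<^sub>R h - v))\<^sup>2" for h
  have yh: "y = v + s *\<^sub>R h" using s by (simp add: h_def)
  have "h \<in> cbox 0 1" using y s by (simp add: h_def mem_box_cart)
  also have "cbox 0 (1::real^'n) = convex hull {x. \<forall>i. x $ i = 0 \<or> x $ i = 1}"
    using unit_interval_convex_hull[where 'a="real^'n"] by (simp add: Cart_1 Basis_vec_def inner_axis)
  finally have h: "h \<in> convex hull {x. \<forall>i. x $ i = 0 \<or> x $ i = 1}" .
  have c: "convex_on UNIV (\<lambda>x. D x + \<kappa> / 2 * (norm (x - v))\<^sup>2)" using D semiconvex_iff_convex_on by blast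
  have cU: "convex_on UNIV \<phi>"
  proof (rule convex_onI)
    fix t :: real and a b assume "0 < t" "t < 1"
    have "v + s *\<^sub>R ((1 - t) *\<^sub>R a + t *\<^sub>R b) = (1 - t) *\<^sub>R (v + s *\<^sub>R a) + t *\<^sub>R (v + s *\<^sub>R b)" by (simp add: algebra_simps)
    then show "\<phi> ((1 - t) *\<^sub>R a + t *\<^sub>R b) \<le> (1 - t) * \<phi> a + t * \<phi> b"
      unfolding \<phi>_def using convex_onD[OF c, of t "v + s *\<^sub>R a" "v + s *\<^sub>R b"] \<open>0 < t\<close> \<open>t < 1\<close> by simp
  qed auto
  then have cv: "convex_on (convex hull {x. \<forall>i. x $ i = 0 \<or> x $ i = 1}) \<phi>"
    using convex_on_subset[OF cU subset_UNIV] by simp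
  have "\<forall>x\<in>{x. \<forall>i. x $ i = 0 \<or> x $ i = 1}. \<phi> x \<le> \<beta> + \<kappa> / 2 * s\<^sup>2 * real CARD('n)"
  proof
    fix w :: "real^'n" assume "w \<in> {x. \<forall>i. x $ i = 0 \<or> x $ i = 1}"
    then have w: "\<forall>i. w $ i = 0 \<or> w $ i = 1" by simp
    have "(norm w)\<^sup>2 = (\<Sum>i\<in>UNIV. (w $ i)\<^sup>2)" unfolding power2_norm_eq_inner inner_vec_def by (simp add: power2_eq_square)
    also have "\<dots> \<le> (\<Sum>i::'n\<in>UNIV. 1)"
    proof (rule sum_mono)
      fix i :: 'n
      show "(w $ i)\<^sup>2 \<le> 1" using w by (cases "w $ i = 0") auto
    qed
    finally have nw: "(norm w)\<^sup>2 \<le> real CARD('n)" by simp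
    have "\<phi> w = D (v + s *\<^sub>R w) + \<kappa> / 2 * s\<^sup>2 * (norm w)\<^sup>2" using s by (simp add: \<phi>_def power_mult_distrib)
    also have "\<dots> \<le> \<beta> + \<kappa> / 2 * s\<^sup>2 * real CARD('n)"
      using v[OF w] nw D(2) by (intro add_mono mult_left_mono) auto
    finally show "\<phi> w \<le> \<beta> + \<kappa> / 2 * s\<^sup>2 * real CARD('n)" .
  qed
  then have "\<phi> h \<le> \<beta> + \<kappa> / 2 * s\<^sup>2 * real CARD('n)" using convex_on_convex_hull_bound[OF cv] h by blast
  moreover have "D y \<le> \<phi> h" unfolding \<phi>_def yh using D(2) by simp
  ultimately show ?thesis by simp
qed


lemma diff2_symmetric: "diff2 f a b x = diff2 f b a x"
  by (simp add: diff2_def algebra_simps)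

text \<open>\<open>Q\<close> interpolates \<open>G\<close> at the corner of a lattice cube around a
  point of \<open>E\<close>. The remainder \<open>D\<close> is small at lattice points because its
  third differences are, and small between them because \<open>D\<close> and \<open>- D\<close> are
  semiconvex.\<close>

theorem quadratic_approx:
  fixes G :: "real^'n \<Rightarrow> real"
  assumes c: "0 \<le> c" and cv: "semiconvex c G" and cc: "semiconvex c (\<lambda>x. - G x)"
    and \<eta>: "0 < \<eta>" and E: "bounded E" "\<not> negligible E" and r0: "0 < r0"
  obtains x r l A where "x \<in> E" "0 < r" "r < r0" "transpose A = A"
    "\<And>y. dist x y \<le> r \<Longrightarrow> \<bar>G y - (G x + l \<bullet> (y - x) + (y - x) \<bullet> (A *v (y - x)) / 2)\<bar> \<le> \<eta> * r\<^sup>2"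
proof -
  define n where "n = real CARD('n)"
  have n1: "1 \<le> n" unfolding n_def by (simp add: Suc_le_eq)
  define \<kappa> where "\<kappa> = c + n\<^sup>2 * c"
  have k0: "0 \<le> \<kappa>" using c by (simp add: \<kappa>_def)
  \<comment> \<open>\<open>N\<close> counts the cells per half side of the cube. The error inside a
    cell is of order \<open>\<kappa> * n * s\<^sup>2\<close> and the tolerance of order
    \<open>\<eta> * (N * s)\<^sup>2\<close>, so a large \<open>N\<close> absorbs the former.\<close>
  obtain N :: nat where N: "2 * \<kappa> * n / \<eta> + 1 \<le> real N" using real_arch_simple by blast
  have N1: "1 \<le> real N" using N k0 n1 \<eta> by (smt (verit) divide_nonneg_pos mult_nonneg_nonneg)
  have Nk: "\<kappa> / 2 * n \<le> \<eta> / 4 * (real N)\<^sup>2"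
  proof -
    have "2 * \<kappa> * n / \<eta> \<le> real N" using N by simp
    also have "real N \<le> (real N)\<^sup>2" using N1 by (simp add: power2_eq_square)
    finally show ?thesis using \<eta> by (simp add: field_simps)
  qed
  \<comment> \<open>Lower corners of cells have coordinates up to \<open>2 * N\<close>; upper
    corners need one more.\<close>
  define M where "M = 2 * N + 1"
  have nM: "1 \<le> n * real M" using n1 by (simp add: M_def mult_ge1_I)
  \<comment> \<open>Summing third differences back to values takes three walks, each costing a
    factor \<open>n * M\<close>.\<close>
  define \<tau> where "\<tau> = \<eta> / 4 * (real N)\<^sup>2 / (n * real M) ^ 3"
  have t: "0 < \<tau>" unfolding \<tau>_def using \<eta> N1 nM by (intro divide_pos_pos mult_pos_pos) auto
  have tM: "(n * real M) ^ 3 * \<tau> = \<eta> / 4 * (real N)\<^sup>2" unfolding \<tau>_def using nM by auto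
  \<comment> \<open>The lattice starts at x - N s (1, ..., 1), so the cube of side 2 N s is centred
    at \<open>x\<close> and contains the ball of radius N s.\<close>
  define cvec :: "real^'n" where "cvec = - (\<chi> i. real N)"
  have bd: "\<bar>diff2 G (s *\<^sub>R a) (s *\<^sub>R b) x\<bar> \<le> c * ((norm a)\<^sup>2 + (norm b)\<^sup>2) / 2 * s\<^sup>2" if "0 < s" for a b s x
    using diff2_bound[OF cv cc, of "s *\<^sub>R a" "s *\<^sub>R b" x] by (simp add: power_mult_distrib algebra_simps)
  have r0N: "0 < r0 / real N" using r0 N1 by simp
  obtain x s where x: "x \<in> E" and s: "0 < s" "s < r0 / real N" and third:
    "\<And>f i j l. (\<forall>j. f j \<le> M) \<Longrightarrow>
      \<bar>diff3 G (s *\<^sub>R axis i 1) (s *\<^sub>R axis j 1) (s *\<^sub>R axis l 1) (x + s *\<^sub>R cvec + s *\<^sub>R lattice_vec f)\<bar> \<le> \<tau> * s\<^sup>2"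
    using third_differences_small_somewhere[OF semiconvex_continuous[OF cv] bd E t r0N] by metis
  define z where "z = x + s *\<^sub>R cvec"
  define e where "e i = s *\<^sub>R axis i (1::real)" for i :: 'n
  \<comment> \<open>Newton interpolation at \<open>z\<close>: \<open>A\<close> copies the second
    differences, and \<open>l\<close> the first differences less the half diagonal term contributed
    by the quadratic part. Hence \<open>D\<close> and its first and second axis differences vanish
    at \<open>z\<close>.\<close>
  define A :: "real^'n^'n" where "A = (\<chi> i j. diff2 G (e i) (e j) z / s\<^sup>2)"
  have A: "transpose A = A" by (simp add: transpose_def A_def vec_eq_iff diff2_symmetric)
  have Ae: "axis i 1 \<bullet> (A *v axis j 1) = A $ i $ j" for i j
    by (simp add: inner_axis' matrix_vector_mult_basis column_def)
  have Aee: "e i \<bullet> (A *v e j) = diff2 G (e i) (e j) z" for i j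
    using s(1) by (simp add: e_def matrix_vector_mult_scaleR Ae) (simp add: A_def e_def power2_eq_square)
  have Ab: "\<bar>A $ i $ j\<bar> \<le> c" for i j
    using bd[OF s(1), of "axis i 1" "axis j 1" z] s(1) by (simp add: A_def e_def abs_divide divide_le_eq)
  define l :: "real^'n" where "l = (\<chi> i. (G (z + e i) - G z) / s - s * A $ i $ i / 2)"
  have le: "l \<bullet> e i = G (z + e i) - G z - e i \<bullet> (A *v e i) / 2" for i
    using s(1) by (simp add: e_def matrix_vector_mult_scaleR Ae inner_axis) (simp add: l_def e_def field_simps)
  define Q where "Q y = G z + l \<bullet> (y - z) + (y - z) \<bullet> (A *v (y - z)) / 2" for y
  define D where "D y = G y - Q y" for y
  have Qs: "Q (y + h) = Q y + l \<bullet> h + (y - z) \<bullet> (A *v h) + h \<bullet> (A *v h) / 2" for y h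
  proof -
    have e: "y + h - z = (y - z) + h" by simp
    show ?thesis unfolding Q_def e inner_add_right quad_form_add[OF A] by simp
  qed
  have Q2: "diff2 Q a b y = a \<bullet> (A *v b)" for a b y
    unfolding diff2_def by (simp add: Qs inner_simps matrix_vector_right_distrib)
  have D2: "diff2 D a b y = diff2 G a b y - a \<bullet> (A *v b)" for a b y
    unfolding Q2[symmetric, of a b y] by (simp add: D_def diff2_def)
  have D3: "diff3 D a b d y = diff3 G a b d y" for a b d y
    by (simp add: diff3_def D2)
  define \<beta> where "\<beta> = \<tau> * s\<^sup>2"
  have b0: "0 \<le> \<beta>" using t by (simp add: \<beta>_def)
  \<comment> \<open>The three walks lead from third differences of \<open>D\<close>, which are those
    of \<open>G\<close>, to second differences, to first differences and finally to values.\<close>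
  have w1: "\<bar>diff2 D (e i) (e j) (z + s *\<^sub>R lattice_vec f)\<bar> \<le> n * real M * \<beta>" if "\<forall>j. f j \<le> M" for f i j
    unfolding n_def
  proof (rule lattice_walk[OF _ that _ b0])
    show "diff2 D (e i) (e j) z = 0" by (simp add: D2 Aee)
    fix f :: "'n \<Rightarrow> nat" and i' :: 'n assume f: "\<forall>j. f j \<le> M"
    show "\<bar>diff2 D (e i) (e j) (z + s *\<^sub>R lattice_vec f + s *\<^sub>R axis i' 1) - diff2 D (e i) (e j) (z + s *\<^sub>R lattice_vec f)\<bar> \<le> \<beta>"
      using third[OF f, of i j i'] unfolding diff3_def[symmetric] D3 by (simp add: z_def \<beta>_def e_def)
  qed
  have w2: "\<bar>D (z + s *\<^sub>R lattice_vec f + e j) - D (z + s *\<^sub>R lattice_vec f)\<bar> \<le> n * real M * (n * real M * \<beta>)" if "\<forall>j. f j \<le> M" for f j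
    unfolding n_def
  proof (rule lattice_walk[where g="\<lambda>y. D (y + e j) - D y", OF _ that])
    show "D (z + e j) - D z = 0" by (simp add: D_def Qs le)
    show "0 \<le> real CARD('n) * real M * \<beta>" using b0 by simp
    fix f :: "'n \<Rightarrow> nat" and i' :: 'n assume f: "\<forall>j. f j \<le> M"
    show "\<bar>D (z + s *\<^sub>R lattice_vec f + s *\<^sub>R axis i' 1 + e j) - D (z + s *\<^sub>R lattice_vec f + s *\<^sub>R axis i' 1) -
        (D (z + s *\<^sub>R lattice_vec f + e j) - D (z + s *\<^sub>R lattice_vec f))\<bar> \<le> real CARD('n) * real M * \<beta>"
      using w1[OF f, of i' j] by (simp add: diff2_def e_def n_def algebra_simps)
  qed
  have w3: "\<bar>D (z + s *\<^sub>R lattice_vec f)\<bar> \<le> n * real M * (n * real M * (n * real M * \<beta>))" if "\<forall>j. f j \<le> M" for f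
    unfolding n_def
  proof (rule lattice_walk[OF _ that])
    show "D z = 0" by (simp add: D_def Q_def)
    show "0 \<le> real CARD('n) * real M * (real CARD('n) * real M * \<beta>)" using b0 by simp
    fix f :: "'n \<Rightarrow> nat" and i' :: 'n assume f: "\<forall>j. f j \<le> M"
    show "\<bar>D (z + s *\<^sub>R lattice_vec f + s *\<^sub>R axis i' 1) - D (z + s *\<^sub>R lattice_vec f)\<bar> \<le> real CARD('n) * real M * (real CARD('n) * real M * \<beta>)"
      using w2[OF f, of i'] by (simp add: e_def n_def)
  qed
  define \<gamma> where "\<gamma> = \<eta> / 4 * (real N)\<^sup>2 * s\<^sup>2"
  have w4: "\<bar>D (z + s *\<^sub>R lattice_vec f)\<bar> \<le> \<gamma>" if "\<forall>j. f j \<le> M" for f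
  proof -
    have "n * real M * (n * real M * (n * real M * \<beta>)) = (n * real M) ^ 3 * \<tau> * s\<^sup>2"
      by (simp add: \<beta>_def power3_eq_cube algebra_simps)
    then show ?thesis using w3[OF that] by (simp add: tM \<gamma>_def)
  qed
  have quad_c: "\<bar>h \<bullet> (A *v h)\<bar> \<le> n\<^sup>2 * c * (norm h)\<^sup>2" for h
    unfolding n_def by (rule quad_form_entry_bound) (rule Ab)
  have scQ: "semiconvex (n\<^sup>2 * c) (\<lambda>y. \<sigma> * Q y)" if "\<sigma> = 1 \<or> \<sigma> = -1" for \<sigma> :: real
    unfolding semiconvex_def
  proof (intro allI impI)
    fix a b :: "real^'n" and t :: real assume t: "0 \<le> t \<and> t \<le> 1"
    have eq: "(1 - t) *\<^sub>R a + t *\<^sub>R b - z = (1 - t) *\<^sub>R (a - z) + t *\<^sub>R (b - z)" by (simp add: algebra_simps)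
    have "Q ((1 - t) *\<^sub>R a + t *\<^sub>R b) = (1 - t) * Q a + t * Q b - t * (1 - t) * ((a - b) \<bullet> (A *v (a - b))) / 2"
      unfolding Q_def eq quad_form_convex_comb[OF A] by (simp add: inner_simps) (simp add: algebra_simps add_divide_distrib diff_divide_distrib)
    moreover have abs_eq: "\<bar>t * (1 - t) * X\<bar> = \<bar>X\<bar> * (t * (1 - t))" for X
      using t by (simp add: abs_mult)
    have "\<bar>(a - b) \<bullet> (A *v (a - b))\<bar> * (t * (1 - t)) \<le> n\<^sup>2 * c * (norm (a - b))\<^sup>2 * (t * (1 - t))"
      using quad_c[of "a - b"] t by (intro mult_right_mono) auto
    then have "\<bar>t * (1 - t) * ((a - b) \<bullet> (A *v (a - b)))\<bar> \<le> n\<^sup>2 * c * (t * (1 - t) * (norm (a - b))\<^sup>2)"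
      unfolding abs_eq by (simp only: mult_ac)
    ultimately show "\<sigma> * Q ((1 - t) *\<^sub>R a + t *\<^sub>R b) \<le> (1 - t) * (\<sigma> * Q a) + t * (\<sigma> * Q b) + n\<^sup>2 * c / 2 * (t * (1 - t) * (norm (a - b))\<^sup>2)"
      using that by auto
  qed
  have scD: "semiconvex \<kappa> D" "semiconvex \<kappa> (\<lambda>y. - D y)"
    using semiconvex_add[OF cv scQ[of "-1"]] semiconvex_add[OF cc scQ[of 1]] by (simp_all add: D_def[abs_def] \<kappa>_def)
  define r where "r = real N * s"
  have cube: "\<bar>D y\<bar> \<le> \<eta> / 2 * r\<^sup>2" if y: "dist x y \<le> r" for y
  proof -
    have co: "0 \<le> (y - z) $ i \<and> (y - z) $ i \<le> 2 * real N * s" for i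
    proof -
      have "\<bar>(y - x) $ i\<bar> \<le> r" using component_le_norm_cart[of "y - x" i] y by (simp add: dist_norm norm_minus_commute)
      moreover have "(y - z) $ i = (y - x) $ i + r" by (simp add: z_def cvec_def r_def algebra_simps)
      ultimately show ?thesis by (simp add: r_def abs_le_iff)
    qed
    \<comment> \<open>\<open>f\<close> selects the lower corner \<open>v\<close> of the lattice cell
      containing \<open>y\<close>.\<close>
    define f where "f i = nat \<lfloor>(y - z) $ i / s\<rfloor>" for i
    define v where "v = z + s *\<^sub>R lattice_vec f"
    have fi: "real (f i) \<le> (y - z) $ i / s" "(y - z) $ i / s \<le> real (f i) + 1" for i
    proof -
      have "0 \<le> (y - z) $ i / s" using co s(1) by simp
      then have "real (f i) = of_int \<lfloor>(y - z) $ i / s\<rfloor>" by (simp add: f_def)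
      then show "real (f i) \<le> (y - z) $ i / s" "(y - z) $ i / s \<le> real (f i) + 1" by linarith+
    qed
    have f2N: "f i \<le> 2 * N" for i
    proof -
      have "(y - z) $ i / s \<le> 2 * real N" using co[of i] s(1) by (simp add: divide_le_eq)
      then have "real (f i) \<le> real (2 * N)" using fi(1)[of i] by simp
      then show ?thesis by (simp only: of_nat_le_iff)
    qed
    have vert: "\<bar>D (v + s *\<^sub>R w)\<bar> \<le> \<gamma>" if w: "\<forall>i. w $ i = 0 \<or> w $ i = 1" for w
    proof -
      define g where "g i = f i + (if w $ i = 1 then 1 else 0)" for i
      have "lattice_vec g = lattice_vec f + w" using w by (auto simp: vec_eq_iff lattice_vec_def g_def)
      then have "v + s *\<^sub>R w = z + s *\<^sub>R lattice_vec g" by (simp add: v_def scaleR_add_right)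
      moreover have "\<forall>j. g j \<le> M" using f2N by (auto simp: g_def M_def intro: le_SucI)
      ultimately show ?thesis using w4 by simp
    qed
    have yv: "0 \<le> (y - v) $ i \<and> (y - v) $ i \<le> s" for i
    proof -
      have "(y - v) $ i = (y - z) $ i - s * real (f i)" by (simp add: v_def lattice_vec_def)
      then show ?thesis using fi[of i] s(1) by (simp add: field_simps)
    qed
    have "D y \<le> \<gamma> + \<kappa> / 2 * s\<^sup>2 * real CARD('n)"
      by (rule semiconvex_cell_bound[OF scD(1) k0 s(1) _ yv]) (use vert in \<open>auto simp: abs_le_iff\<close>)
    moreover have "- D y \<le> \<gamma> + \<kappa> / 2 * s\<^sup>2 * real CARD('n)"
      by (rule semiconvex_cell_bound[OF scD(2) k0 s(1) _ yv]) (use vert in \<open>auto simp: abs_le_iff\<close>)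
    moreover have "\<kappa> / 2 * s\<^sup>2 * real CARD('n) \<le> \<gamma>"
      using mult_right_mono[OF Nk, of "s\<^sup>2"] by (simp add: n_def \<gamma>_def mult_ac)
    moreover have "\<gamma> = \<eta> / 4 * r\<^sup>2" by (simp add: \<gamma>_def r_def power_mult_distrib)
    ultimately show ?thesis unfolding abs_le_iff by linarith
  qed
  have rp: "0 < r" using N1 s(1) by (simp add: r_def)
  show thesis
  proof (rule that[OF x rp _ A])
    show "r < r0" using s(2) N1 by (simp add: r_def field_simps)
    fix y assume y: "dist x y \<le> r"
    have "Q y = Q x + l \<bullet> (y - x) + (x - z) \<bullet> (A *v (y - x)) + (y - x) \<bullet> (A *v (y - x)) / 2"
      using Qs[of x "y - x"] by simp
    moreover have "(x - z) \<bullet> (A *v (y - x)) = (A *v (x - z)) \<bullet> (y - x)"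
      using sym_dot[OF A] by (simp add: inner_commute)
    ultimately have "G y - (G x + (l + A *v (x - z)) \<bullet> (y - x) + (y - x) \<bullet> (A *v (y - x)) / 2) = D y - D x"
      by (simp add: D_def inner_simps)
    moreover have "\<bar>D x\<bar> \<le> \<eta> / 2 * r\<^sup>2" "\<bar>D y\<bar> \<le> \<eta> / 2 * r\<^sup>2" using cube[of x] cube[OF y] rp by auto
    ultimately show "\<bar>G y - (G x + (l + A *v (x - z)) \<bullet> (y - x) + (y - x) \<bullet> (A *v (y - x)) / 2)\<bar> \<le> \<eta> * r\<^sup>2"
      by linarith
  qed
qed

section \<open>Sup-convolutions and the viscosity sum lemma\<close>

lemma semiconvex_mono:
  assumes "semiconvex k f" "k \<le> l"
  shows "semiconvex l f"
  unfolding semiconvex_def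
proof (intro allI impI)
  fix a b :: 'a and t :: real assume t: "0 \<le> t \<and> t \<le> 1"
  have "k / 2 * (t * (1 - t) * (norm (a - b))\<^sup>2) \<le> l / 2 * (t * (1 - t) * (norm (a - b))\<^sup>2)"
    using assms(2) t by (intro mult_right_mono) auto
  then show "f ((1 - t) *\<^sub>R a + t *\<^sub>R b) \<le> (1 - t) * f a + t * f b + l / 2 * (t * (1 - t) * (norm (a - b))\<^sup>2)"
    using assms(1) t unfolding semiconvex_def by (meson add_left_mono order_trans)
qed

lemma semiconvex_0_iff: "semiconvex 0 f \<longleftrightarrow> convex_on UNIV f"
  using semiconvex_iff_convex_on[of 0 f 0] by simp

lemma semiconvex_half_norm_sq: "semiconvex 0 (\<lambda>x::'a::real_inner. k / 2 * (norm x)\<^sup>2)" if "0 \<le> k"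
proof -
  have "semiconvex k (\<lambda>x::'a. 0)" using that unfolding semiconvex_def by auto
  then show ?thesis using semiconvex_iff_convex_on[of k "\<lambda>x::'a. 0" 0] by (simp add: semiconvex_0_iff)
qed

lemma semiconvex_neg_half_norm_sq: "semiconvex k (\<lambda>x::'a::real_inner. - (k / 2 * (norm x)\<^sup>2))"
  using semiconvex_iff_convex_on[of k "\<lambda>x::'a. - (k / 2 * (norm x)\<^sup>2)" 0] by (simp add: convex_on_const)

text \<open>Averages of translates of a convex minorant, corrected by the semiconcavity defect, are again
  convex minorants; hence the largest convex minorant inherits semiconcavity.\<close>

lemma convex_envelope:
  fixes f :: "'a::real_inner \<Rightarrow> real"
  assumes f0: "convex_on UNIV f0" "\<And>x. f0 x \<le> f x" and sc: "semiconvex c (\<lambda>x. - f x)"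
  obtains g where "convex_on UNIV g" "\<And>x. g x \<le> f x"
    "\<And>h x. convex_on UNIV h \<Longrightarrow> (\<And>x. h x \<le> f x) \<Longrightarrow> h x \<le> g x"
    "semiconvex c (\<lambda>x. - g x)"
proof -
  define H where "H = {h. convex_on UNIV h \<and> (\<forall>x. h x \<le> f x)}"
  define g where "g x = (SUP h\<in>H. h x)" for x
  have H0: "H \<noteq> {}" using f0 by (auto simp: H_def)
  have bdd: "bdd_above ((\<lambda>h. h x) ` H)" for x by (rule bdd_aboveI2[of _ _ "f x"]) (auto simp: H_def)
  have up: "h x \<le> g x" if "h \<in> H" for h x unfolding g_def by (rule cSUP_upper[OF that bdd])
  have least: "g x \<le> b" if "\<And>h. h \<in> H \<Longrightarrow> h x \<le> b" for x b unfolding g_def by (rule cSUP_least[OF H0 that])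
  have gf: "g x \<le> f x" for x by (rule least) (auto simp: H_def)
  have gc: "convex_on UNIV g"
  proof (rule convex_onI)
    fix t :: real and a b :: 'a assume t: "0 < t" "t < 1"
    show "g ((1 - t) *\<^sub>R a + t *\<^sub>R b) \<le> (1 - t) * g a + t * g b"
    proof (rule least)
      fix h assume h: "h \<in> H"
      then have "h ((1 - t) *\<^sub>R a + t *\<^sub>R b) \<le> (1 - t) * h a + t * h b"
        using t by (intro convex_onD) (auto simp: H_def)
      also have "\<dots> \<le> (1 - t) * g a + t * g b" using up[OF h] t by (intro add_mono mult_left_mono) auto
      finally show "h ((1 - t) *\<^sub>R a + t *\<^sub>R b) \<le> (1 - t) * g a + t * g b" .
    qed
  qed simp
  have gsc: "semiconvex c (\<lambda>x. - g x)"
    unfolding semiconvex_def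
  proof (intro allI impI)
    fix a b :: 'a and t :: real assume t: "0 \<le> t \<and> t \<le> 1"
    define e where "e = c / 2 * (t * (1 - t) * (norm (a - b))\<^sup>2)"
    define k where "k x = (1 - t) * g (x + t *\<^sub>R (a - b)) + t * g (x - (1 - t) *\<^sub>R (a - b)) - e" for x
    have "k \<in> H" unfolding H_def
    proof (intro CollectI conjI allI)
      show "convex_on UNIV k"
      proof (rule convex_onI)
        fix s :: real and x y :: 'a assume s: "0 < s" "s < 1"
        have e1: "(1 - s) *\<^sub>R x + s *\<^sub>R y + t *\<^sub>R (a - b) = (1 - s) *\<^sub>R (x + t *\<^sub>R (a - b)) + s *\<^sub>R (y + t *\<^sub>R (a - b))"
          by (simp add: algebra_simps)
        have e2: "(1 - s) *\<^sub>R x + s *\<^sub>R y - (1 - t) *\<^sub>R (a - b) = (1 - s) *\<^sub>R (x - (1 - t) *\<^sub>R (a - b)) + s *\<^sub>R (y - (1 - t) *\<^sub>R (a - b))"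
          by (simp add: algebra_simps)
        have "(1 - t) * g ((1 - s) *\<^sub>R x + s *\<^sub>R y + t *\<^sub>R (a - b)) \<le> (1 - t) * ((1 - s) * g (x + t *\<^sub>R (a - b)) + s * g (y + t *\<^sub>R (a - b)))"
          unfolding e1 using t s by (intro mult_left_mono convex_onD[OF gc]) auto
        moreover have "t * g ((1 - s) *\<^sub>R x + s *\<^sub>R y - (1 - t) *\<^sub>R (a - b)) \<le> t * ((1 - s) * g (x - (1 - t) *\<^sub>R (a - b)) + s * g (y - (1 - t) *\<^sub>R (a - b)))"
          unfolding e2 using t s by (intro mult_left_mono convex_onD[OF gc]) auto
        ultimately show "k ((1 - s) *\<^sub>R x + s *\<^sub>R y) \<le> (1 - s) * k x + s * k y"
          unfolding k_def by (simp add: algebra_simps)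
      qed simp
      fix x
      have d: "(1 - t) *\<^sub>R (x + t *\<^sub>R (a - b)) + t *\<^sub>R (x - (1 - t) *\<^sub>R (a - b)) = x"
        "x + t *\<^sub>R (a - b) - (x - (1 - t) *\<^sub>R (a - b)) = a - b"
        by (simp_all add: algebra_simps)
      have "k x \<le> (1 - t) * f (x + t *\<^sub>R (a - b)) + t * f (x - (1 - t) *\<^sub>R (a - b)) - e"
        unfolding k_def using t gf by (intro diff_right_mono add_mono mult_left_mono) auto
      also have "\<dots> \<le> f x"
        using sc[unfolded semiconvex_def, rule_format, OF t, of "x + t *\<^sub>R (a - b)" "x - (1 - t) *\<^sub>R (a - b)", unfolded d]
        unfolding e_def by linarith
      finally show "k x \<le> f x" .
    qed
    then have "k ((1 - t) *\<^sub>R a + t *\<^sub>R b) \<le> g ((1 - t) *\<^sub>R a + t *\<^sub>R b)" by (rule up)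
    moreover have "(1 - t) *\<^sub>R a + t *\<^sub>R b + t *\<^sub>R (a - b) = a" "(1 - t) *\<^sub>R a + t *\<^sub>R b - (1 - t) *\<^sub>R (a - b) = b"
      by (simp_all add: algebra_simps)
    ultimately show "- g ((1 - t) *\<^sub>R a + t *\<^sub>R b) \<le> (1 - t) * - g a + t * - g b + c / 2 * (t * (1 - t) * (norm (a - b))\<^sup>2)"
      unfolding k_def e_def by simp
  qed
  show thesis by (rule that[OF gc gf _ gsc]) (rule up, simp add: H_def)
qed

section \<open>Upper semicontinuity and sup-convolutions\<close>

definition usc :: "'a::topological_space set \<Rightarrow> ('a \<Rightarrow> real) \<Rightarrow> bool" where
  "usc X u \<longleftrightarrow> (\<forall>x\<in>X. \<forall>c. u x < c \<longrightarrow> (\<forall>\<^sub>F y in at x within X. u y < c))"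

lemma uscD: "usc X u \<Longrightarrow> x \<in> X \<Longrightarrow> u x < c \<Longrightarrow> \<forall>\<^sub>F y in at x within X. u y < c"
  by (auto simp: usc_def)

lemma uscD_ball:
  fixes X :: "'a::metric_space set"
  assumes "usc X u" "x \<in> X" "u x < c"
  obtains d where "0 < d" "\<And>y. y \<in> X \<Longrightarrow> dist y x < d \<Longrightarrow> u y < c"
proof -
  from uscD[OF assms] obtain d where "0 < d" "\<forall>y\<in>X. y \<noteq> x \<and> dist y x < d \<longrightarrow> u y < c"
    by (auto simp: eventually_at)
  then show thesis using that[of d] assms(3) by metis
qed

lemma usc_subset: "usc X u \<Longrightarrow> Y \<subseteq> X \<Longrightarrow> usc Y u"
  unfolding usc_def by (meson at_le filter_leD subset_iff)

lemma continuous_imp_usc: "continuous_on X u \<Longrightarrow> usc X u"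
  unfolding usc_def continuous_on_def by (auto intro: order_tendstoD)

lemma usc_add:
  assumes "usc X u" "usc X v"
  shows "usc X (\<lambda>x. u x + v x)"
  unfolding usc_def
proof (intro ballI allI impI)
  fix x c assume x: "x \<in> X" and c: "u x + v x < c"
  let ?d = "(c - u x - v x) / 2"
  have "\<forall>\<^sub>F y in at x within X. u y < u x + ?d" "\<forall>\<^sub>F y in at x within X. v y < v x + ?d"
    using assms x c by (auto intro!: uscD)
  then show "\<forall>\<^sub>F y in at x within X. u y + v y < c"
    by eventually_elim (simp add: field_simps)
qed

lemma usc_attains_sup:
  fixes K :: "'a::topological_space set"
  assumes K: "compact K" "K \<noteq> {}" and u: "usc K u"
  obtains x where "x \<in> K" "\<And>y. y \<in> K \<Longrightarrow> u y \<le> u x"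
proof -
  have "\<exists>x\<in>K. \<forall>y\<in>K. u y \<le> u x"
  proof (rule ccontr)
    assume "\<not> ?thesis"
    then obtain Y where Y: "\<And>x. x \<in> K \<Longrightarrow> Y x \<in> K \<and> u x < u (Y x)" by (metis not_le)
    have "\<exists>U. open U \<and> x \<in> U \<and> (\<forall>y\<in>U \<inter> K. u y < u (Y x))" if "x \<in> K" for x
      using uscD[OF u that, of "u (Y x)"] Y[OF that] by (auto simp: eventually_at_topological)
    then obtain U where U: "\<And>x. x \<in> K \<Longrightarrow> open (U x) \<and> x \<in> U x \<and> (\<forall>y\<in>U x \<inter> K. u y < u (Y x))" by metis
    obtain C where C: "C \<subseteq> K" "finite C" "K \<subseteq> (\<Union>x\<in>C. U x)"
      by (rule compactE_image[OF K(1), of K U]) (use U in auto)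
    have "C \<noteq> {}" using C K by auto
    define m where "m = Max ((\<lambda>x. u (Y x)) ` C)"
    have "m \<in> (\<lambda>x. u (Y x)) ` C" unfolding m_def using C \<open>C \<noteq> {}\<close> by (intro Max_in) auto
    then obtain j where j: "j \<in> C" "m = u (Y j)" by auto
    have "Y j \<in> K" using Y j C by auto
    then obtain i where i: "i \<in> C" "Y j \<in> U i" using C(3) by auto
    have "u (Y j) < u (Y i)" using U[of i] i C \<open>Y j \<in> K\<close> by auto
    moreover have "u (Y i) \<le> m" unfolding m_def using C i by (intro Max_ge) auto
    ultimately show False using j by simp
  qed
  then show thesis using that by blast
qed

text \<open>A relation that includes attainment, because the maximising \<open>y\<close> is the
  point to which test functions are carried. The argument ranges over the whole space while
  \<open>y\<close> stays in \<open>K\<close>, so \<open>u\<close> is never extended beyond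
  \<open>K\<close>.\<close>

definition is_supconv :: "'a::real_inner set \<Rightarrow> ('a \<Rightarrow> real) \<Rightarrow> real \<Rightarrow> ('a \<Rightarrow> real) \<Rightarrow> bool" where
  "is_supconv K u k U \<longleftrightarrow> (\<forall>x. (\<exists>y\<in>K. U x = u y - k / 2 * (norm (x - y))\<^sup>2) \<and>
     (\<forall>y\<in>K. u y - k / 2 * (norm (x - y))\<^sup>2 \<le> U x))"

lemma ex_supconv:
  fixes K :: "'a::euclidean_space set"
  assumes "compact K" "K \<noteq> {}" "usc K u"
  obtains U where "is_supconv K u k U"
proof -
  have "\<exists>s. (\<exists>y\<in>K. s = u y - k / 2 * (norm (x - y))\<^sup>2) \<and> (\<forall>y\<in>K. u y - k / 2 * (norm (x - y))\<^sup>2 \<le> s)" for x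
  proof -
    have "usc K (\<lambda>y. u y + - (k / 2 * (norm (x - y))\<^sup>2))"
      by (intro usc_add assms continuous_imp_usc continuous_intros)
    then obtain y where "y \<in> K" "\<And>y'. y' \<in> K \<Longrightarrow> u y' + - (k / 2 * (norm (x - y'))\<^sup>2) \<le> u y + - (k / 2 * (norm (x - y))\<^sup>2)"
      by (rule usc_attains_sup[OF assms(1,2)]) blast
    then show ?thesis by (intro exI[of _ "u y - k / 2 * (norm (x - y))\<^sup>2"]) auto
  qed
  then show thesis using that unfolding is_supconv_def by metis
qed

text \<open>For fixed \<open>y\<close> the competitor is a constant minus \<open>k / 2\<close> times
  a squared distance, with convexity defect exactly \<open>k\<close>; the maximum over
  \<open>y\<close> can only be larger at the two end points.\<close>

lemma supconv_semiconvex: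
  assumes "is_supconv K u k U"
  shows "semiconvex k U"
  unfolding semiconvex_def
proof (intro allI impI)
  fix a b and t :: real assume t: "0 \<le> t \<and> t \<le> 1"
  obtain y where y: "y \<in> K" "U ((1 - t) *\<^sub>R a + t *\<^sub>R b) = u y - k / 2 * (norm ((1 - t) *\<^sub>R a + t *\<^sub>R b - y))\<^sup>2"
    using assms unfolding is_supconv_def by blast
  have e: "(1 - t) *\<^sub>R a + t *\<^sub>R b - y = (1 - t) *\<^sub>R (a - y) + t *\<^sub>R (b - y)" by (simp add: algebra_simps)
  have "(norm ((1 - t) *\<^sub>R a + t *\<^sub>R b - y))\<^sup>2 = (1 - t) * (norm (a - y))\<^sup>2 + t * (norm (b - y))\<^sup>2 - t * (1 - t) * (norm (a - b))\<^sup>2"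
    unfolding e using norm_sq_convex_comb[of t "a - y" "b - y"] by simp
  then have "U ((1 - t) *\<^sub>R a + t *\<^sub>R b) = (1 - t) * (u y - k / 2 * (norm (a - y))\<^sup>2) + t * (u y - k / 2 * (norm (b - y))\<^sup>2)
     + k / 2 * (t * (1 - t) * (norm (a - b))\<^sup>2)"
    unfolding y(2) by (simp only:) (simp add: field_simps)
  also have "\<dots> \<le> (1 - t) * U a + t * U b + k / 2 * (t * (1 - t) * (norm (a - b))\<^sup>2)"
    using assms y(1) t unfolding is_supconv_def by (intro add_mono mult_left_mono order_refl) auto
  finally show "U ((1 - t) *\<^sub>R a + t *\<^sub>R b) \<le> (1 - t) * U a + t * U b + k / 2 * (t * (1 - t) * (norm (a - b))\<^sup>2)" .
qed

text \<open>A plane touching a semiconvex function from above also bounds it below up to a quadratic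
  (\<open>low\<close>). The lower bound from \<open>x\<close> and the plane from \<open>x'\<close>
  are compared at \<open>x' - t *\<^sub>R e\<close>, where \<open>e\<close> is the unit direction of
  \<open>q - p\<close>; then \<open>t\<close> is the distance of the contact points, or tends to 0
  if they coincide.\<close>

lemma semiconvex_contact_slopes:
  fixes w :: "'a::real_inner \<Rightarrow> real"
  assumes sc: "semiconvex c w" and c: "0 \<le> c"
    and p: "\<And>y. w y \<le> w x + p \<bullet> (y - x)" and q: "\<And>y. w y \<le> w x' + q \<bullet> (y - x')"
  shows "norm (q - p) \<le> 4 * c * norm (x' - x)"
proof (cases "q = p")
  case False
  have low: "w x + p \<bullet> h - c * (norm h)\<^sup>2 \<le> w (x + h)" for h
  proof -
    have "midpoint (x + h) (x - h) = x" by (simp add: midpoint_def scaleR_2[symmetric])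
    moreover have "(norm (x + h - (x - h)))\<^sup>2 = 4 * (norm h)\<^sup>2"
    proof -
      have "x + h - (x - h) = 2 *\<^sub>R h" by (simp add: scaleR_2)
      then show ?thesis by (simp add: power_mult_distrib)
    qed
    ultimately show ?thesis using semiconvex_midpoint[OF sc, of "x + h" "x - h"] p[of "x - h"] by simp
  qed
  define e where "e = (1 / norm (q - p)) *\<^sub>R (q - p)"
  have e: "norm e = 1" "(q - p) \<bullet> e = norm (q - p)"
    using False by (auto simp: e_def power2_norm_eq_inner[symmetric] power2_eq_square)
  have key: "t * norm (q - p) \<le> c * (t + norm (x' - x))\<^sup>2" if "0 < t" for t
  proof -
    let ?z = "x' - t *\<^sub>R e"
    have "w x + p \<bullet> (?z - x) - c * (norm (?z - x))\<^sup>2 \<le> w ?z" using low[of "?z - x"] by simp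
    also have "\<dots> \<le> w x' + q \<bullet> (?z - x')" by (rule q)
    also have "\<dots> \<le> w x + p \<bullet> (x' - x) + q \<bullet> (?z - x')" using p[of x'] by simp
    finally have "(q - p) \<bullet> (t *\<^sub>R e) \<le> c * (norm (?z - x))\<^sup>2" by (simp add: inner_simps algebra_simps)
    moreover have "norm (?z - x) \<le> t + norm (x' - x)"
      using norm_triangle_ineq4[of "x' - x" "t *\<^sub>R e"] e that by (simp add: algebra_simps)
    then have "c * (norm (?z - x))\<^sup>2 \<le> c * (t + norm (x' - x))\<^sup>2" using c by (intro mult_left_mono power_mono) auto
    ultimately show ?thesis using e by simp
  qed
  show ?thesis
  proof (cases "x' = x")
    case True
    have "norm (q - p) \<le> c * t" if "0 < t" for t
      using key[OF that] that by (simp add: True power2_eq_square)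
    from this[of "norm (q - p) / (2 * (c + 1))"] have "norm (q - p) * (2 * (c + 1)) \<le> c * norm (q - p)"
      using False c by (simp add: field_simps)
    then have "norm (q - p) * (c + 2) \<le> 0" by (simp add: algebra_simps)
    then show ?thesis using False c by (simp add: mult_le_0_iff)
  next
    case False
    then show ?thesis using key[of "norm (x' - x)"] by (simp add: power2_eq_square)
  qed
qed (use c in auto)

text \<open>An extra \<eta> / 2 |y - x|^2 beats the error \<open>\<eta>' * r\<^sup>2\<close> on the
  sphere of radius \<open>r\<close>, while the polynomial agrees with \<open>U\<close> at the
  centre. So polynomial minus \<open>U\<close> attains its minimum over the ball at an interior
  point, where a vertical translate touches \<open>U\<close> from above.\<close>

lemma slide_quadratic_test:
  fixes U :: "real^'n \<Rightarrow> real"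
  assumes U: "continuous_on UNIV U" and B: "transpose B = B" and r: "0 < r" and e: "\<eta>' < \<eta> / 2"
    and le: "\<And>y. dist x y \<le> r \<Longrightarrow> U y \<le> U x + l \<bullet> (y - x) + (y - x) \<bullet> (B *v (y - x)) / 2 + \<eta>' * r\<^sup>2"
  obtains z l' \<rho> where "dist x z < r" "0 < \<rho>"
    "\<And>y. dist z y < \<rho> \<Longrightarrow> U y \<le> U z + l' \<bullet> (y - z) + (y - z) \<bullet> ((B + \<eta> *\<^sub>R mat 1) *v (y - z)) / 2"
proof -
  define B' where "B' = B + \<eta> *\<^sub>R mat 1"
  have B': "transpose B' = B'" using B by (simp add: B'_def transpose_def vec_eq_iff mat_def)
  have B'v: "h \<bullet> (B' *v h) = h \<bullet> (B *v h) + \<eta> * (norm h)\<^sup>2" for h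
    by (simp add: B'_def matrix_vector_mult_add_rdistrib scaleR_matrix_vector_assoc[symmetric] inner_simps power2_norm_eq_inner)
  define q where "q y = U x + l \<bullet> (y - x) + (y - x) \<bullet> (B' *v (y - x)) / 2" for y
  have qs: "q y = q z + (l + B' *v (z - x)) \<bullet> (y - z) + (y - z) \<bullet> (B' *v (y - z)) / 2" for y z
  proof -
    have e: "y - x = (z - x) + (y - z)" by simp
    have "(y - x) \<bullet> (B' *v (y - x)) = (z - x) \<bullet> (B' *v (z - x)) + 2 * ((z - x) \<bullet> (B' *v (y - z))) + (y - z) \<bullet> (B' *v (y - z))"
      unfolding e by (rule quad_form_add[OF B'])
    moreover have "l \<bullet> (y - x) = l \<bullet> (z - x) + l \<bullet> (y - z)" by (simp add: inner_simps)
    moreover have "(z - x) \<bullet> (B' *v (y - z)) = (B' *v (z - x)) \<bullet> (y - z)" using sym_dot[OF B'] by (simp add: inner_commute)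
    ultimately show ?thesis unfolding q_def inner_add_left by linarith
  qed
  have cq: "continuous_on UNIV q" unfolding q_def
    by (intro continuous_intros bounded_linear.continuous_on[OF matrix_vector_mul_bounded_linear]) auto
  have "continuous_on (cball x r) (\<lambda>y. q y - U y)"
    by (intro continuous_on_diff continuous_on_subset[OF cq] continuous_on_subset[OF U]) auto
  then obtain z where z: "z \<in> cball x r" "\<And>y. y \<in> cball x r \<Longrightarrow> q z - U z \<le> q y - U y"
    using continuous_attains_inf[of "cball x r" "\<lambda>y. q y - U y"] r by auto
  have "q x = U x" by (simp add: q_def)
  then have z0: "q z - U z \<le> 0" using z(2)[of x] r by simp
  have zr: "dist x z < r"
  proof (rule ccontr)
    assume "\<not> dist x z < r"
    then have d: "dist x z = r" using z(1) by simp
    then have n: "norm (z - x) = r" by (simp add: dist_norm norm_minus_commute)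
    have "U z \<le> U x + l \<bullet> (z - x) + (z - x) \<bullet> (B *v (z - x)) / 2 + \<eta>' * r\<^sup>2" using le[of z] d by simp
    moreover have "q z = U x + l \<bullet> (z - x) + (z - x) \<bullet> (B *v (z - x)) / 2 + \<eta> / 2 * r\<^sup>2"
      by (simp add: q_def B'v n add_divide_distrib)
    ultimately have "\<eta> / 2 * r\<^sup>2 \<le> \<eta>' * r\<^sup>2" using z0 by linarith
    then show False using e r by simp
  qed
  show thesis
  proof (rule that[OF zr])
    show "0 < r - dist x z" using zr by simp
    fix y assume "dist z y < r - dist x z"
    then have "y \<in> cball x r" using dist_triangle[of x y z] by simp
    from z(2)[OF this] show "U y \<le> U z + (l + B' *v (z - x)) \<bullet> (y - z) + (y - z) \<bullet> ((B + \<eta> *\<^sub>R mat 1) *v (y - z)) / 2"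
      unfolding B'_def[symmetric] using qs[of y z] by simp
  qed
qed

text \<open>Shifting both arguments of the penalty by \<open>z - y0\<close> leaves it unchanged, so
  what touches \<open>U\<close> at \<open>z\<close> touches \<open>u\<close> at the maximiser
  \<open>y0\<close>, with the same gradient and Hessian.\<close>

lemma supconv_test_transfer:
  fixes U :: "'a::real_inner \<Rightarrow> real"
  assumes s: "is_supconv K u k U" and y0: "U z = u y0 - k / 2 * (norm (z - y0))\<^sup>2"
    and t: "\<And>y. dist z y < \<rho> \<Longrightarrow> U y \<le> U z + q (y - z)" and y: "y \<in> K" "dist y0 y < \<rho>"
  shows "u y \<le> u y0 + q (y - y0)"
proof -
  have "u y - k / 2 * (norm (y + (z - y0) - y))\<^sup>2 \<le> U (y + (z - y0))" using s y unfolding is_supconv_def by blast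
  also have "\<dots> \<le> U z + q (y + (z - y0) - z)"
  proof (rule t)
    have "z - (y + (z - y0)) = y0 - y" by simp
    then show "dist z (y + (z - y0)) < \<rho>" using y by (simp add: dist_norm)
  qed
  finally show ?thesis using y0 by simp
qed

text \<open>The strict inequality on the diagonal over \<open>B\<close> extends to nearby pairs,
  uniformly by a Lebesgue number. Sup-convolutions evaluate \<open>u\<close> and \<open>v\<close> at
  such pairs.\<close>

lemma usc_sum_separated:
  fixes u v :: "'a::metric_space \<Rightarrow> real"
  assumes u: "usc K u" and v: "usc K v" and B: "compact B" "B \<subseteq> K" and lt: "\<And>x. x \<in> B \<Longrightarrow> u x + v x < \<kappa>"
  obtains d where "0 < d"
    "\<And>y y'. y \<in> K \<Longrightarrow> y' \<in> K \<Longrightarrow> dist y y' < d \<Longrightarrow> y \<in> B \<or> y' \<in> B \<Longrightarrow> u y + v y' < \<kappa>"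
proof -
  have "\<exists>\<delta>>0. \<forall>y\<in>K. \<forall>y'\<in>K. dist y b < \<delta> \<and> dist y' b < \<delta> \<longrightarrow> u y + v y' < \<kappa>" if b: "b \<in> B" for b
  proof -
    define \<rho> where "\<rho> = (\<kappa> - (u b + v b)) / 2"
    have \<rho>: "0 < \<rho>" "u b + \<rho> + (v b + \<rho>) = \<kappa>" using lt[OF b] by (auto simp: \<rho>_def field_simps)
    have bK: "b \<in> K" using b B by auto
    obtain d1 where d1: "0 < d1" "\<And>y. y \<in> K \<Longrightarrow> dist y b < d1 \<Longrightarrow> u y < u b + \<rho>"
      using uscD_ball[OF u bK, of "u b + \<rho>"] \<rho>(1) by (metis less_add_same_cancel1)
    obtain d2 where d2: "0 < d2" "\<And>y. y \<in> K \<Longrightarrow> dist y b < d2 \<Longrightarrow> v y < v b + \<rho>"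
      using uscD_ball[OF v bK, of "v b + \<rho>"] \<rho>(1) by (metis less_add_same_cancel1)
    have "u y + v y' < \<kappa>" if "y \<in> K" "y' \<in> K" "dist y b < min d1 d2" "dist y' b < min d1 d2" for y y'
      using d1(2)[OF that(1)] d2(2)[OF that(2)] that(3,4) \<rho>(2) by simp
    then show ?thesis using d1(1) d2(1) by (intro exI[of _ "min d1 d2"]) auto
  qed
  then obtain \<delta> where \<delta>: "\<And>b. b \<in> B \<Longrightarrow> 0 < \<delta> b \<and> (\<forall>y\<in>K. \<forall>y'\<in>K. dist y b < \<delta> b \<and> dist y' b < \<delta> b \<longrightarrow> u y + v y' < \<kappa>)"
    by metis
  obtain d where d: "0 < d" "\<And>x. x \<in> B \<Longrightarrow> \<exists>G\<in>(\<lambda>b. ball b (\<delta> b)) ` B. ball x d \<subseteq> G"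
    by (rule Heine_Borel_lemma[OF B(1), of "(\<lambda>b. ball b (\<delta> b)) ` B"]) (use \<delta> in \<open>auto intro!: bexI\<close>)
  show thesis
  proof (rule that[OF d(1)])
    fix y y' assume y: "y \<in> K" "y' \<in> K" "dist y y' < d" "y \<in> B \<or> y' \<in> B"
    then obtain x where x: "x \<in> B" "y \<in> ball x d" "y' \<in> ball x d" using d(1) by (auto simp: dist_commute)
    then obtain b where "b \<in> B" "ball x d \<subseteq> ball b (\<delta> b)" using d(2) by blast
    then have "y \<in> ball b (\<delta> b)" "y' \<in> ball b (\<delta> b)" using x by auto
    then show "u y + v y' < \<kappa>" using \<delta>[OF \<open>b \<in> B\<close>] y(1,2) by (simp add: dist_commute)
  qed
qed

lemma supconv_le:
  assumes U: "is_supconv K u k U" and k: "0 \<le> k" and M: "\<And>y. y \<in> K \<Longrightarrow> u y \<le> M" and R: "\<And>y. y \<in> K \<Longrightarrow> norm y \<le> R"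
    and z: "R \<le> norm z"
  shows "U z \<le> M - k / 2 * (norm z - R)\<^sup>2"
proof -
  obtain y where y: "y \<in> K" "U z = u y - k / 2 * (norm (z - y))\<^sup>2" using U unfolding is_supconv_def by blast
  have "norm z - R \<le> norm (z - y)" using R[OF y(1)] norm_triangle_ineq2[of z y] by simp
  then have "k / 2 * (norm z - R)\<^sup>2 \<le> k / 2 * (norm (z - y))\<^sup>2" using k z by (intro mult_left_mono power_mono) auto
  then show ?thesis using y M[OF y(1)] by simp
qed

lemma parallelogram_dist:
  fixes y y' z :: "'a::real_inner"
  shows "(norm (y - y'))\<^sup>2 \<le> 2 * ((norm (z - y))\<^sup>2 + (norm (z - y'))\<^sup>2)"
proof -
  have "(norm (y - y'))\<^sup>2 + (norm ((z - y) + (z - y')))\<^sup>2 = 2 * ((norm (z - y))\<^sup>2 + (norm (z - y'))\<^sup>2)"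
    by (simp add: power2_norm_eq_inner inner_simps inner_commute)
  then show ?thesis by (smt (verit) zero_le_power2)
qed

text \<open>\<open>B\<close> plays the role of the boundary. The Hessians are opposite up to \<eta>,
  at points \<open>y\<close> and \<open>y'\<close> that need not coincide; this is enough because
  the subequation does not depend on the point.\<close>

theorem viscosity_sum_lemma:
  fixes u v :: "real^'n \<Rightarrow> real"
  assumes K: "compact K" and u: "usc K u" and v: "usc K v" and B: "compact B" "B \<subseteq> K"
    and Bneg: "\<And>x. x \<in> B \<Longrightarrow> u x + v x \<le> 0" and xs: "xs \<in> K" "0 < u xs + v xs" and \<eta>: "0 < \<eta>"
  obtains A y l y' l' \<rho> where "transpose A = A" "0 < \<rho>" "y \<in> K - B" "y' \<in> K - B"
    "\<And>z. z \<in> K \<Longrightarrow> dist y z < \<rho> \<Longrightarrow> u z \<le> u y + (l \<bullet> (z - y) + (z - y) \<bullet> ((A + \<eta> *\<^sub>R mat 1) *v (z - y)) / 2)"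
    "\<And>z. z \<in> K \<Longrightarrow> dist y' z < \<rho> \<Longrightarrow> v z \<le> v y' + (l' \<bullet> (z - y') + (z - y') \<bullet> ((- A + \<eta> *\<^sub>R mat 1) *v (z - y')) / 2)"
proof -
  have K0: "K \<noteq> {}" using xs by auto
  define w0 where "w0 = u xs + v xs"
  have w0: "0 < w0" using xs by (simp add: w0_def)
  obtain M where M: "0 < M" "\<And>y. y \<in> K \<Longrightarrow> u y \<le> M" "\<And>y. y \<in> K \<Longrightarrow> v y \<le> M"
  proof -
    obtain a where a: "\<And>y. y \<in> K \<Longrightarrow> u y \<le> u a" using usc_attains_sup[OF K K0 u] by blast
    obtain b where b: "\<And>y. y \<in> K \<Longrightarrow> v y \<le> v b" using usc_attains_sup[OF K K0 v] by blast
    show thesis by (rule that[of "max 1 (max (u a) (v b))"]) (auto simp: le_max_iff_disj a b)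
  qed
  obtain R where R: "0 < R" "\<And>y. y \<in> K \<Longrightarrow> norm y \<le> R"
    using compact_imp_bounded[OF K] unfolding bounded_pos by blast
  obtain d where d: "0 < d"
    "\<And>y y'. y \<in> K \<Longrightarrow> y' \<in> K \<Longrightarrow> dist y y' < d \<Longrightarrow> y \<in> B \<or> y' \<in> B \<Longrightarrow> u y + v y' < w0 / 2"
    using usc_sum_separated[OF u v B, of "w0 / 2"] Bneg w0 by (smt (verit) half_gt_zero)
  \<comment> \<open>At a point where \<open>w\<close> is at least \<open>w0 / 2\<close> the two
    penalties add up to at most \<open>2 * M\<close>. With \<open>8 * M < k * d\<^sup>2\<close> this
    puts the maximisers for \<open>U\<close> and \<open>V\<close> within distance \<open>d\<close>,
    hence both outside \<open>B\<close> (\<open>inner_pts\<close>).\<close>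
  define k where "k = 8 * M / d\<^sup>2 + 1"
  have k1: "1 \<le> k" using M(1) by (simp add: k_def)
  have kd: "8 * M < k * d\<^sup>2" using d(1) by (simp add: k_def field_simps)
  obtain U where U: "is_supconv K u k U" by (rule ex_supconv[OF K K0 u])
  obtain V where V: "is_supconv K v k V" by (rule ex_supconv[OF K K0 v])
  define w where "w x = U x + V x" for x
  have scU: "semiconvex k U" and scV: "semiconvex k V" using U V by (auto intro: supconv_semiconvex)
  have scw: "semiconvex (2 * k) w" using semiconvex_add[OF scU scV] by (simp add: w_def[abs_def])
  have cw: "continuous_on S w" for S by (rule semiconvex_continuous[OF scw])
  have wxs: "w0 \<le> w xs"
  proof -
    have "u xs - k / 2 * (norm (xs - xs))\<^sup>2 \<le> U xs" "v xs - k / 2 * (norm (xs - xs))\<^sup>2 \<le> V xs"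
      using U V xs(1) unfolding is_supconv_def by blast+
    then show ?thesis by (simp add: w0_def w_def)
  qed
  have inner_pts: "y \<notin> B \<and> y' \<notin> B" if y: "y \<in> K" "U z = u y - k / 2 * (norm (z - y))\<^sup>2"
    and y': "y' \<in> K" "V z = v y' - k / 2 * (norm (z - y'))\<^sup>2" and wz: "w0 / 2 \<le> w z" for y y' z
  proof -
    have eq: "k / 2 * ((norm (z - y))\<^sup>2 + (norm (z - y'))\<^sup>2) = u y + v y' - w z"
      using y y' by (simp add: w_def algebra_simps)
    also have "\<dots> \<le> 2 * M" using M(2)[OF y(1)] M(3)[OF y'(1)] wz w0 by simp
    finally have "k * (2 * ((norm (z - y))\<^sup>2 + (norm (z - y'))\<^sup>2)) \<le> 8 * M" by (simp add: algebra_simps)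
    moreover have "k * (norm (y - y'))\<^sup>2 \<le> k * (2 * ((norm (z - y))\<^sup>2 + (norm (z - y'))\<^sup>2))"
      using parallelogram_dist k1 by (intro mult_left_mono) auto
    ultimately have "k * (norm (y - y'))\<^sup>2 < k * d\<^sup>2" using kd by linarith
    then have "(norm (y - y'))\<^sup>2 < d\<^sup>2" using k1 by (simp add: mult_less_cancel_left)
    then have "dist y y' < d" using d(1) by (simp add: dist_norm power_less_imp_less_base)
    moreover have "w0 / 2 \<le> u y + v y'"
    proof -
      have "0 \<le> k / 2 * ((norm (z - y))\<^sup>2 + (norm (z - y'))\<^sup>2)" using k1 by simp
      then show ?thesis using eq wz by linarith
    qed
    ultimately show ?thesis using d(2)[OF y(1) y'(1)] by force
  qed
  \<comment> \<open>Beyond radius \<open>R1\<close> the penalty makes \<open>w\<close> drop below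
    every plane of slope at most 1 that is at least \<open>w0\<close> at \<open>xs\<close>, so
    contact points stay in the ball of radius \<open>R1\<close>.\<close>
  define R1 where "R1 = 2 * M + 3 * R + 1"
  have far: "w x < w0 - 2 * R - t" if x: "R1 < norm x" and t: "t \<le> norm x - R" for x t
  proof -
    have b: "R \<le> norm x" using x M(1) R(1) by (simp add: R1_def)
    define s where "s = norm x - R"
    have s: "2 * M + 2 * R + 1 < s" using x by (simp add: R1_def s_def)
    have "1 * s\<^sup>2 \<le> k * s\<^sup>2" using k1 by (intro mult_right_mono) auto
    then have "w x \<le> 2 * M - s\<^sup>2"
      using supconv_le[OF U _ M(2) R(2) b] supconv_le[OF V _ M(3) R(2) b] k1 unfolding w_def s_def[symmetric] by simp
    moreover have "(2 * M + 2 * R + 1) * s \<le> s * s" using s M R by (intro mult_right_mono) auto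
    moreover have "(2 * M + 2 * R) * 1 \<le> (2 * M + 2 * R) * s" using s M(1) R(1) by (intro mult_left_mono) auto
    ultimately show ?thesis using w0 t by (simp add: power2_eq_square algebra_simps s_def)
  qed
  \<comment> \<open>With slopes this small, a contact plane changes by at most \<open>w0 / 4\<close>
    between \<open>xs\<close> and the contact point. So \<open>w\<close> is at least
    \<open>3 / 4 * w0\<close> on \<open>E\<close> and still at least \<open>w0 / 2\<close> nearby,
    as \<open>inner_pts\<close> requires.\<close>
  define p0 where "p0 = min 1 (w0 / (4 * (R + R1)))"
  have RR: "0 < R + R1" using R M by (simp add: R1_def)
  have p0: "0 < p0" "p0 \<le> 1" "p0 * (R + R1) \<le> w0 / 4"
  proof -
    show "0 < p0" "p0 \<le> 1" using w0 RR by (auto simp: p0_def)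
    have "p0 * (R + R1) \<le> w0 / (4 * (R + R1)) * (R + R1)" using RR by (intro mult_right_mono) (auto simp: p0_def)
    moreover have "w0 / (4 * S) * S = w0 / 4" if "0 < S" for S using that by simp
    ultimately show "p0 * (R + R1) \<le> w0 / 4" using RR by metis
  qed
  define contact where "contact x p \<longleftrightarrow> (\<forall>y. w y \<le> w x + p \<bullet> (y - x))" for x p
  define E where "E = {x. \<exists>p. norm p \<le> p0 \<and> contact x p}"
  have Eb: "norm x \<le> R1 \<and> 3 / 4 * w0 \<le> w x" if "x \<in> E" for x
  proof -
    obtain p where p: "norm p \<le> p0" "contact x p" using \<open>x \<in> E\<close> by (auto simp: E_def)
    have "w0 \<le> w x + p \<bullet> (xs - x)" using p(2) wxs unfolding contact_def by (meson order_trans)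
    also have "p \<bullet> (xs - x) \<le> norm p * norm (xs - x)" by (rule norm_cauchy_schwarz)
    also have "\<dots> \<le> p0 * (R + norm x)"
      using p R(2)[OF xs(1)] norm_triangle_ineq4[of xs x] p0 by (intro mult_mono) auto
    finally have l: "w0 - p0 * (R + norm x) \<le> w x" by simp
    have "norm x \<le> R1"
    proof (rule ccontr)
      assume "\<not> norm x \<le> R1"
      then have "w x < w0 - 2 * R - (norm x - R)" by (intro far) auto
      moreover have "p0 * (R + norm x) \<le> 1 * (R + norm x)" using p0 R(1) by (intro mult_right_mono) auto
      ultimately show False using l by simp
    qed
    moreover have "p0 * (R + norm x) \<le> p0 * (R + R1)" using calculation p0 by simp
    ultimately show ?thesis using l p0(3) by simp
  qed
  have Ebdd: "bounded E" using Eb by (auto simp: bounded_iff)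
  have surj: "\<exists>x. contact x p" if "norm p \<le> p0" for p
  proof -
    have RR1: "R \<le> R1" using M R by (simp add: R1_def)
    have "continuous_on (cball 0 R1) (\<lambda>x. w x - p \<bullet> x)" by (intro continuous_intros cw)
    then obtain x where x: "x \<in> cball 0 R1" "\<And>y. y \<in> cball 0 R1 \<Longrightarrow> w y - p \<bullet> y \<le> w x - p \<bullet> x"
      using continuous_attains_sup[of "cball 0 R1" "\<lambda>x. w x - p \<bullet> x"] RR1 R(1) by (auto simp: cball_eq_empty)
    have pn: "\<bar>p \<bullet> y\<bar> \<le> norm y" for y
      using Cauchy_Schwarz_ineq2[of p y] mult_right_mono[of "norm p" 1 "norm y"] that p0 by simp
    have "w y - p \<bullet> y \<le> w x - p \<bullet> x" for y
    proof (cases "norm y \<le> R1")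
      case False
      have "w y < w0 - 2 * R - (norm y - R)" by (intro far) (use False in auto)
      then have "w y - p \<bullet> y < w0 - R" using pn[of y] by (simp add: abs_le_iff)
      also have "\<dots> \<le> w xs - p \<bullet> xs" using wxs pn[of xs] R(2)[OF xs(1)] by (simp add: abs_le_iff)
      also have "\<dots> \<le> w x - p \<bullet> x" using R(2)[OF xs(1)] RR1 by (intro x(2)) auto
      finally show ?thesis by simp
    qed (use x in auto)
    then show ?thesis unfolding contact_def by (intro exI[of _ x]) (auto simp: inner_simps algebra_simps)
  qed
  \<comment> \<open>Every slope of norm at most \<open>p0\<close> occurs (\<open>surj\<close>), and
    the slope is a Lipschitz function of the contact point. If \<open>E\<close> were negligible so
    would be its image, which contains a ball.\<close>
  have Enn: "\<not> negligible E"
  proof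
    assume neg: "negligible E"
    define P where "P x = (SOME p. norm p \<le> p0 \<and> contact x p)" for x
    have P: "norm (P x) \<le> p0 \<and> contact x (P x)" if "x \<in> E" for x
      unfolding P_def by (rule someI_ex) (use that in \<open>auto simp: E_def\<close>)
    have lip: "norm (q - p) \<le> 8 * k * norm (x' - x)" if "contact x p" "contact x' q" for x p x' q
      using semiconvex_contact_slopes[OF scw, of x p x' q] that k1 by (auto simp: contact_def)
    have "negligible (P ` E)"
    proof (rule negligible_locally_Lipschitz_image[OF order_refl neg])
      fix x assume "x \<in> E"
      then show "\<exists>T B. open T \<and> x \<in> T \<and> (\<forall>y\<in>E \<inter> T. norm (P y - P x) \<le> B * norm (y - x))"
        using P lip by (intro exI[of _ UNIV] exI[of _ "8 * k"]) auto
    qed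
    moreover have "ball 0 p0 \<subseteq> P ` E"
    proof
      fix p :: "real^'n" assume "p \<in> ball 0 p0"
      then have p: "norm p \<le> p0" by simp
      then obtain x where x: "contact x p" using surj by blast
      then have "x \<in> E" using p by (auto simp: E_def)
      then have "norm (P x - p) \<le> 8 * k * norm (x - x)" using lip[OF x] P by blast
      then have "P x = p" by simp
      then show "p \<in> P ` E" using \<open>x \<in> E\<close> by blast
    qed
    ultimately have "negligible (ball (0::real^'n) p0)" using negligible_subset by blast
    moreover have "ball (0::real^'n) p0 \<noteq> {}" using p0(1) by simp
    ultimately show False using open_not_negligible[of "ball (0::real^'n) p0"] by blast
  qed
  have "uniformly_continuous_on (cball 0 (R1 + 1)) w" by (rule compact_uniformly_continuous[OF cw]) simp
  then obtain r1 where r1: "0 < r1" "\<And>x z. x \<in> cball 0 (R1 + 1) \<Longrightarrow> z \<in> cball 0 (R1 + 1) \<Longrightarrow> dist z x < r1 \<Longrightarrow> dist (w z) (w x) < w0 / 4"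
    unfolding uniformly_continuous_on_def using w0 by (metis divide_pos_pos zero_less_numeral)
  define r0 where "r0 = min 1 r1"
  have near: "w0 / 2 \<le> w z" if "x \<in> E" "dist x z < r0" for x z
  proof -
    have "norm z \<le> norm x + dist x z" using norm_triangle_sub[of z x] by (simp add: dist_norm norm_minus_commute)
    then have "dist (w z) (w x) < w0 / 4"
      using Eb[OF that(1)] that(2) by (intro r1(2)) (auto simp: r0_def dist_commute)
    then show ?thesis using Eb[OF that(1)] unfolding dist_real_def by linarith
  qed
  obtain x00 p00 where x00: "contact x00 p00" "norm p00 \<le> p0" using surj[of 0] p0 by auto
  text \<open>\<open>-\<Gamma>\<close> is the concave envelope of \<open>w\<close>.\<close>
  obtain \<Gamma> where G: "convex_on UNIV \<Gamma>" "\<And>x. \<Gamma> x \<le> - w x"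
    "\<And>h x. convex_on UNIV h \<Longrightarrow> (\<And>x. h x \<le> - w x) \<Longrightarrow> h x \<le> \<Gamma> x"
  proof (rule convex_envelope[of "\<lambda>x. - (w x00 + p00 \<bullet> (x - x00))" "\<lambda>x. - w x" "2 * k"])
    show "convex_on UNIV (\<lambda>x. - (w x00 + p00 \<bullet> (x - x00)))"
      by (rule convex_onI) (auto simp: inner_simps algebra_simps)
    show "- (w x00 + p00 \<bullet> (x - x00)) \<le> - w x" for x using x00(1)[unfolded contact_def, rule_format, of x] by linarith
    show "semiconvex (2 * k) (\<lambda>x. - (- w x))" using scw by simp
  qed blast
  have Gc: "- (w x + p \<bullet> (y - x)) \<le> \<Gamma> y" if "contact x p" for x p y
  proof (rule G(3)[of "\<lambda>y. - (w x + p \<bullet> (y - x))"])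
    show "convex_on UNIV (\<lambda>y. - (w x + p \<bullet> (y - x)))"
      by (rule convex_onI) (auto simp: inner_simps algebra_simps)
    show "- (w x + p \<bullet> (y - x)) \<le> - w y" for y using that[unfolded contact_def, rule_format, of y] by linarith
  qed
  \<comment> \<open>A function with two-sided second-order bounds is inserted between
    \<open>U\<close> and \<open>- \<Gamma> - V\<close>. \<open>U\<close> plus the quadratic is
    convex and below \<open>f\<close>, and \<open>f\<close> is semiconcave; the convex envelope
    \<open>g\<close> of \<open>f\<close> lies between them and inherits both properties. Removing
    the quadratic gives \<open>H\<close>.\<close>
  define f where "f x = - \<Gamma> x - V x + k / 2 * (norm x)\<^sup>2" for x
  have cU: "convex_on UNIV (\<lambda>x. U x + k / 2 * (norm x)\<^sup>2)" using scU semiconvex_iff_convex_on[of k U 0] by simp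
  have Uf: "U x + k / 2 * (norm x)\<^sup>2 \<le> f x" for x using G(2)[of x] by (simp add: f_def w_def)
  have scf: "semiconvex (2 * k) (\<lambda>x. - f x)"
  proof -
    have "semiconvex (0 + k + k) (\<lambda>x. \<Gamma> x + V x + - (k / 2 * (norm x)\<^sup>2))"
      by (intro semiconvex_add scV semiconvex_neg_half_norm_sq) (use G(1) semiconvex_0_iff in blast)
    moreover have "(\<lambda>x. \<Gamma> x + V x + - (k / 2 * (norm x)\<^sup>2)) = (\<lambda>x. - f x)" by (auto simp: f_def)
    ultimately show ?thesis by simp
  qed
  obtain g where g: "convex_on UNIV g" "\<And>x. g x \<le> f x"
    "\<And>h x. convex_on UNIV h \<Longrightarrow> (\<And>x. h x \<le> f x) \<Longrightarrow> h x \<le> g x" "semiconvex (2 * k) (\<lambda>x. - g x)"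
  proof (rule convex_envelope[OF cU Uf scf])
  qed blast
  define H where "H x = g x - k / 2 * (norm x)\<^sup>2" for x
  have H1: "semiconvex (2 * k) H"
  proof -
    have "semiconvex (0 + k) (\<lambda>x. g x + - (k / 2 * (norm x)\<^sup>2))"
      by (intro semiconvex_add semiconvex_neg_half_norm_sq) (use g(1) semiconvex_0_iff in blast)
    moreover have "(\<lambda>x. g x + - (k / 2 * (norm x)\<^sup>2)) = H" by (auto simp: H_def)
    ultimately have "semiconvex k H" by simp
    then show ?thesis using k1 by (auto intro: semiconvex_mono)
  qed
  have H2: "semiconvex (2 * k) (\<lambda>x. - H x)"
  proof -
    have "semiconvex (2 * k + 0) (\<lambda>x. - g x + k / 2 * (norm x)\<^sup>2)"
      by (intro semiconvex_add semiconvex_half_norm_sq g(4)) (use k1 in simp)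
    moreover have "(\<lambda>x. - g x + k / 2 * (norm x)\<^sup>2) = (\<lambda>x. - H x)" by (auto simp: H_def)
    ultimately show ?thesis by simp
  qed
  have UH: "U x \<le> H x" for x using g(3)[OF cU Uf, of x] by (simp add: H_def)
  have HV: "V x \<le> - \<Gamma> x - H x" for x using g(2)[of x] by (simp add: H_def f_def)
  define \<eta>' where "\<eta>' = \<eta> / 4"
  have e': "0 < \<eta>'" "\<eta>' < \<eta> / 2" using \<eta> by (auto simp: \<eta>'_def)
  have r0: "0 < r0" using r1 by (simp add: r0_def)
  obtain x r l A where x: "x \<in> E" and r: "0 < r" "r < r0" and A: "transpose A = A" and
    q: "\<And>y. dist x y \<le> r \<Longrightarrow> \<bar>H y - (H x + l \<bullet> (y - x) + (y - x) \<bullet> (A *v (y - x)) / 2)\<bar> \<le> \<eta>' * r\<^sup>2"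
  proof (rule quadratic_approx[OF _ H1 H2 e'(1) Ebdd Enn r0])
    show "0 \<le> 2 * k" using k1 by simp
  qed blast
  obtain p where p: "contact x p" using x by (auto simp: E_def)
  \<comment> \<open>At a contact point \<open>- \<Gamma>\<close> equals \<open>w\<close>, which
    forces equality in both \<open>UH\<close> and \<open>HV\<close>.\<close>
  have Hx: "H x = U x" "V x = w x - U x"
    using UH[of x] HV[of x] Gc[OF p, of x] by (auto simp: w_def)
  have nA: "transpose (- A) = - A" using A by (simp add: transpose_def vec_eq_iff)
  have neg: "h \<bullet> (- A *v h) = - (h \<bullet> (A *v h))" for h
    using matrix_vector_mult_diff_rdistrib[of 0 A h] by simp
  obtain z1 l1 \<rho>1 where z1: "dist x z1 < r" "0 < \<rho>1"
    "\<And>y. dist z1 y < \<rho>1 \<Longrightarrow> U y \<le> U z1 + l1 \<bullet> (y - z1) + (y - z1) \<bullet> ((A + \<eta> *\<^sub>R mat 1) *v (y - z1)) / 2"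
  proof (rule slide_quadratic_test[of U A r \<eta>' \<eta> x l])
    fix y assume "dist x y \<le> r"
    from q[OF this] show "U y \<le> U x + l \<bullet> (y - x) + (y - x) \<bullet> (A *v (y - x)) / 2 + \<eta>' * r\<^sup>2"
      using UH[of y] Hx by (simp add: abs_le_iff)
  qed (use A r e' semiconvex_continuous[OF scU] in auto)
  \<comment> \<open>\<open>V\<close> lies below the contact plane minus \<open>H\<close>, whence the
    slope \<open>p - l\<close> and the matrix \<open>- A\<close>.\<close>
  obtain z2 l2 \<rho>2 where z2: "dist x z2 < r" "0 < \<rho>2"
    "\<And>y. dist z2 y < \<rho>2 \<Longrightarrow> V y \<le> V z2 + l2 \<bullet> (y - z2) + (y - z2) \<bullet> ((- A + \<eta> *\<^sub>R mat 1) *v (y - z2)) / 2"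
  proof (rule slide_quadratic_test[of V "- A" r \<eta>' \<eta> x "p - l"])
    fix y assume y: "dist x y \<le> r"
    have "- \<Gamma> y \<le> w x + p \<bullet> (y - x)" using Gc[OF p, of y] by simp
    moreover have "(p - l) \<bullet> (y - x) = p \<bullet> (y - x) - l \<bullet> (y - x)" by (rule inner_diff_left)
    ultimately show "V y \<le> V x + (p - l) \<bullet> (y - x) + (y - x) \<bullet> (- A *v (y - x)) / 2 + \<eta>' * r\<^sup>2"
      using HV[of y] q[OF y] Hx unfolding neg abs_le_iff by linarith
  qed (use nA r e' semiconvex_continuous[OF scV] in auto)
  have w12: "w0 / 2 \<le> w z1" "w0 / 2 \<le> w z2" using near[OF x] z1(1) z2(1) r(2) by auto
  \<comment> \<open>\<open>z1\<close> and \<open>z2\<close> may differ. \<open>inner_pts\<close>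
    takes maximisers for both \<open>U\<close> and \<open>V\<close> at each of them;
    \<open>y1\<close> and \<open>y2'\<close> are the ones returned.\<close>
  obtain y1 where y1: "y1 \<in> K" "U z1 = u y1 - k / 2 * (norm (z1 - y1))\<^sup>2" using U unfolding is_supconv_def by blast
  obtain y1' where y1': "y1' \<in> K" "V z1 = v y1' - k / 2 * (norm (z1 - y1'))\<^sup>2" using V unfolding is_supconv_def by blast
  obtain y2 where y2: "y2 \<in> K" "U z2 = u y2 - k / 2 * (norm (z2 - y2))\<^sup>2" using U unfolding is_supconv_def by blast
  obtain y2' where y2': "y2' \<in> K" "V z2 = v y2' - k / 2 * (norm (z2 - y2'))\<^sup>2" using V unfolding is_supconv_def by blast
  show thesis
  proof (rule that[OF A, of "min \<rho>1 \<rho>2" y1 y2' l1 l2])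
    show "0 < min \<rho>1 \<rho>2" using z1 z2 by simp
    show "y1 \<in> K - B" using inner_pts[OF y1 y1' w12(1)] y1 by simp
    show "y2' \<in> K - B" using inner_pts[OF y2 y2' w12(2)] y2' by simp
    show "u z \<le> u y1 + (l1 \<bullet> (z - y1) + (z - y1) \<bullet> ((A + \<eta> *\<^sub>R mat 1) *v (z - y1)) / 2)" if "z \<in> K" "dist y1 z < min \<rho>1 \<rho>2" for z
      by (rule supconv_test_transfer[OF U y1(2), of \<rho>1]) (use z1(3) that in \<open>auto simp: add.assoc\<close>)
    show "v z \<le> v y2' + (l2 \<bullet> (z - y2') + (z - y2') \<bullet> ((- A + \<eta> *\<^sub>R mat 1) *v (z - y2')) / 2)" if "z \<in> K" "dist y2' z < min \<rho>1 \<rho>2" for z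
      by (rule supconv_test_transfer[OF V y2'(2), of \<rho>2]) (use z2(3) that in \<open>auto simp: add.assoc\<close>)
  qed
qed

section \<open>Subequations, test functions and comparison\<close>

lemma norm_matrix_vector_le:
  fixes A :: "real^'n^'m"
  shows "norm (A *v x) \<le> norm A * norm x"
proof -
  have "norm ((A *v x) $ i) \<le> norm (norm x *\<^sub>R (\<chi> i. norm (A $ i)) $ i)" for i
    using Cauchy_Schwarz_ineq2[of "A $ i" x] by (simp add: matrix_vector_mul_component mult.commute)
  then have "norm (A *v x) \<le> norm (norm x *\<^sub>R (\<chi> i. norm (A $ i)))"
    by (intro norm_le_componentwise_cart) simp
  also have "\<dots> = norm (\<chi> i. norm (A $ i)) * norm x" by simp
  also have "norm (\<chi> i. norm (A $ i)) = norm A" by (simp add: norm_vec_def)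
  finally show ?thesis .
qed

lemma quad_form_norm_le:
  fixes A :: "real^'n^'n"
  shows "\<bar>x \<bullet> (A *v x)\<bar> \<le> norm A * (norm x)\<^sup>2"
proof -
  have "\<bar>x \<bullet> (A *v x)\<bar> \<le> norm x * norm (A *v x)" by (rule Cauchy_Schwarz_ineq2)
  also have "\<dots> \<le> norm x * (norm A * norm x)" by (intro mult_left_mono norm_matrix_vector_le) simp
  finally show ?thesis by (simp add: power2_eq_square algebra_simps)
qed

lemma quad_form_mat_1:
  fixes B :: "real^'n^'n"
  shows "h \<bullet> ((B + t *\<^sub>R mat 1) *v h) = h \<bullet> (B *v h) + t * (norm h)\<^sup>2"
  by (simp add: matrix_vector_mult_add_rdistrib scaleR_matrix_vector_assoc[symmetric] inner_simps power2_norm_eq_inner)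

lemma Sym_iff: "A \<in> Sym \<longleftrightarrow> transpose A = A" by (simp add: Sym_def)

lemma transpose_linear:
  "transpose (A + B) = transpose A + transpose (B :: real^'n^'m)" "transpose (A - B) = transpose A - transpose B"
  "transpose (- A) = - transpose A" "transpose (t *\<^sub>R A) = t *\<^sub>R transpose A"
  by (simp_all add: transpose_def vec_eq_iff)

lemma Sym_intros:
  "mat 1 \<in> Sym" "A \<in> Sym \<Longrightarrow> B \<in> Sym \<Longrightarrow> A + B \<in> Sym" "A \<in> Sym \<Longrightarrow> B \<in> Sym \<Longrightarrow> A - B \<in> Sym"
  "A \<in> Sym \<Longrightarrow> - A \<in> Sym" "A \<in> Sym \<Longrightarrow> t *\<^sub>R A \<in> Sym"
  by (simp_all add: Sym_iff transpose_linear)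

lemma closed_Sym: "closed (Sym :: (real^'n^'n) set)"
proof -
  have eq: "Sym = (\<Inter>i. \<Inter>j. {A :: real^'n^'n. A $ i $ j = A $ j $ i})"
    by (auto simp: Sym_def transpose_def vec_eq_iff)
  show ?thesis unfolding eq by (intro closed_INT ballI closed_Collect_eq continuous_intros)
qed

text \<open>The properties that \<open>F\<close> and its dual share in comparison and in envelope
  arguments; invariance under scaling is carried separately.\<close>

definition subeq :: "(real^'n^'n) set \<Rightarrow> bool" where
  "subeq G \<longleftrightarrow> G \<subseteq> Sym \<and> closed G \<and> (\<forall>A\<in>G. \<forall>P. psd P \<longrightarrow> A + P \<in> G)"

lemma cone_imp_subeq: "cone_subequation F \<Longrightarrow> subeq F"
  by (simp add: cone_subequation_def subeq_def)

lemma sym_interior_subset: "sym_interior F \<subseteq> F \<inter> Sym"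
  by (auto simp: sym_interior_def)

text \<open>If \<open>B\<close> is within \<delta> of \<open>A\<close>, then
  \<open>B - A + \<delta> *\<^sub>R mat 1\<close> is positive semidefinite, so positivity fills a
  whole ball around \<open>A\<close>.\<close>

lemma sym_interiorI_shift:
  fixes F :: "(real^'n^'n) set"
  assumes F: "subeq F" and d: "0 < \<delta>" and A: "A - \<delta> *\<^sub>R mat 1 \<in> F"
  shows "A \<in> sym_interior F"
proof -
  have "A - \<delta> *\<^sub>R mat 1 \<in> Sym" using A F by (auto simp: subeq_def)
  then have AS: "A \<in> Sym" using Sym_intros(2)[OF _ Sym_intros(5)[OF Sym_intros(1)], of _ \<delta>] by fastforce
  have "B \<in> F" if B: "B \<in> Sym" "dist B A < \<delta>" for B
  proof -
    have "psd (B - A + \<delta> *\<^sub>R mat 1)" unfolding psd_def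
    proof (intro conjI allI)
      show "transpose (B - A + \<delta> *\<^sub>R mat 1) = B - A + \<delta> *\<^sub>R mat 1"
        using Sym_intros B(1) AS by (metis Sym_iff)
      fix x :: "real^'n"
      have "norm (B - A) * (norm x)\<^sup>2 \<le> \<delta> * (norm x)\<^sup>2" using B(2) by (intro mult_right_mono) (auto simp: dist_norm)
      then show "0 \<le> x \<bullet> ((B - A + \<delta> *\<^sub>R mat 1) *v x)"
        using quad_form_norm_le[of x "B - A"] unfolding quad_form_mat_1 by linarith
    qed
    then have "A - \<delta> *\<^sub>R mat 1 + (B - A + \<delta> *\<^sub>R mat 1) \<in> F" using F A unfolding subeq_def by blast
    then show ?thesis by simp
  qed
  then show ?thesis using AS d by (auto simp: sym_interior_def)
qed

lemma sym_interior_add_psd: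
  assumes F: "subeq F" and A: "A \<in> sym_interior F" and P: "psd P"
  shows "A + P \<in> sym_interior F"
proof -
  obtain e where e: "0 < e" "\<And>B. B \<in> Sym \<Longrightarrow> dist B A < e \<Longrightarrow> B \<in> F" and AS: "A \<in> Sym"
    using A by (auto simp: sym_interior_def)
  have PS: "P \<in> Sym" using P by (simp add: psd_def Sym_iff)
  have "B \<in> F" if B: "B \<in> Sym" "dist B (A + P) < e" for B
  proof -
    have "B - P \<in> F" using B PS by (intro e(2) Sym_intros) (auto simp: dist_norm algebra_simps)
    then have "B - P + P \<in> F" using F P unfolding subeq_def by blast
    then show ?thesis by simp
  qed
  then show ?thesis using AS PS e(1) Sym_intros(2) by (auto simp: sym_interior_def)
qed

lemma sym_interior_open:
  assumes "A \<in> sym_interior F"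
  obtains e where "0 < e" "\<And>B. B \<in> Sym \<Longrightarrow> dist B A < e \<Longrightarrow> B \<in> sym_interior F"
proof -
  obtain e where e: "0 < e" "\<And>B. B \<in> Sym \<Longrightarrow> dist B A < e \<Longrightarrow> B \<in> F"
    using assms by (auto simp: sym_interior_def)
  have "B \<in> sym_interior F" if B: "B \<in> Sym" "dist B A < e / 2" for B
  proof -
    have "C \<in> F" if "C \<in> Sym" "dist C B < e / 2" for C
      using that B dist_triangle[of C A B] by (intro e(2)) auto
    then show ?thesis using B(1) e(1) unfolding sym_interior_def by (auto intro!: exI[of _ "e / 2"])
  qed
  then show thesis using that[of "e / 2"] e(1) by auto
qed

lemma subeq_dual:
  fixes F :: "(real^'n^'n) set"
  assumes F: "subeq F"
  shows "subeq (dual_subeq F)"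
  unfolding subeq_def
proof (intro conjI ballI allI impI)
  show "dual_subeq F \<subseteq> Sym" by (auto simp: dual_subeq_def)
  show "closed (dual_subeq F)"
    unfolding closure_subset_eq[symmetric]
  proof
    fix A assume "A \<in> closure (dual_subeq F)"
    then have ap: "\<forall>e>0. \<exists>B\<in>dual_subeq F. dist B A < e" by (simp add: closure_approachable)
    then have "\<forall>e>0. \<exists>B\<in>Sym. dist B A < e" by (fastforce simp: dual_subeq_def)
    then have AS: "A \<in> Sym" using closed_Sym by (metis closure_approachable closure_closed)
    have "- A \<notin> sym_interior F"
    proof
      assume "- A \<in> sym_interior F"
      then obtain e where e: "0 < e" "\<And>B. B \<in> Sym \<Longrightarrow> dist B (- A) < e \<Longrightarrow> B \<in> sym_interior F"
        using sym_interior_open by blast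
      obtain B where B: "B \<in> dual_subeq F" "dist B A < e" using ap e(1) by blast
      then have "- B \<in> sym_interior F" by (intro e(2)) (auto simp: dual_subeq_def Sym_intros dist_norm norm_minus_commute)
      then show False using B(1) by (auto simp: dual_subeq_def)
    qed
    then show "A \<in> dual_subeq F" using AS by (simp add: dual_subeq_def)
  qed
  fix A P :: "real^'n^'n" assume A: "A \<in> dual_subeq F" and P: "psd P"
  have PS: "P \<in> Sym" using P by (simp add: psd_def Sym_iff)
  have "- (A + P) \<notin> sym_interior F"
    using sym_interior_add_psd[OF F _ P, of "- (A + P)"] A by (auto simp: dual_subeq_def)
  then show "A + P \<in> dual_subeq F" using A PS by (auto simp: dual_subeq_def Sym_intros)
qed

section \<open>Calculus of twice differentiable test functions\<close>

lemma C2_hessian_at_nearby: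
  assumes "C2_hessian_at phi x A"
  obtains r g H where "0 < r" "H x = A" "continuous_on (ball x r) H"
    "\<And>y. y \<in> ball x r \<Longrightarrow> (phi has_derivative (\<lambda>h. g y \<bullet> h)) (at y)"
    "\<And>y. y \<in> ball x r \<Longrightarrow> (g has_derivative (\<lambda>h. H y *v h)) (at y)"
    "\<And>y. y \<in> ball x r \<Longrightarrow> C2_hessian_at phi y (H y)"
proof -
  obtain r g H where *: "0 < r" "\<And>y. y \<in> ball x r \<Longrightarrow> (phi has_derivative (\<lambda>h. g y \<bullet> h)) (at y)"
    "\<And>y. y \<in> ball x r \<Longrightarrow> (g has_derivative (\<lambda>h. H y *v h)) (at y)" "continuous_on (ball x r) H" "A = H x"
    using assms unfolding C2_hessian_at_def by blast
  have "C2_hessian_at phi y (H y)" if y: "y \<in> ball x r" for y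
  proof -
    have sub: "ball y (r - dist x y) \<subseteq> ball x r"
    proof
      fix z assume "z \<in> ball y (r - dist x y)"
      then show "z \<in> ball x r" using dist_triangle[of x z y] by simp
    qed
    show ?thesis unfolding C2_hessian_at_def
    proof (intro exI[of _ "r - dist x y"] exI[of _ g] exI[of _ H] conjI ballI)
      show "0 < r - dist x y" using y by simp
      show "continuous_on (ball y (r - dist x y)) H" using *(4) sub continuous_on_subset by blast
    qed (use * sub in auto)
  qed
  then show thesis using that * by blast
qed

lemma C2_hessian_at_add:
  assumes "C2_hessian_at phi x A" "C2_hessian_at psi x B"
  shows "C2_hessian_at (\<lambda>y. phi y + psi y) x (A + B)"
proof -
  obtain r g H where 1: "0 < r" "H x = A" "continuous_on (ball x r) H"
    "\<And>y. y \<in> ball x r \<Longrightarrow> (phi has_derivative (\<lambda>h. g y \<bullet> h)) (at y)"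
    "\<And>y. y \<in> ball x r \<Longrightarrow> (g has_derivative (\<lambda>h. H y *v h)) (at y)"
    using C2_hessian_at_nearby[OF assms(1)] by metis
  obtain r' g' H' where 2: "0 < r'" "H' x = B" "continuous_on (ball x r') H'"
    "\<And>y. y \<in> ball x r' \<Longrightarrow> (psi has_derivative (\<lambda>h. g' y \<bullet> h)) (at y)"
    "\<And>y. y \<in> ball x r' \<Longrightarrow> (g' has_derivative (\<lambda>h. H' y *v h)) (at y)"
    using C2_hessian_at_nearby[OF assms(2)] by metis
  show ?thesis unfolding C2_hessian_at_def
  proof (rule exI[of _ "min r r'"], intro conjI exI[of _ "\<lambda>y. g y + g' y"] exI[of _ "\<lambda>y. H y + H' y"] ballI)
    show "continuous_on (ball x (min r r')) (\<lambda>y. H y + H' y)"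
      using 1(3) 2(3) by (intro continuous_on_add) (auto elim!: continuous_on_subset)
    fix y assume y: "y \<in> ball x (min r r')"
    show "((\<lambda>y. phi y + psi y) has_derivative (\<lambda>h. (g y + g' y) \<bullet> h)) (at y)"
      unfolding inner_add_left using y by (intro has_derivative_add 1 2) auto
    show "((\<lambda>y. g y + g' y) has_derivative (\<lambda>h. (H y + H' y) *v h)) (at y)"
      unfolding matrix_vector_mult_add_rdistrib using y by (intro has_derivative_add 1 2) auto
  qed (use 1 2 in auto)
qed

lemma C2_hessian_at_scale:
  assumes "C2_hessian_at phi x A"
  shows "C2_hessian_at (\<lambda>y. t * phi y) x (t *\<^sub>R A)"
proof -
  obtain r g H where 1: "0 < r" "H x = A" "continuous_on (ball x r) H"
    "\<And>y. y \<in> ball x r \<Longrightarrow> (phi has_derivative (\<lambda>h. g y \<bullet> h)) (at y)"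
    "\<And>y. y \<in> ball x r \<Longrightarrow> (g has_derivative (\<lambda>h. H y *v h)) (at y)"
    using C2_hessian_at_nearby[OF assms(1)] by metis
  show ?thesis unfolding C2_hessian_at_def
  proof (rule exI[of _ r], intro conjI exI[of _ "\<lambda>y. t *\<^sub>R g y"] exI[of _ "\<lambda>y. t *\<^sub>R H y"] ballI)
    show "continuous_on (ball x r) (\<lambda>y. t *\<^sub>R H y)" by (intro continuous_intros 1)
    fix y assume y: "y \<in> ball x r"
    show "((\<lambda>y. t * phi y) has_derivative (\<lambda>h. (t *\<^sub>R g y) \<bullet> h)) (at y)"
      unfolding inner_scaleR_left by (intro has_derivative_mult_right 1 y)
    show "((\<lambda>y. t *\<^sub>R g y) has_derivative (\<lambda>h. (t *\<^sub>R H y) *v h)) (at y)"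
      unfolding scaleR_matrix_vector_assoc[symmetric] by (intro has_derivative_scaleR_right 1 y)
  qed (use 1 in auto)
qed

lemma C2_hessian_at_minus: "C2_hessian_at phi x A \<Longrightarrow> C2_hessian_at (\<lambda>y. - phi y) x (- A)"
  using C2_hessian_at_scale[of phi x A "-1"] by simp

lemma C2_hessian_at_quadratic:
  fixes B :: "real^'n^'n"
  assumes B: "transpose B = B"
  shows "C2_hessian_at (\<lambda>y. c + (l \<bullet> (y - y0) + (y - y0) \<bullet> (B *v (y - y0)) / 2)) x B"
  unfolding C2_hessian_at_def
proof (rule exI[of _ 1], intro conjI exI[of _ "\<lambda>y. l + B *v (y - y0)"] exI[of _ "\<lambda>y. B"] ballI)
  fix y
  have lin: "((\<lambda>y. B *v (y - y0)) has_derivative (\<lambda>h. B *v h)) (at y)"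
    by (rule bounded_linear.has_derivative[OF matrix_vector_mul_bounded_linear]) (auto intro!: derivative_eq_intros)
  show "((\<lambda>y. c + (l \<bullet> (y - y0) + (y - y0) \<bullet> (B *v (y - y0)) / 2)) has_derivative (\<lambda>h. (l + B *v (y - y0)) \<bullet> h)) (at y)"
  proof -
    have id: "((\<lambda>y. y - y0) has_derivative (\<lambda>h. h)) (at y)" by (auto intro!: derivative_eq_intros)
    have "((\<lambda>y. c + (l \<bullet> (y - y0) + (1 / 2) * ((y - y0) \<bullet> (B *v (y - y0))))) has_derivative
      (\<lambda>h. 0 + (l \<bullet> h + (1 / 2) * ((y - y0) \<bullet> (B *v h) + h \<bullet> (B *v (y - y0)))))) (at y)"
      by (intro has_derivative_add has_derivative_const has_derivative_inner_right has_derivative_mult_right has_derivative_inner id lin)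
    moreover have "0 + (l \<bullet> h + (1 / 2) * ((y - y0) \<bullet> (B *v h) + h \<bullet> (B *v (y - y0)))) = (l + B *v (y - y0)) \<bullet> h" for h
      unfolding sym_dot[OF B, of "y - y0" h] by (simp add: inner_add_left) (simp add: inner_commute)
    ultimately show ?thesis by simp
  qed
  show "((\<lambda>y. l + B *v (y - y0)) has_derivative (\<lambda>h. B *v h)) (at y)"
    using has_derivative_add[OF has_derivative_const lin] by simp
qed auto

lemma C2_hessian_at_const: "C2_hessian_at (\<lambda>y. c) x 0"
  using C2_hessian_at_quadratic[of 0 c 0 0 x] by (simp add: transpose_def vec_eq_iff)

lemma gradient_line_derivative:
  assumes "(phi has_derivative (\<lambda>h. g \<bullet> h)) (at (p + t *\<^sub>R a))"
  shows "((\<lambda>t. phi (p + t *\<^sub>R a)) has_real_derivative (g \<bullet> a)) (at t)"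
proof -
  have "((\<lambda>t. p + t *\<^sub>R a) has_derivative (\<lambda>h. h *\<^sub>R a)) (at t)" by (auto intro!: derivative_eq_intros)
  from has_derivative_compose[OF this assms] show ?thesis
    by (simp add: has_field_derivative_def mult_commute_abs)
qed

text \<open>One factor \<open>s\<close> comes from the mean value theorem along \<open>a\<close>,
  which leaves a difference of gradients; the other comes from differentiability of the gradient at
  \<open>x\<close>.\<close>

lemma C2_hessian_mixed_difference:
  assumes C: "C2_hessian_at phi x A" and e: "0 < e"
  obtains d where "0 < d" "\<And>s. 0 < s \<Longrightarrow> s < d \<Longrightarrow>
     \<bar>phi (x + s *\<^sub>R a + s *\<^sub>R b) - phi (x + s *\<^sub>R a) - phi (x + s *\<^sub>R b) + phi x - s\<^sup>2 * ((A *v b) \<bullet> a)\<bar> \<le> e * s\<^sup>2"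
proof -
  obtain r g H where 1: "0 < r" "H x = A"
    "\<And>y. y \<in> ball x r \<Longrightarrow> (phi has_derivative (\<lambda>h. g y \<bullet> h)) (at y)"
    "\<And>y. y \<in> ball x r \<Longrightarrow> (g has_derivative (\<lambda>h. H y *v h)) (at y)"
    using C2_hessian_at_nearby[OF C] by metis
  define N where "N = norm a + norm b + 1"
  have N: "0 < N" by (simp add: N_def add_nonneg_pos)
  define e' where "e' = e / (2 * N * N)"
  have e': "0 < e'" using e N by (simp add: e'_def)
  have "(g has_derivative (\<lambda>h. A *v h)) (at x)" using 1(4)[of x] 1(1,2) by simp
  then obtain d where d: "0 < d" "\<And>y. norm (y - x) < d \<Longrightarrow> norm (g y - g x - A *v (y - x)) \<le> e' * norm (y - x)"
    unfolding has_derivative_at_alt using e' by blast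
  show thesis
  proof (rule that[of "min d r / N"])
    show "0 < min d r / N" using d 1 N by simp
    fix s :: real assume s: "0 < s" "s < min d r / N"
    then have sN: "s * N < d" "s * N < r" using N by (auto simp: field_simps)
    have near: "norm (t *\<^sub>R a + b') \<le> s * N" if "0 \<le> t" "t \<le> s" "b' = 0 \<or> b' = s *\<^sub>R b" for t b'
    proof -
      have "norm (t *\<^sub>R a + b') \<le> t * norm a + norm b'" using norm_triangle_ineq[of "t *\<^sub>R a" b'] that by simp
      also have "t * norm a \<le> s * norm a" using that by (intro mult_right_mono) auto
      also have "norm b' \<le> s * norm b" using that s by auto
      finally show ?thesis using s by (simp add: N_def algebra_simps)
    qed
    define \<psi> where "\<psi> t = phi (x + s *\<^sub>R b + t *\<^sub>R a) - phi (x + t *\<^sub>R a)" for t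
    have der: "(\<psi> has_real_derivative (g (x + s *\<^sub>R b + t *\<^sub>R a) \<bullet> a - g (x + t *\<^sub>R a) \<bullet> a)) (at t)" if "0 \<le> t" "t \<le> s" for t
      unfolding \<psi>_def
    proof (intro DERIV_diff gradient_line_derivative 1(3))
      have "dist x (x + s *\<^sub>R b + t *\<^sub>R a) = norm (t *\<^sub>R a + s *\<^sub>R b)"
      proof -
        have "x - (x + s *\<^sub>R b + t *\<^sub>R a) = - (t *\<^sub>R a + s *\<^sub>R b)" by simp
        then show ?thesis unfolding dist_norm by (simp only: norm_minus_cancel)
      qed
      then show "x + s *\<^sub>R b + t *\<^sub>R a \<in> ball x r" using near[OF that, of "s *\<^sub>R b"] sN by simp
      show "x + t *\<^sub>R a \<in> ball x r" using near[OF that, of 0] sN by (simp add: dist_norm)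
    qed
    obtain t where t: "0 < t" "t < s" "\<psi> s - \<psi> 0 = (s - 0) * (g (x + s *\<^sub>R b + t *\<^sub>R a) \<bullet> a - g (x + t *\<^sub>R a) \<bullet> a)"
      using MVT2[OF s(1) der] by blast
    define E1 where "E1 = g (x + s *\<^sub>R b + t *\<^sub>R a) - g x - A *v (t *\<^sub>R a + s *\<^sub>R b)"
    define E2 where "E2 = g (x + t *\<^sub>R a) - g x - A *v (t *\<^sub>R a)"
    have n1: "norm (t *\<^sub>R a + s *\<^sub>R b) \<le> s * N" and n2: "norm (t *\<^sub>R a) \<le> s * N"
      using near[of t "s *\<^sub>R b"] near[of t 0] t by auto
    have "norm E1 \<le> e' * norm (t *\<^sub>R a + s *\<^sub>R b)"
      using d(2)[of "x + s *\<^sub>R b + t *\<^sub>R a"] n1 sN by (simp add: E1_def algebra_simps)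
    then have E1: "norm E1 \<le> e' * (s * N)" using n1 e' by (meson less_imp_le mult_left_mono order_trans)
    have "norm E2 \<le> e' * norm (t *\<^sub>R a)"
      using d(2)[of "x + t *\<^sub>R a"] n2 sN by (simp add: E2_def)
    then have E2: "norm E2 \<le> e' * (s * N)" using n2 e' by (meson less_imp_le mult_left_mono order_trans)
    have "g (x + s *\<^sub>R b + t *\<^sub>R a) - g (x + t *\<^sub>R a) = s *\<^sub>R (A *v b) + (E1 - E2)"
      by (simp add: E1_def E2_def matrix_vector_right_distrib matrix_vector_mult_scaleR)
    then have "\<psi> s - \<psi> 0 = s * ((s *\<^sub>R (A *v b) + (E1 - E2)) \<bullet> a)" using t(3) by (simp add: inner_diff_left[symmetric])
    then have eq: "\<psi> s - \<psi> 0 - s\<^sup>2 * ((A *v b) \<bullet> a) = s * ((E1 - E2) \<bullet> a)" by (simp add: inner_add_left algebra_simps power2_eq_square)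
    have na: "norm a \<le> N" and nn: "0 \<le> 2 * e' * (s * N)" using e' s N by (simp add: N_def, simp)
    have "\<bar>(E1 - E2) \<bullet> a\<bar> \<le> norm (E1 - E2) * norm a" by (rule Cauchy_Schwarz_ineq2)
    also have "\<dots> \<le> (2 * e' * (s * N)) * N"
      using norm_triangle_ineq4[of E1 E2] E1 E2 by (intro mult_mono na nn) auto
    also have "\<dots> = e * s" using N by (simp add: e'_def)
    finally have "s * \<bar>(E1 - E2) \<bullet> a\<bar> \<le> s * (e * s)" using s(1) by (intro mult_left_mono) auto
    then have "\<bar>\<psi> s - \<psi> 0 - s\<^sup>2 * ((A *v b) \<bullet> a)\<bar> \<le> e * s\<^sup>2" unfolding eq abs_mult using s(1) by (simp add: power2_eq_square algebra_simps)
    moreover have "\<psi> s - \<psi> 0 = phi (x + s *\<^sub>R a + s *\<^sub>R b) - phi (x + s *\<^sub>R a) - phi (x + s *\<^sub>R b) + phi x"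
      by (simp add: \<psi>_def algebra_simps)
    ultimately show "\<bar>phi (x + s *\<^sub>R a + s *\<^sub>R b) - phi (x + s *\<^sub>R a) - phi (x + s *\<^sub>R b) + phi x - s\<^sup>2 * ((A *v b) \<bullet> a)\<bar> \<le> e * s\<^sup>2"
      by simp
  qed
qed

text \<open>\<open>C2_hessian_at\<close> does not demand a symmetric matrix, while
  \<open>Sym\<close> and \<open>psd\<close> do. The mixed difference is symmetric in its directions,
  so both bilinear values are limits of the same quotient.\<close>

lemma C2_hessian_symmetric:
  fixes A :: "real^'n^'n"
  assumes C: "C2_hessian_at phi x A"
  shows "transpose A = A"
proof -
  have "(A *v b) \<bullet> a = (A *v a) \<bullet> b" for a b
  proof (rule ccontr)
    assume ne: "(A *v b) \<bullet> a \<noteq> (A *v a) \<bullet> b"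
    define e where "e = \<bar>(A *v b) \<bullet> a - (A *v a) \<bullet> b\<bar> / 3"
    have e: "0 < e" using ne by (simp add: e_def)
    obtain d1 where d1: "0 < d1" "\<And>s. 0 < s \<Longrightarrow> s < d1 \<Longrightarrow>
     \<bar>phi (x + s *\<^sub>R a + s *\<^sub>R b) - phi (x + s *\<^sub>R a) - phi (x + s *\<^sub>R b) + phi x - s\<^sup>2 * ((A *v b) \<bullet> a)\<bar> \<le> e * s\<^sup>2"
      using C2_hessian_mixed_difference[OF C e] by metis
    obtain d2 where d2: "0 < d2" "\<And>s. 0 < s \<Longrightarrow> s < d2 \<Longrightarrow>
     \<bar>phi (x + s *\<^sub>R b + s *\<^sub>R a) - phi (x + s *\<^sub>R b) - phi (x + s *\<^sub>R a) + phi x - s\<^sup>2 * ((A *v a) \<bullet> b)\<bar> \<le> e * s\<^sup>2"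
      using C2_hessian_mixed_difference[OF C e] by metis
    define s where "s = min d1 d2 / 2"
    have s: "0 < s" "s < d1" "s < d2" using d1(1) d2(1) by (auto simp: s_def)
    have c: "x + s *\<^sub>R b + s *\<^sub>R a = x + s *\<^sub>R a + s *\<^sub>R b" by simp
    have "\<bar>s\<^sup>2 * ((A *v b) \<bullet> a) - s\<^sup>2 * ((A *v a) \<bullet> b)\<bar> \<le> 2 * (e * s\<^sup>2)"
      using d1(2)[OF s(1,2)] d2(2)[OF s(1,3)] unfolding c by linarith
    moreover have "\<bar>s\<^sup>2 * ((A *v b) \<bullet> a) - s\<^sup>2 * ((A *v a) \<bullet> b)\<bar> = s\<^sup>2 * \<bar>(A *v b) \<bullet> a - (A *v a) \<bullet> b\<bar>"
      by (metis abs_mult abs_power2 right_diff_distrib)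
    moreover have "\<bar>(A *v b) \<bullet> a - (A *v a) \<bullet> b\<bar> = 3 * e" by (simp add: e_def)
    ultimately have "s\<^sup>2 * (3 * e) \<le> 2 * (e * s\<^sup>2)" by simp
    moreover have "0 < e * s\<^sup>2" "s\<^sup>2 * (3 * e) = 3 * (e * s\<^sup>2)" using e s(1) by simp_all
    ultimately show False by linarith
  qed
  from this[of "axis _ 1" "axis _ 1"] have "A $ i $ j = A $ j $ i" for i j
    by (simp add: matrix_vector_mult_basis column_def inner_axis)
  then show ?thesis by (simp add: transpose_def vec_eq_iff)
qed

text \<open>Were the form negative on \<open>h\<close>, the derivative along \<open>h\<close>, zero
  at the minimum, would be negative shortly after it, against the mean value theorem.\<close>

lemma C2_hessian_local_min:
  assumes C: "C2_hessian_at phi x A" and r: "0 < \<rho>" and m: "\<And>y. y \<in> ball x \<rho> \<Longrightarrow> phi x \<le> phi y"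
  shows "0 \<le> h \<bullet> (A *v h)"
proof (rule ccontr)
  assume neg: "\<not> 0 \<le> h \<bullet> (A *v h)"
  then have h0: "h \<noteq> 0" by auto
  obtain r g H where 1: "0 < r" "H x = A"
    "\<And>y. y \<in> ball x r \<Longrightarrow> (phi has_derivative (\<lambda>h. g y \<bullet> h)) (at y)"
    "\<And>y. y \<in> ball x r \<Longrightarrow> (g has_derivative (\<lambda>h. H y *v h)) (at y)"
    using C2_hessian_at_nearby[OF C] by metis
  define e where "e = - (h \<bullet> (A *v h)) / (2 * (norm h)\<^sup>2)"
  have e: "0 < e" using neg h0 by (simp add: e_def divide_neg_pos)
  have eh: "e * (norm h)\<^sup>2 = - (h \<bullet> (A *v h)) / 2" using h0 by (simp add: e_def)
  have "(g has_derivative (\<lambda>h. A *v h)) (at x)" using 1(4)[of x] 1(1,2) by simp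
  then obtain d where d: "0 < d" "\<And>y. norm (y - x) < d \<Longrightarrow> norm (g y - g x - A *v (y - x)) \<le> e * norm (y - x)"
    unfolding has_derivative_at_alt using e by blast
  define t where "t = min (min d r) \<rho> / (2 * norm h)"
  have t0: "0 < t" using h0 d 1 r by (simp add: t_def)
  have tn: "s * norm h < d" "s * norm h < r" "s * norm h < \<rho>" if "s \<le> t" for s
  proof -
    have "s * norm h \<le> t * norm h" using that by (intro mult_right_mono) auto
    also have "\<dots> = min (min d r) \<rho> / 2" using h0 by (simp add: t_def)
    finally show "s * norm h < d" "s * norm h < r" "s * norm h < \<rho>" using d 1 r by auto
  qed
  have der: "((\<lambda>t. phi (x + t *\<^sub>R h)) has_real_derivative (g (x + s *\<^sub>R h) \<bullet> h)) (at s)" if "\<bar>s\<bar> \<le> t" for s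
    by (intro gradient_line_derivative 1(3)) (use tn(2)[OF that] in \<open>simp add: dist_norm\<close>)
  have "g (x + 0 *\<^sub>R h) \<bullet> h = 0"
  proof (rule DERIV_local_min[OF der t0])
    show "\<forall>y. \<bar>0 - y\<bar> < t \<longrightarrow> phi (x + 0 *\<^sub>R h) \<le> phi (x + y *\<^sub>R h)"
    proof (intro allI impI)
      fix y assume "\<bar>0 - y\<bar> < t"
      then show "phi (x + 0 *\<^sub>R h) \<le> phi (x + y *\<^sub>R h)" using m[of "x + y *\<^sub>R h"] tn(3)[of "\<bar>y\<bar>"] by (simp add: dist_norm)
    qed
  qed (use t0 in simp)
  then have g0: "g x \<bullet> h = 0" by simp
  have d0: "\<And>s. 0 \<le> s \<Longrightarrow> s \<le> t \<Longrightarrow> ((\<lambda>t. phi (x + t *\<^sub>R h)) has_real_derivative (g (x + s *\<^sub>R h) \<bullet> h)) (at s)" by (rule der) simp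
  obtain s where s: "0 < s" "s < t" "phi (x + t *\<^sub>R h) - phi (x + 0 *\<^sub>R h) = (t - 0) * (g (x + s *\<^sub>R h) \<bullet> h)"
    using MVT2[OF t0 d0] by blast
  have "phi x \<le> phi (x + t *\<^sub>R h)" using tn(3)[of t] t0 by (intro m) (simp add: dist_norm)
  then have "0 \<le> t * (g (x + s *\<^sub>R h) \<bullet> h)" using s(3) by simp
  then have "0 \<le> g (x + s *\<^sub>R h) \<bullet> h" using t0 by (metis mult_pos_neg not_le)
  moreover have "\<bar>(g (x + s *\<^sub>R h) - g x - A *v (s *\<^sub>R h)) \<bullet> h\<bar> \<le> e * (s * norm h) * norm h"
  proof -
    have "norm (g (x + s *\<^sub>R h) - g x - A *v (s *\<^sub>R h)) \<le> e * (s * norm h)" using d(2)[of "x + s *\<^sub>R h"] tn(1)[of s] s by simp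
    then show ?thesis by (intro order_trans[OF Cauchy_Schwarz_ineq2] mult_right_mono) auto
  qed
  moreover have "(g (x + s *\<^sub>R h) - g x - A *v (s *\<^sub>R h)) \<bullet> h = g (x + s *\<^sub>R h) \<bullet> h - g x \<bullet> h - s * (h \<bullet> (A *v h))"
    by (simp only: inner_diff_left matrix_vector_mult_scaleR inner_scaleR_left inner_commute[of "A *v h" h])
  ultimately have "0 \<le> s * (h \<bullet> (A *v h)) + e * (s * norm h) * norm h"
    using g0 unfolding abs_le_iff by linarith
  also have "\<dots> = s * (h \<bullet> (A *v h) + e * (norm h)\<^sup>2)" by (simp add: power2_eq_square algebra_simps)
  finally have "0 \<le> h \<bullet> (A *v h) + e * (norm h)\<^sup>2" using s(1) by (simp add: zero_le_mult_iff)
  then show False using neg eh by simp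
qed

text \<open>The test condition at one point for real-valued functions. On an open set a ball inside
  the domain replaces the relative neighbourhood (\<open>F_subharmonic_iff\<close>), so the domain
  need not be mentioned.\<close>

definition sub_at :: "(real^'n^'n) set \<Rightarrow> (real^'n \<Rightarrow> real) \<Rightarrow> real^'n \<Rightarrow> bool" where
  "sub_at G u x0 \<longleftrightarrow> (\<forall>phi A. C2_hessian_at phi x0 A \<and> (\<exists>r>0. \<forall>y\<in>ball x0 r. u y \<le> phi y) \<and> u x0 = phi x0 \<longrightarrow> A \<in> G)"

lemma F_subharmonic_iff:
  fixes u :: "real^'n \<Rightarrow> real"
  assumes X: "open X"
  shows "F_subharmonic G X (\<lambda>x. ereal (u x)) \<longleftrightarrow> usc X u \<and> (\<forall>x\<in>X. sub_at G u x)"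
proof -
  have 1: "usc_on X (\<lambda>x. ereal (u x)) \<longleftrightarrow> usc X u"
  proof
    assume l: "usc_on X (\<lambda>x. ereal (u x))"
    show "usc X u" unfolding usc_def
    proof (intro ballI allI impI)
      fix x c assume "x \<in> X" "u x < c"
      then have "\<forall>\<^sub>F y in at x within X. ereal (u y) < ereal c"
        using l[unfolded usc_on_def, rule_format, of x "ereal c"] by simp
      then show "\<forall>\<^sub>F y in at x within X. u y < c" by simp
    qed
  next
    assume r: "usc X u"
    show "usc_on X (\<lambda>x. ereal (u x))" unfolding usc_on_def
    proof (intro ballI allI impI)
      fix x and c :: ereal assume "x \<in> X" "ereal (u x) < c"
      then show "\<forall>\<^sub>F y in at x within X. ereal (u y) < c" using r by (cases c) (auto simp: usc_def)
    qed
  qed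
  have 2: "(\<exists>r>0. \<forall>y\<in>ball x0 r \<inter> X. ereal (u y) \<le> ereal (phi y)) \<longleftrightarrow> (\<exists>r>0. \<forall>y\<in>ball x0 r. u y \<le> phi y)" if x0: "x0 \<in> X" for x0 phi
  proof
    assume "\<exists>r>0. \<forall>y\<in>ball x0 r \<inter> X. ereal (u y) \<le> ereal (phi y)"
    then obtain r where r: "0 < r" "\<forall>y\<in>ball x0 r \<inter> X. u y \<le> phi y" by auto
    obtain s where s: "0 < s" "ball x0 s \<subseteq> X" using X x0 open_contains_ball by blast
    show "\<exists>r>0. \<forall>y\<in>ball x0 r. u y \<le> phi y"
      by (rule exI[of _ "min r s"]) (use r s in auto)
  qed auto
  show ?thesis unfolding F_subharmonic_def 1 sub_at_def using 2 by auto
qed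

lemma sub_at_quadratic:
  fixes B :: "real^'n^'n"
  assumes s: "sub_at G u y" and B: "transpose B = B" and r: "0 < \<rho>"
    and le: "\<And>z. dist y z < \<rho> \<Longrightarrow> u z \<le> u y + (l \<bullet> (z - y) + (z - y) \<bullet> (B *v (z - y)) / 2)"
  shows "B \<in> G"
proof -
  let ?phi = "\<lambda>z. u y + (l \<bullet> (z - y) + (z - y) \<bullet> (B *v (z - y)) / 2)"
  have "\<exists>r>0. \<forall>z\<in>ball y r. u z \<le> ?phi z" using r le by auto
  moreover have "u y = ?phi y" by simp
  ultimately show ?thesis using s C2_hessian_at_quadratic[OF B, of "u y" l y y] unfolding sub_at_def by blast
qed

text \<open>Whatever touches \<open>w\<close> from above at \<open>x\<close> also touches every
  smaller function that agrees with \<open>w\<close> at \<open>x\<close>.\<close>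

lemma sub_at_lower:
  assumes s: "sub_at G u x" and r: "0 < \<rho>" and le: "\<And>y. y \<in> ball x \<rho> \<Longrightarrow> u y \<le> w y" and eq: "u x = w x"
  shows "sub_at G w x"
  unfolding sub_at_def
proof (intro allI impI, elim conjE exE)
  fix phi A r assume "C2_hessian_at phi x A" "w x = phi x" "0 < r" "\<forall>y\<in>ball x r. w y \<le> phi y"
  moreover have "u y \<le> phi y" if "y \<in> ball x (min r \<rho>)" for y
    using order_trans[OF le[of y], of "phi y"] calculation(4) that by auto
  then have "\<exists>r>0. \<forall>y\<in>ball x r. u y \<le> phi y"
    using calculation(3) r by (intro exI[of _ "min r \<rho>"]) auto
  ultimately show "A \<in> G" using s eq unfolding sub_at_def by auto
qed

lemma sub_at_add_const:
  assumes "sub_at G u x"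
  shows "sub_at G (\<lambda>y. u y + c) x"
  unfolding sub_at_def
proof (intro allI impI, elim conjE exE)
  fix phi A r assume *: "C2_hessian_at phi x A" "u x + c = phi x" "0 < r" "\<forall>y\<in>ball x r. u y + c \<le> phi y"
  have "C2_hessian_at (\<lambda>y. phi y + - c) x (A + 0)" by (intro C2_hessian_at_add * C2_hessian_at_const)
  moreover have "\<exists>r>0. \<forall>y\<in>ball x r. u y \<le> phi y + - c"
    by (rule exI[of _ r]) (use * in \<open>auto simp: algebra_simps\<close>)
  moreover have "u x = phi x + - c" using * by simp
  ultimately have "A + 0 \<in> G" using assms unfolding sub_at_def by blast
  then show "A \<in> G" by simp
qed

lemma sub_at_scale:
  assumes F: "cone_subequation F" and u: "sub_at F u x" and t: "0 < t"
  shows "sub_at F (\<lambda>y. t * u y) x"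
  unfolding sub_at_def
proof (intro allI impI, elim conjE exE)
  fix phi A r assume *: "C2_hessian_at phi x A" "t * u x = phi x" "0 < r" "\<forall>y\<in>ball x r. t * u y \<le> phi y"
  have "C2_hessian_at (\<lambda>y. (1 / t) * phi y) x ((1 / t) *\<^sub>R A)" by (rule C2_hessian_at_scale[OF *(1)])
  moreover have le: "u y \<le> (1 / t) * phi y" if "y \<in> ball x r" for y
  proof -
    have "t * u y \<le> phi y" using *(4) that by blast
    then show ?thesis using t by (simp add: pos_le_divide_eq mult.commute)
  qed
  then have "\<exists>r>0. \<forall>y\<in>ball x r. u y \<le> (1 / t) * phi y" using *(3) by blast
  moreover have "u x = (1 / t) * phi x" unfolding *(2)[symmetric] using t by simp
  ultimately have "(1 / t) *\<^sub>R A \<in> F" using u unfolding sub_at_def by blast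
  then have "t *\<^sub>R ((1 / t) *\<^sub>R A) \<in> F" using F t unfolding cone_subequation_def by blast
  then show "A \<in> F" using t by simp
qed

text \<open>A function touching \<open>f\<close> from above has a Hessian exceeding that of
  \<open>f\<close> by a positive semidefinite matrix.\<close>

lemma sub_at_smooth:
  assumes G: "subeq G" and f: "C2_hessian_at f x B" and B: "B \<in> G"
  shows "sub_at G f x"
  unfolding sub_at_def
proof (intro allI impI, elim conjE exE)
  fix phi A r assume *: "C2_hessian_at phi x A" "f x = phi x" "0 < r" "\<forall>y\<in>ball x r. f y \<le> phi y"
  have C: "C2_hessian_at (\<lambda>y. phi y + - f y) x (A + - B)" by (intro C2_hessian_at_add C2_hessian_at_minus * f)
  have "psd (A - B)" unfolding psd_def
  proof (intro conjI allI)
    show "transpose (A - B) = A - B" using C2_hessian_symmetric[OF C] by simp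
    show "0 \<le> h \<bullet> ((A - B) *v h)" for h
      using C2_hessian_local_min[OF C *(3), of h] * by auto
  qed
  then have "B + (A - B) \<in> G" using G B unfolding subeq_def by blast
  then show "A \<in> G" by simp
qed

text \<open>A small multiple of the squared norm added to \<open>u\<close> makes room for the two
  errors of \<open>viscosity_sum_lemma\<close>. One matrix then lies in the interior of
  \<open>F\<close> while its negative lies in the dual, which is contradictory by definition of the
  dual.\<close>

theorem comparison:
  fixes u v :: "real^'n \<Rightarrow> real"
  assumes F: "subeq F" and U: "open U" "bounded U" and u: "usc (closure U) u" "\<And>x. x \<in> U \<Longrightarrow> sub_at F u x"
    and v: "usc (closure U) v" "\<And>x. x \<in> U \<Longrightarrow> sub_at (dual_subeq F) v x"
    and bd: "\<And>x. x \<in> frontier U \<Longrightarrow> u x + v x \<le> 0" and x: "x \<in> U"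
  shows "u x + v x \<le> 0"
proof (rule ccontr)
  assume "\<not> u x + v x \<le> 0"
  then have pos: "0 < u x + v x" by simp
  obtain R where R: "0 < R" "\<And>y. y \<in> closure U \<Longrightarrow> norm y \<le> R"
    using bounded_closure[OF U(2)] unfolding bounded_pos by blast
  \<comment> \<open>The perturbation is nonpositive on the closure and consumes at most half of the
    positive value at \<open>x\<close>.\<close>
  define \<delta> where "\<delta> = (u x + v x) / R\<^sup>2"
  have d: "0 < \<delta>" "\<delta> * R\<^sup>2 = u x + v x" using pos R by (auto simp: \<delta>_def)
  define u' where "u' y = u y + \<delta> / 2 * ((norm y)\<^sup>2 - R\<^sup>2)" for y
  have u'usc: "usc (closure U) u'" unfolding u'_def
    by (intro usc_add u continuous_imp_usc continuous_intros)
  have u'le: "u' y \<le> u y" if "y \<in> closure U" for y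
  proof -
    have "(norm y)\<^sup>2 \<le> R\<^sup>2" using R(2)[OF that] by (intro power_mono) auto
    then show ?thesis using d(1) by (simp add: u'_def mult_le_0_iff)
  qed
  have fr: "compact (frontier U)" "frontier U \<subseteq> closure U"
    using U(2) by (simp add: compact_frontier_bounded) (auto simp: frontier_def)
  have pos': "0 < u' x + v x"
  proof -
    have "u' x + v x = (u x + v x) / 2 + \<delta> / 2 * (norm x)\<^sup>2" using d(2) by (simp add: u'_def algebra_simps)
    then show ?thesis using pos d(1) by (simp add: add_pos_nonneg)
  qed
  have K: "compact (closure U)" using U(2) by (simp add: compact_closure)
  have xcl: "x \<in> closure U" using x closure_subset by blast
  have bd': "u' y + v y \<le> 0" if "y \<in> frontier U" for y using bd[OF that] u'le[of y] that fr(2) by force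
  have inU: "closure U - frontier U = U" using U(1) by (auto simp: frontier_def interior_open closure_subset[THEN subsetD])
  \<comment> \<open>With error \<delta> / 4, removing the perturbation from the test for
    \<open>u\<close> leaves A - 3 \<delta> / 4. This is \<delta> / 2 below A - \<delta> / 4, the
    negative of the matrix tested by \<open>v\<close>.\<close>
  have d4: "0 < \<delta> / 4" using d by simp
  obtain A y l y' l' \<rho> where A: "transpose A = A" and \<rho>: "0 < \<rho>" and y0: "y \<in> closure U - frontier U" "y' \<in> closure U - frontier U" and
    t1: "\<And>z. z \<in> closure U \<Longrightarrow> dist y z < \<rho> \<Longrightarrow> u' z \<le> u' y + (l \<bullet> (z - y) + (z - y) \<bullet> ((A + (\<delta> / 4) *\<^sub>R mat 1) *v (z - y)) / 2)" and
    t2: "\<And>z. z \<in> closure U \<Longrightarrow> dist y' z < \<rho> \<Longrightarrow> v z \<le> v y' + (l' \<bullet> (z - y') + (z - y') \<bullet> ((- A + (\<delta> / 4) *\<^sub>R mat 1) *v (z - y')) / 2)"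
    by (rule viscosity_sum_lemma[OF K u'usc v(1) fr bd' xcl pos' d4]) (assumption, rule that, assumption+)
  have y: "y \<in> U" "y' \<in> U" using y0 unfolding inU by auto
  have A': "A \<in> Sym" using A by (simp add: Sym_iff)
  have AS: "A + t *\<^sub>R mat 1 \<in> Sym" "- A + t *\<^sub>R mat 1 \<in> Sym" for t by (intro Sym_intros A')+
  obtain \<rho>1 where \<rho>1: "0 < \<rho>1" "ball y \<rho>1 \<subseteq> U" using U(1) y(1) open_contains_ball by blast
  obtain \<rho>2 where \<rho>2: "0 < \<rho>2" "ball y' \<rho>2 \<subseteq> U" using U(1) y(2) open_contains_ball by blast
  have "A + (- 3 / 4 * \<delta>) *\<^sub>R mat 1 \<in> F"
  proof (rule sub_at_quadratic[OF u(2)[OF y(1)], of _ "min \<rho> \<rho>1" "l - \<delta> *\<^sub>R y"])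
    fix z :: "real^'n" assume z: "dist y z < min \<rho> \<rho>1"
    have zU: "z \<in> closure U" using z \<rho>1(2) closure_subset[of U] by auto
    have "(norm z)\<^sup>2 = (norm y)\<^sup>2 + 2 * (y \<bullet> (z - y)) + (norm (z - y))\<^sup>2"
      by (simp add: power2_norm_eq_inner inner_simps inner_commute)
    moreover have "a = b + 2 * c + d \<Longrightarrow> \<delta> / 2 * a = \<delta> / 2 * b + \<delta> * c + \<delta> / 2 * d" for a b c d
      by (simp add: algebra_simps)
    ultimately have "\<delta> / 2 * (norm z)\<^sup>2 = \<delta> / 2 * (norm y)\<^sup>2 + \<delta> * (y \<bullet> (z - y)) + \<delta> / 2 * (norm (z - y))\<^sup>2"
      by blast
    moreover have "a + (d / 2 * Z - d / 2 * R2) \<le> b + (d / 2 * Y - d / 2 * R2) + (L + (Q + d / 4 * N) / 2) \<Longrightarrow>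
        d / 2 * Z = d / 2 * Y + d * I + d / 2 * N \<Longrightarrow> a \<le> b + (L - d * I + (Q + - 3 / 4 * d * N) / 2)" for a b d Z Y R2 L Q N I :: real
      by (simp add: field_simps)
    moreover have "(l - \<delta> *\<^sub>R y) \<bullet> (z - y) = l \<bullet> (z - y) - \<delta> * (y \<bullet> (z - y))" by (simp add: inner_diff_left)
    moreover have "u' z \<le> u' y + (l \<bullet> (z - y) + (z - y) \<bullet> ((A + (\<delta> / 4) *\<^sub>R mat 1) *v (z - y)) / 2)"
      using t1[OF zU] z by simp
    ultimately show "u z \<le> u y + ((l - \<delta> *\<^sub>R y) \<bullet> (z - y) + (z - y) \<bullet> ((A + (- 3 / 4 * \<delta>) *\<^sub>R mat 1) *v (z - y)) / 2)"
      unfolding quad_form_mat_1 u'_def right_diff_distrib[of "\<delta> / 2"] by metis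
  next
    show "transpose (A + (- 3 / 4 * \<delta>) *\<^sub>R mat 1) = A + (- 3 / 4 * \<delta>) *\<^sub>R mat 1"
      using AS(1) by (simp only: Sym_iff)
  qed (use \<rho> \<rho>1 in simp)
  moreover have "A + (- 3 / 4 * \<delta>) *\<^sub>R mat 1 = A - (\<delta> / 4) *\<^sub>R mat 1 - (\<delta> / 2) *\<^sub>R mat 1"
  proof -
    have "A + (- 3 / 4 * \<delta>) *\<^sub>R M = A - (\<delta> / 4) *\<^sub>R M - (\<delta> / 2) *\<^sub>R M" for M
      by (simp add: vec_eq_iff field_simps)
    then show ?thesis .
  qed
  ultimately have "A - (\<delta> / 4) *\<^sub>R mat 1 - (\<delta> / 2) *\<^sub>R mat 1 \<in> F" by metis
  then have "A - (\<delta> / 4) *\<^sub>R mat 1 \<in> sym_interior F"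
    by (rule sym_interiorI_shift[OF F, rotated]) (use d(1) in simp)
  moreover have "- A + (\<delta> / 4) *\<^sub>R mat 1 \<in> dual_subeq F"
    by (rule sub_at_quadratic[OF v(2)[OF y(2)], of _ "min \<rho> \<rho>2" l']) (use t2 AS(2) \<rho> \<rho>2 closure_subset[of U] in \<open>auto simp: Sym_iff subset_iff\<close>)
  then have "- (- A + (\<delta> / 4) *\<^sub>R mat 1) \<notin> sym_interior F" by (simp add: dual_subeq_def)
  ultimately show False by simp
qed

section \<open>Semicontinuous envelopes\<close>

lemma usc_scale:
  assumes "usc X u" "0 < t"
  shows "usc X (\<lambda>x. t * u x)"
  unfolding usc_def
proof (intro ballI allI impI)
  fix x c assume x: "x \<in> X" "t * u x < c"
  then have "u x < c / t" using assms(2) by (simp add: pos_less_divide_eq mult.commute)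
  then have "\<forall>\<^sub>F y in at x within X. u y < c / t" using assms(1) x by (auto simp: usc_def)
  then show "\<forall>\<^sub>F y in at x within X. t * u y < c"
    by eventually_elim (use assms(2) in \<open>simp add: pos_less_divide_eq mult.commute\<close>)
qed

lemma usc_imp_continuous:
  assumes "usc X u" "usc X (\<lambda>x. - u x)"
  shows "continuous_on X u"
  unfolding continuous_on_def
proof (intro ballI order_tendstoI)
  fix x a assume x: "x \<in> X" "a < u x"
  then have "\<forall>\<^sub>F y in at x within X. - u y < - a" using uscD[OF assms(2) x(1), of "- a"] by simp
  then show "\<forall>\<^sub>F y in at x within X. a < u y" by simp
next
  fix x a assume "x \<in> X" "u x < a"
  then show "\<forall>\<^sub>F y in at x within X. u y < a" using assms(1) by (auto simp: usc_def)
qed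

text \<open>In the annulus between \<open>\<delta>'\<close> and \<open>\<delta>\<close> the maximum
  already equals \<open>h\<close>, so stopping at radius \<open>\<delta>\<close> causes no
  jump.\<close>

lemma usc_glue:
  fixes h \<beta> :: "'a::metric_space \<Rightarrow> real"
  assumes h: "usc X h" and b: "continuous_on (ball z \<delta>) \<beta>" and d: "\<delta>' < \<delta>"
    and le: "\<And>y. y \<in> X \<Longrightarrow> \<delta>' \<le> dist z y \<Longrightarrow> dist z y < \<delta> \<Longrightarrow> \<beta> y \<le> h y"
  shows "usc X (\<lambda>y. if dist z y < \<delta> then max (h y) (\<beta> y) else h y)" (is "usc X ?w")
  unfolding usc_def
proof (intro ballI allI impI)
  fix x c assume x: "x \<in> X" and c: "?w x < c"
  have hc: "\<forall>\<^sub>F y in at x within X. h y < c" using h x c by (auto simp: usc_def split: if_splits)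
  show "\<forall>\<^sub>F y in at x within X. ?w y < c"
  proof (cases "dist z x < \<delta>")
    case True
    then have xb: "x \<in> ball z \<delta>" by simp
    have "(\<beta> \<longlongrightarrow> \<beta> x) (at x)" using b xb by (simp add: continuous_on_eq_continuous_at isCont_def)
    moreover have "\<beta> x < c" using c True by auto
    ultimately have "\<forall>\<^sub>F y in at x. \<beta> y < c" by (rule order_tendstoD(2))
    then have "\<forall>\<^sub>F y in at x within X. \<beta> y < c" by (metis at_le filter_leD subset_UNIV)
    with hc show ?thesis by eventually_elim auto
  next
    case False
    have "open {y. \<delta>' < dist z y}" by (intro open_Collect_less continuous_intros)
    then have "\<forall>\<^sub>F y in at x within X. y \<in> {y. \<delta>' < dist z y}"
      unfolding eventually_at_topological using False d by (intro exI[of _ "{y. \<delta>' < dist z y}"]) auto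
    moreover have "\<forall>\<^sub>F y in at x within X. y \<in> X" by (simp add: eventually_at_filter)
    ultimately show ?thesis using hc
    proof eventually_elim
      case (elim y)
      then show ?case using le[of y] by auto
    qed
  qed
qed

lemma sub_at_glue:
  assumes h: "sub_at G h x" and b: "x \<in> ball z \<delta> \<Longrightarrow> sub_at G \<beta> x"
  shows "sub_at G (\<lambda>y. if dist z y < \<delta> then max (h y) (\<beta> y) else h y) x" (is "sub_at G ?w x")
proof (cases "dist z x < \<delta> \<and> h x < \<beta> x")
  case True
  show ?thesis
  proof (rule sub_at_lower[OF b, of "\<delta> - dist z x"])
    fix y assume "y \<in> ball x (\<delta> - dist z x)"
    then have "dist z y < \<delta>" using dist_triangle[of z y x] by simp
    then show "\<beta> y \<le> ?w y" by simp
  qed (use True in auto)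
next
  case False
  show ?thesis by (rule sub_at_lower[OF h, of 1]) (use False in auto)
qed

text \<open>The limit superior with the point itself included. The last conclusion, that local upper
  bounds of \<open>f\<close> pass to \<open>g\<close>, is the minimality from which further
  properties of the envelope are derived.\<close>

lemma usc_envelope:
  fixes f :: "'a::metric_space \<Rightarrow> real"
  assumes bd: "\<And>x. x \<in> X \<Longrightarrow> \<exists>d>0. \<exists>c. \<forall>y\<in>X. dist y x < d \<longrightarrow> f y \<le> c"
  obtains g where "\<And>x. x \<in> X \<Longrightarrow> f x \<le> g x" "usc X g"
    "\<And>x c d. x \<in> X \<Longrightarrow> 0 < d \<Longrightarrow> (\<And>y. y \<in> X \<Longrightarrow> dist y x < d \<Longrightarrow> f y \<le> c) \<Longrightarrow> g x \<le> c"
proof -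
  define C where "C x = {c. \<exists>d>0. \<forall>y\<in>X. dist y x < d \<longrightarrow> f y \<le> c}" for x
  define g where "g x = Inf (C x)" for x
  have ne: "C x \<noteq> {}" if "x \<in> X" for x using bd[OF that] by (auto simp: C_def)
  have lb: "f x \<le> c" if "x \<in> X" "c \<in> C x" for x c using that by (force simp: C_def)
  have bb: "bdd_below (C x)" if "x \<in> X" for x using lb[OF that] by (intro bdd_belowI) auto
  have 1: "f x \<le> g x" if "x \<in> X" for x unfolding g_def by (rule cInf_greatest[OF ne[OF that] lb[OF that]])
  have 3: "g x \<le> c" if "x \<in> X" "c \<in> C x" for x c unfolding g_def by (rule cInf_lower[OF that(2) bb[OF that(1)]])
  have 2: "usc X g" unfolding usc_def
  proof (intro ballI allI impI)
    fix x c assume x: "x \<in> X" and c: "g x < c"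
    obtain c' where c': "c' \<in> C x" "c' < c" using cInf_lessD[OF ne[OF x]] c unfolding g_def by blast
    then obtain d where d: "0 < d" "\<forall>y\<in>X. dist y x < d \<longrightarrow> f y \<le> c'" by (auto simp: C_def)
    have "g y < c" if "y \<in> X" "dist y x < d" for y
    proof -
      have "f w \<le> c'" if "w \<in> X" "dist w y < d - dist y x" for w
        using d(2) that dist_triangle[of w x y] by auto
      then have "c' \<in> C y" unfolding C_def using \<open>dist y x < d\<close> by (auto intro!: exI[of _ "d - dist y x"])
      then show ?thesis using 3[OF \<open>y \<in> X\<close>] c'(2) by fastforce
    qed
    then show "\<forall>\<^sub>F y in at x within X. g y < c" unfolding eventually_at using d(1) by blast
  qed
  have 4: "g x \<le> c" if "x \<in> X" "0 < d" "\<And>y. y \<in> X \<Longrightarrow> dist y x < d \<Longrightarrow> f y \<le> c" for x c d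
    by (rule 3[OF that(1)]) (unfold C_def, use that in blast)
  show thesis by (rule that[of g]) (fact 1 2 4)+
qed

text \<open>The form in which barriers act on an envelope. Neighbourhoods are relative to
  \<open>X\<close>, so boundary points belonging to \<open>X\<close> are covered as well.\<close>

lemma envelope_le_continuous:
  fixes f :: "'a::metric_space \<Rightarrow> real"
  assumes env: "\<And>x c d. x \<in> X \<Longrightarrow> 0 < d \<Longrightarrow> (\<And>y. y \<in> X \<Longrightarrow> dist y x < d \<Longrightarrow> f y \<le> c) \<Longrightarrow> g x \<le> c"
    and h: "continuous_on (X \<inter> U) h" and U: "open U" "x \<in> U" and x: "x \<in> X" and le: "\<And>y. y \<in> X \<Longrightarrow> y \<in> U \<Longrightarrow> f y \<le> h y"
  shows "g x \<le> h x"
proof (rule field_le_epsilon)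
  fix e :: real assume e: "0 < e"
  obtain d1 where d1: "0 < d1" "\<And>y. y \<in> X \<inter> U \<Longrightarrow> dist y x < d1 \<Longrightarrow> dist (h y) (h x) < e"
    using h x U(2) e unfolding continuous_on_iff by (metis IntI)
  obtain d2 where d2: "0 < d2" "ball x d2 \<subseteq> U" using U open_contains_ball by blast
  show "g x \<le> h x + e"
  proof (rule env[OF x, of "min d1 d2"])
    fix y assume y: "y \<in> X" "dist y x < min d1 d2"
    then have "y \<in> U" using d2(2) by (auto simp: dist_commute)
    then have "dist (h y) (h x) < e" using d1(2) y by auto
    then show "f y \<le> h x + e" using le[OF y(1) \<open>y \<in> U\<close>] by (simp add: dist_real_def)
  qed (use d1 d2 in auto)
qed

lemma mat_1_perturbation:
  assumes "0 < (e::real)"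
  obtains c where "0 < c" "norm ((2 * c) *\<^sub>R mat 1 :: real^'n^'n) \<le> e / 2"
proof -
  have n1: "0 < norm (mat 1 :: real^'n^'n) + 1" by (simp add: add_nonneg_pos)
  define c where "c = e / (4 * (norm (mat 1 :: real^'n^'n) + 1))"
  have c: "0 < c" using assms n1 by (simp add: c_def)
  have cancel: "2 * (e / (4 * N)) * N = e / 2" if "0 < N" for N using that by simp
  have "norm ((2 * c) *\<^sub>R mat 1 :: real^'n^'n) \<le> 2 * c * (norm (mat 1 :: real^'n^'n) + 1)" using c by simp
  also have "\<dots> = e / 2" unfolding c_def by (rule cancel[OF n1])
  finally show thesis using that c by blast
qed

text \<open>A test function for \<open>g\<close> at \<open>x\<close>, made strict by e |y - x|^2,
  touches some member of the family up to a constant at a point near \<open>x\<close>. The perturbed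
  Hessian there lies in \<open>G\<close>, and \<open>G\<close> is closed.\<close>

lemma sub_at_envelope:
  fixes g :: "real^'n \<Rightarrow> real"
  assumes G: "subeq G" and X: "open Y" "x \<in> Y" "Y \<subseteq> X"
    and W: "W \<noteq> {}" "\<And>w. w \<in> W \<Longrightarrow> usc X w" "\<And>w y. w \<in> W \<Longrightarrow> y \<in> Y \<Longrightarrow> sub_at G w y"
      "\<And>w y. w \<in> W \<Longrightarrow> y \<in> X \<Longrightarrow> w y \<le> g y"
    and env: "\<And>c d. 0 < d \<Longrightarrow> (\<And>y w. y \<in> X \<Longrightarrow> dist y x < d \<Longrightarrow> w \<in> W \<Longrightarrow> w y \<le> c) \<Longrightarrow> g x \<le> c"
  shows "sub_at G g x"
  unfolding sub_at_def
proof (intro allI impI, elim conjE exE)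
  fix phi A r1 assume phi: "C2_hessian_at phi x A" and eq: "g x = phi x" and r1: "0 < r1" "\<forall>y\<in>ball x r1. g y \<le> phi y"
  obtain r2 gr H where H: "0 < r2" "H x = A" "continuous_on (ball x r2) H"
    "\<And>y. y \<in> ball x r2 \<Longrightarrow> (phi has_derivative (\<lambda>h. gr y \<bullet> h)) (at y)"
    "\<And>y. y \<in> ball x r2 \<Longrightarrow> C2_hessian_at phi y (H y)"
    using C2_hessian_at_nearby[OF phi] by metis
  obtain r3 where r3: "0 < r3" "ball x r3 \<subseteq> Y" using X open_contains_ball by blast
  define r where "r = min r1 (min r2 r3)"
  have r: "0 < r" using r1 H r3 by (simp add: r_def)
  have cphi: "isCont phi y" if "y \<in> ball x r2" for y using H(4)[OF that] has_derivative_continuous by blast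
  have approx: "\<exists>z\<in>ball x d. H z + (2 * e) *\<^sub>R mat 1 \<in> G" if e: "0 < e" and d: "0 < d" "d < r" for e d
  proof -
    define q where "q y = e * (norm (y - x))\<^sup>2" for y
    \<comment> \<open>Some \<open>w\<close> comes within \<open>s\<close> of \<open>g x\<close>
      close to \<open>x\<close>. As \<open>w\<close> is below \<open>phi\<close>, maximality at
      \<open>z\<close> forces \<open>q z < 2 * s\<close>, half of the value of \<open>q\<close> on
      the sphere, so \<open>z\<close> is an interior point.\<close>
    define s where "s = e * d\<^sup>2 / 4"
    have s: "0 < s" using e d by (simp add: s_def)
    have "isCont (\<lambda>y. phi y + q y) x" unfolding q_def using H(1) by (intro continuous_intros cphi) auto
    then obtain d' where d': "0 < d'" "\<And>y. dist y x < d' \<Longrightarrow> dist (phi y + q y) (phi x + q x) < s"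
      unfolding continuous_at_eps_delta using s by blast
    have qx: "q x = 0" by (simp add: q_def)
    have "\<exists>y w. y \<in> X \<and> dist y x < min d d' \<and> w \<in> W \<and> g x - s < w y"
    proof (rule ccontr)
      assume no: "\<not> ?thesis"
      have "g x \<le> g x - s"
        by (rule env[of "min d d'"]) (use d d' no in \<open>auto simp: not_less\<close>)
      then show False using s by simp
    qed
    then obtain y w where y: "y \<in> X" "dist y x < min d d'" and w: "w \<in> W" "g x - s < w y" by blast
    have sub: "cball x d \<subseteq> X" using d(2) r3(2) X(3) by (force simp: r_def)
    have "usc (cball x d) (\<lambda>z. w z + - (phi z + q z))"
    proof (rule usc_add[OF _ continuous_imp_usc])
      show "usc (cball x d) w" using usc_subset[OF W(2)[OF w(1)] sub] .
      show "continuous_on (cball x d) (\<lambda>z. - (phi z + q z))" unfolding q_def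
        using cphi d(2) by (intro continuous_intros continuous_at_imp_continuous_on) (auto simp: r_def)
    qed
    then obtain z where z: "z \<in> cball x d" "\<And>y. y \<in> cball x d \<Longrightarrow> w y + - (phi y + q y) \<le> w z + - (phi z + q z)"
      using usc_attains_sup[of "cball x d" "\<lambda>z. w z + - (phi z + q z)"] d(1) by auto
    have "w y - (phi y + q y) \<le> w z - (phi z + q z)" using z(2)[of y] y by (auto simp: dist_commute)
    moreover have "phi y + q y < g x + s" using d'(2)[of y] y eq qx by (auto simp: dist_real_def)
    ultimately have "- 2 * s < w z - (phi z + q z)" using w(2) by linarith
    moreover have "w z \<le> phi z"
    proof -
      have "z \<in> X" "z \<in> ball x r1" using z(1) sub d(2) by (auto simp: r_def)
      then show ?thesis using W(4)[OF w(1)] r1(2) by (meson order_trans)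
    qed
    ultimately have "q z < 2 * s" by linarith
    then have "e * (norm (z - x))\<^sup>2 < e * d\<^sup>2" using e d by (simp add: q_def s_def) (smt (verit) mult_pos_pos zero_less_power)
    then have "(norm (z - x))\<^sup>2 < d\<^sup>2" using e by simp
    then have zd: "dist x z < d" using d(1) by (simp add: dist_norm norm_minus_commute power_less_imp_less_base)
    have qC: "C2_hessian_at q z ((2 * e) *\<^sub>R mat 1)"
    proof -
      have t: "transpose ((2 * e) *\<^sub>R mat 1 :: real^'n^'n) = (2 * e) *\<^sub>R mat 1" by (simp add: transpose_linear)
      have "q = (\<lambda>y. 0 + (0 \<bullet> (y - x) + (y - x) \<bullet> (((2 * e) *\<^sub>R mat 1) *v (y - x)) / 2))"
        by (auto simp: q_def fun_eq_iff scaleR_matrix_vector_assoc[symmetric] power2_norm_eq_inner)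
      then show ?thesis using C2_hessian_at_quadratic[OF t, of 0 0 x z] by simp
    qed
    define k where "k = w z - (phi z + q z)"
    have C: "C2_hessian_at (\<lambda>y. phi y + q y + k) z (H z + (2 * e) *\<^sub>R mat 1 + 0)"
      using zd d(2) by (intro C2_hessian_at_add H(5) qC C2_hessian_at_const) (auto simp: r_def)
    have zY: "z \<in> Y" using zd d(2) r3(2) by (auto simp: r_def)
    have "\<exists>r>0. \<forall>y\<in>ball z r. w y \<le> phi y + q y + k"
    proof (rule exI[of _ "d - dist x z"], intro conjI ballI)
      fix y assume "y \<in> ball z (d - dist x z)"
      then have "y \<in> cball x d" using dist_triangle[of x y z] by simp
      from z(2)[OF this] show "w y \<le> phi y + q y + k" by (simp add: k_def)
    qed (use zd in simp)
    moreover have "w z = phi z + q z + k" by (simp add: k_def)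
    ultimately have "H z + (2 * e) *\<^sub>R mat 1 + 0 \<in> G" using W(3)[OF w(1) zY] C unfolding sub_at_def by blast
    then show ?thesis using zd by auto
  qed
  have "A \<in> closure G" unfolding closure_approachable
  proof (intro allI impI)
    fix e :: real assume e: "0 < e"
    obtain e' where e': "0 < e'" "norm ((2 * e') *\<^sub>R mat 1 :: real^'n^'n) \<le> e / 2" using mat_1_perturbation[OF e] by blast
    have "isCont H x" using H(1,3) by (simp add: continuous_on_eq_continuous_at)
    then obtain d where d: "0 < d" "\<And>z. dist z x < d \<Longrightarrow> dist (H z) A < e / 2"
      unfolding continuous_at_eps_delta H(2) using e by (metis half_gt_zero)
    have "0 < min d (r / 2)" "min d (r / 2) < r" using d r by auto
    then obtain z where z: "z \<in> ball x (min d (r / 2))" "H z + (2 * e') *\<^sub>R mat 1 \<in> G" using approx[OF e'(1)] by blast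
    have "dist (H z + (2 * e') *\<^sub>R mat 1) A \<le> dist (H z) A + norm ((2 * e') *\<^sub>R mat 1 :: real^'n^'n)"
      unfolding dist_norm using norm_triangle_ineq[of "H z - A" "(2 * e') *\<^sub>R mat 1"] by (simp add: algebra_simps)
    also note e'(2)
    also have "dist (H z) A < e / 2" using z(1) by (intro d) (simp add: dist_commute)
    finally show "\<exists>y\<in>G. dist y A < e" using z(2) by force
  qed
  then show "A \<in> G" using G by (simp add: subeq_def)
qed

section \<open>The Perron solution with prescribed poles\<close>

definition has_barrier :: "(real^'n^'n) set \<Rightarrow> (real^'n) set \<Rightarrow> real^'n \<Rightarrow> bool" where
  "has_barrier G Om y \<longleftrightarrow> (\<exists>r>0. \<exists>c>0. \<exists>\<beta>. \<beta> y = 0 \<and> continuous_on (ball y r) \<beta> \<and>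
     (\<forall>C>0. \<forall>x\<in>ball y r. sub_at G (\<lambda>z. C * \<beta> z) x) \<and>
     (\<forall>x\<in>closure Om \<inter> ball y r. \<beta> x \<le> - (c * (norm (x - y))\<^sup>2)))"

lemma has_barrierE:
  assumes "has_barrier G Om y"
  obtains r c \<beta> where "0 < r" "0 < c" "\<beta> y = 0" "continuous_on (ball y r) \<beta>"
    "\<And>C x. 0 < C \<Longrightarrow> x \<in> ball y r \<Longrightarrow> sub_at G (\<lambda>z. C * \<beta> z) x"
    "\<And>x. x \<in> closure Om \<Longrightarrow> x \<in> ball y r \<Longrightarrow> \<beta> x \<le> - (c * (norm (x - y))\<^sup>2)"
  using assms unfolding has_barrier_def by blast

text \<open>\<open>k\<close> stands for the Riesz kernel and \<open>b\<close> for a subsolution with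
  the exact poles. One pole and several poles differ in how \<open>b\<close> is shown to be
  subharmonic, so that fact is an assumption here.\<close>

locale singular_dirichlet =
  fixes F :: "(real^'n^'n) set" and Om S :: "(real^'n) set" and Th :: "real^'n \<Rightarrow> real"
    and k \<phi> b :: "real^'n \<Rightarrow> real"
  assumes cone: "cone_subequation F" and Om: "open Om" "bounded Om"
    and S: "finite S" "S \<subseteq> Om" "S \<noteq> {}" and Th: "\<And>s. s \<in> S \<Longrightarrow> 0 < Th s"
    and k_cont: "continuous_on (- {0}) k"
    and k_pole: "\<And>B. \<exists>r>0. \<forall>x. 0 < norm x \<and> norm x < r \<longrightarrow> k x \<le> B"
    and k_dual: "\<And>t s x. 0 < t \<Longrightarrow> x \<noteq> s \<Longrightarrow> sub_at (dual_subeq F) (\<lambda>y. - (t * k (y - s))) x"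
    and phi: "continuous_on (frontier Om) \<phi>"
    and b_cont: "continuous_on (closure Om - S) b" and b_sub: "\<And>x. x \<in> Om - S \<Longrightarrow> sub_at F b x"
    and b_bdry: "\<And>x. x \<in> frontier Om \<Longrightarrow> b x \<le> \<phi> x"
    and b_pole: "\<And>s. s \<in> S \<Longrightarrow> \<exists>r>0. \<exists>M. \<forall>x\<in>ball s r - {s}. \<bar>b x - Th s * k (x - s)\<bar> \<le> M"
    and barrier: "\<And>y. y \<in> frontier Om \<Longrightarrow> has_barrier F Om y"
    and dual_barrier: "\<And>y. y \<in> frontier Om \<Longrightarrow> has_barrier (dual_subeq F) Om y"
begin

abbreviation "X \<equiv> closure Om - S"

lemma F: "subeq F" using cone by (rule cone_imp_subeq)

lemma open_diff: "open (Om - S)" using Om(1) S(1) by (simp add: finite_imp_closed open_Diff)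

lemma diff_subset: "Om - S \<subseteq> X" using closure_subset by blast

lemma frontier_facts: "compact (frontier Om)" "frontier Om \<subseteq> X" "frontier Om \<inter> Om = {}"
    "X = frontier Om \<union> (Om - S)"
proof -
  show "compact (frontier Om)" using Om(2) by (simp add: compact_frontier_bounded)
  show "frontier Om \<subseteq> X" "frontier Om \<inter> Om = {}" "X = frontier Om \<union> (Om - S)"
    using Om(1) S(2) closure_subset by (auto simp: frontier_def interior_open)
qed

lemma k_shift_cont: "continuous_on (- {s}) (\<lambda>y. k (y - s))"
  by (rule continuous_on_compose2[OF k_cont]) (auto intro!: continuous_intros)

lemma poles_comparison:
  assumes u: "usc X u" "\<And>x. x \<in> Om - S \<Longrightarrow> sub_at F u x"
    and v: "usc X v" "\<And>x. x \<in> Om - S \<Longrightarrow> sub_at (dual_subeq F) v x"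
    and bd: "\<And>x. x \<in> frontier Om \<Longrightarrow> u x + v x \<le> 0"
    and up: "\<And>s. s \<in> S \<Longrightarrow> \<exists>r>0. \<exists>M. \<forall>x\<in>ball s r - {s}. u x \<le> Th s * k (x - s) + M"
    and vp: "\<And>s. s \<in> S \<Longrightarrow> \<exists>r>0. \<exists>M. \<forall>x\<in>ball s r - {s}. v x \<le> - (Th s * k (x - s)) + M"
    and x0: "x0 \<in> Om - S"
  shows "u x0 + v x0 \<le> 0"
proof -
  obtain m where m: "0 \<le> m" "\<And>x. x \<in> frontier Om \<Longrightarrow> u x \<le> m"
  proof (cases "frontier Om = {}")
    case False
    obtain x where "\<And>y. y \<in> frontier Om \<Longrightarrow> u y \<le> u x"
      using usc_attains_sup[OF frontier_facts(1) False usc_subset[OF u(1) frontier_facts(2)]] by blast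
    then show ?thesis using that[of "max 0 (u x)"] by (auto simp: le_max_iff_disj)
  qed (use that[of 0] in auto)
  \<comment> \<open>On the frontier \<open>(1 + \<epsilon>) * u + v\<close> is at most
    \<open>\<epsilon> * u\<close>, hence the allowance \<open>\<epsilon> * m\<close>; it disappears
    as \<epsilon> tends to 0.\<close>
  have key: "(1 + \<epsilon>) * u x0 + v x0 \<le> \<epsilon> * m" if e: "0 < \<epsilon>" for \<epsilon>
  proof -
    have "\<exists>r>0. r < dist x0 s \<and> cball s r \<subseteq> Om \<and> (\<forall>x\<in>cball s r - {s}. (1 + \<epsilon>) * u x + v x \<le> 0)" if s: "s \<in> S" for s
    proof -
      obtain r1 M1 where 1: "0 < r1" "\<And>x. x \<in> ball s r1 - {s} \<Longrightarrow> u x \<le> Th s * k (x - s) + M1" using up[OF s] by blast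
      obtain r2 M2 where 2: "0 < r2" "\<And>x. x \<in> ball s r2 - {s} \<Longrightarrow> v x \<le> - (Th s * k (x - s)) + M2" using vp[OF s] by blast
      \<comment> \<open>Below this value of \<open>k\<close> the uncancelled part
        \<open>\<epsilon> * Th s * k\<close> outweighs the bounded errors of \<open>u\<close> and
        \<open>v\<close>.\<close>
      obtain r3 where 3: "0 < r3" "\<And>x. 0 < norm x \<Longrightarrow> norm x < r3 \<Longrightarrow> k x \<le> - ((1 + \<epsilon>) * M1 + M2) / (\<epsilon> * Th s)"
        using k_pole by blast
      obtain r4 where 4: "0 < r4" "ball s r4 \<subseteq> Om" using Om(1) S(2) s open_contains_ball by blast
      have 5: "0 < dist x0 s" using x0 s by auto
      define r where "r = min (min r1 r2) (min (min r3 r4) (dist x0 s)) / 2"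
      have r0: "0 < r" using 1 2 3 4 5 by (simp add: r_def)
      have "2 * r \<le> r1" "2 * r \<le> r2" "2 * r \<le> r3" "2 * r \<le> r4" "2 * r \<le> dist x0 s" by (auto simp: r_def)
      then have r: "0 < r" "r < r1" "r < r2" "r < r3" "r < r4" "r < dist x0 s" using r0 by linarith+
      have "(1 + \<epsilon>) * u x + v x \<le> 0" if x: "x \<in> cball s r - {s}" for x
      proof -
        have "k (x - s) \<le> - ((1 + \<epsilon>) * M1 + M2) / (\<epsilon> * Th s)"
          by (rule 3(2)) (use x r in \<open>auto simp: dist_norm norm_minus_commute\<close>)
        then have "(\<epsilon> * Th s) * k (x - s) \<le> - ((1 + \<epsilon>) * M1 + M2)"
          using e Th[OF s] by (simp add: pos_le_divide_eq mult.commute)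
        moreover have "(1 + \<epsilon>) * u x \<le> (1 + \<epsilon>) * (Th s * k (x - s) + M1)"
          using 1(2)[of x] x r e by (intro mult_left_mono) auto
        moreover have "v x \<le> - (Th s * k (x - s)) + M2" using 2(2)[of x] x r by auto
        ultimately show ?thesis by (simp add: algebra_simps)
      qed
      moreover have "cball s r \<subseteq> Om" using 4(2) r by auto
      ultimately show ?thesis using r by blast
    qed
    then obtain r where r: "\<And>s. s \<in> S \<Longrightarrow> 0 < r s \<and> r s < dist x0 s \<and> cball s (r s) \<subseteq> Om \<and> (\<forall>x\<in>cball s (r s) - {s}. (1 + \<epsilon>) * u x + v x \<le> 0)"
      by metis
    \<comment> \<open>Comparison runs off small closed balls around the poles, where the sum is
      already nonpositive away from the pole; the radii leave \<open>x0\<close> outside.\<close>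
    define U where "U = Om - (\<Union>s\<in>S. cball s (r s))"
    have U: "open U" "bounded U" "x0 \<in> U" "U \<subseteq> Om - S"
    proof -
      show "open U" unfolding U_def using Om(1) S(1) by (intro open_Diff closed_UN) auto
      show "bounded U" using Om(2) by (rule bounded_subset) (auto simp: U_def)
      show "x0 \<in> U" using x0 r by (fastforce simp: U_def dist_commute)
      show "U \<subseteq> Om - S" using r by (force simp: U_def)
    qed
    have noS: "closure U \<inter> ball s (r s) = {}" if "s \<in> S" for s
    proof -
      have "ball s (r s) \<inter> U = {}" using that by (auto simp: U_def)
      then show ?thesis using open_Int_closure_eq_empty[of "ball s (r s)" U] by auto
    qed
    have clU: "closure U \<subseteq> X"
    proof
      fix x assume x: "x \<in> closure U"
      then have "x \<in> closure Om" using closure_mono[of U Om] by (auto simp: U_def)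
      moreover have "x \<notin> S" using noS x r by force
      ultimately show "x \<in> X" by simp
    qed
    have "(1 + \<epsilon>) * u x0 + (v x0 + - (\<epsilon> * m)) \<le> 0"
    proof (rule comparison[where u="\<lambda>x. (1 + \<epsilon>) * u x" and v="\<lambda>x. v x + - (\<epsilon> * m)", OF F U(1,2) _ _ _ _ _ U(3)])
      show "usc (closure U) (\<lambda>x. (1 + \<epsilon>) * u x)" using e by (intro usc_scale usc_subset[OF u(1) clU]) auto
      show "usc (closure U) (\<lambda>x. v x + - (\<epsilon> * m))"
        by (rule usc_add[OF usc_subset[OF v(1) clU] continuous_imp_usc]) (rule continuous_on_const)
      show "sub_at F (\<lambda>x. (1 + \<epsilon>) * u x) x" if "x \<in> U" for x
        using that U(4) e by (intro sub_at_scale cone u(2)) auto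
      show "sub_at (dual_subeq F) (\<lambda>x. v x + - (\<epsilon> * m)) x" if "x \<in> U" for x
        using that U(4) by (intro sub_at_add_const v(2)) auto
      fix x assume "x \<in> frontier U"
      then have x: "x \<in> closure U" "x \<notin> U" using U(1) by (auto simp: frontier_def interior_open)
      have em: "0 \<le> \<epsilon> * m" using e m(1) by simp
      show "(1 + \<epsilon>) * u x + (v x + - (\<epsilon> * m)) \<le> 0"
      proof (cases "x \<in> Om")
        case True
        then obtain s where s: "s \<in> S" "x \<in> cball s (r s)" using x(2) by (auto simp: U_def)
        moreover have "x \<noteq> s" using noS[OF s(1)] r[OF s(1)] x(1) by force
        ultimately have "(1 + \<epsilon>) * u x + v x \<le> 0" using r[OF s(1)] by blast
        then show ?thesis using em by simp
      next
        case False
        then have xf: "x \<in> frontier Om" using clU x(1) Om(1) by (auto simp: frontier_def interior_open)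
        have "\<epsilon> * u x \<le> \<epsilon> * m" using m(2)[OF xf] e by simp
        then show ?thesis using bd[OF xf] by (simp add: algebra_simps)
      qed
    qed
    then show ?thesis by simp
  qed
  show ?thesis
  proof (rule ccontr)
    define g where "g = u x0 + v x0"
    assume "\<not> u x0 + v x0 \<le> 0"
    then have g: "0 < g" by (simp add: g_def)
    define N where "N = m + \<bar>u x0\<bar> + 1"
    have N: "0 < N" "m - u x0 \<le> N" using m(1) by (auto simp: N_def)
    \<comment> \<open>Chosen so that \<open>key\<close> gives \<open>g \<le> g / 2\<close>.\<close>
    define e where "e = g / (2 * N)"
    have e: "0 < e" using g N by (simp add: e_def)
    have "g \<le> e * (m - u x0)" using key[OF e] g_def by (simp add: algebra_simps)
    also have "\<dots> \<le> e * N" using e N by (intro mult_left_mono) auto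
    also have "\<dots> = g / 2" using N by (simp add: e_def)
    finally show False using g by simp
  qed
qed

text \<open>The Perron family. At the poles it prescribes an upper bound on the growth, which
  survives pasting and envelopes; the matching lower bound comes from \<open>b\<close>.\<close>

definition "W = {w. usc X w \<and> (\<forall>x\<in>Om - S. sub_at F w x) \<and> (\<forall>x\<in>frontier Om. w x \<le> \<phi> x) \<and>
   (\<forall>s\<in>S. \<exists>r>0. \<exists>M. \<forall>x\<in>ball s r - {s}. w x \<le> Th s * k (x - s) + M)}"

lemma W_D:
  assumes "w \<in> W"
  shows "usc X w" "\<And>x. x \<in> Om - S \<Longrightarrow> sub_at F w x" "\<And>x. x \<in> frontier Om \<Longrightarrow> w x \<le> \<phi> x"
    "\<And>s. s \<in> S \<Longrightarrow> \<exists>r>0. \<exists>M. \<forall>x\<in>ball s r - {s}. w x \<le> Th s * k (x - s) + M"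
  using assms by (auto simp: W_def)

lemma b_in_W: "b \<in> W"
proof -
  have "\<exists>r>0. \<exists>M. \<forall>x\<in>ball s r - {s}. b x \<le> Th s * k (x - s) + M" if s: "s \<in> S" for s
  proof -
    obtain r M where "0 < r" "\<And>x. x \<in> ball s r - {s} \<Longrightarrow> \<bar>b x - Th s * k (x - s)\<bar> \<le> M" using b_pole[OF s] by blast
    then have "b x \<le> Th s * k (x - s) + M" if "x \<in> ball s r - {s}" for x using that by (force simp: abs_le_iff)
    then show ?thesis using \<open>0 < r\<close> by blast
  qed
  then show ?thesis unfolding W_def using b_sub b_bdry continuous_imp_usc[OF b_cont] by blast
qed

text \<open>Serves both the boundary barriers and the interior bump. The pasting ball keeps away
  from the poles, so the growth condition there is untouched.\<close>

lemma glue_in_W: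
  assumes h: "h \<in> W" and beta: "continuous_on (ball z \<delta>) \<beta>" and d: "\<delta>' < \<delta>"
    and le: "\<And>y. y \<in> X \<Longrightarrow> \<delta>' \<le> dist z y \<Longrightarrow> dist z y < \<delta> \<Longrightarrow> \<beta> y \<le> h y"
    and sub: "\<And>x. x \<in> Om - S \<Longrightarrow> x \<in> ball z \<delta> \<Longrightarrow> sub_at F \<beta> x"
    and bdry: "\<And>x. x \<in> frontier Om \<Longrightarrow> x \<in> ball z \<delta> \<Longrightarrow> \<beta> x \<le> \<phi> x"
    and poles: "S \<inter> cball z \<delta> = {}"
  shows "(\<lambda>y. if dist z y < \<delta> then max (h y) (\<beta> y) else h y) \<in> W"
  unfolding W_def
proof (intro CollectI conjI ballI)
  show "usc X (\<lambda>y. if dist z y < \<delta> then max (h y) (\<beta> y) else h y)"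
    by (rule usc_glue[OF W_D(1)[OF h] beta d le])
  show "sub_at F (\<lambda>y. if dist z y < \<delta> then max (h y) (\<beta> y) else h y) x" if "x \<in> Om - S" for x
    by (intro sub_at_glue W_D(2)[OF h] sub that)
  show "(if dist z x < \<delta> then max (h x) (\<beta> x) else h x) \<le> \<phi> x" if "x \<in> frontier Om" for x
    using W_D(3)[OF h that] bdry[OF that] by simp
  fix s assume s: "s \<in> S"
  obtain r M where r: "0 < r" "\<And>x. x \<in> ball s r - {s} \<Longrightarrow> h x \<le> Th s * k (x - s) + M" using W_D(4)[OF h s] by blast
  have "\<delta> < dist z s" using poles s by (auto simp: disjoint_iff)
  moreover have "\<not> dist z x < \<delta>" if "x \<in> ball s (min r (dist z s - \<delta>))" for x
    using that dist_triangle[of z s x] by (simp add: dist_commute)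
  ultimately show "\<exists>r>0. \<exists>M. \<forall>x\<in>ball s r - {s}. (if dist z x < \<delta> then max (h x) (\<beta> x) else h x) \<le> Th s * k (x - s) + M"
    using r by (intro exI[of _ "min r (dist z s - \<delta>)"] conjI exI[of _ M] ballI) auto
qed

text \<open>Comparison with the kernel of the single pole \<open>s\<close>. At another pole
  \<open>s'\<close> this kernel is bounded, whereas \<open>- (Th s' * k (x - s'))\<close> is
  nonnegative nearby, so the dual function meets the growth condition there as well.\<close>

lemma W_upper_bound:
  assumes s: "s \<in> S"
  obtains C where "\<And>w x. w \<in> W \<Longrightarrow> x \<in> X \<Longrightarrow> w x \<le> Th s * k (x - s) + C"
proof -
  have sX: "X \<subseteq> - {s}" using s by auto
  have ck: "continuous_on X (\<lambda>x. k (x - s))" by (rule continuous_on_subset[OF k_shift_cont sX])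
  have "continuous_on (frontier Om) (\<lambda>x. \<phi> x - Th s * k (x - s))"
    by (intro continuous_intros phi continuous_on_subset[OF ck frontier_facts(2)])
  then have "bounded ((\<lambda>x. \<phi> x - Th s * k (x - s)) ` frontier Om)"
    using frontier_facts(1) compact_continuous_image compact_imp_bounded by blast
  then obtain C where C: "\<And>x. x \<in> frontier Om \<Longrightarrow> \<bar>\<phi> x - Th s * k (x - s)\<bar> \<le> C" unfolding bounded_iff by auto
  show thesis
  proof (rule that[of C])
    fix w x assume w: "w \<in> W" and x: "x \<in> X"
    have "w x + (- (Th s * k (x - s)) + - C) \<le> 0" if x: "x \<in> Om - S"
    proof (rule poles_comparison[where u=w and v="\<lambda>x. - (Th s * k (x - s)) + - C", OF _ _ _ _ _ _ _ x])
      show "usc X w" by (rule W_D(1)[OF w])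
      show "sub_at F w x" if "x \<in> Om - S" for x using that by (rule W_D(2)[OF w])
      show "\<exists>r>0. \<exists>M. \<forall>x\<in>ball s r - {s}. w x \<le> Th s * k (x - s) + M" if "s \<in> S" for s
        using that by (rule W_D(4)[OF w])
      show "usc X (\<lambda>x. - (Th s * k (x - s)) + - C)" by (intro continuous_imp_usc continuous_intros ck)
      show "sub_at (dual_subeq F) (\<lambda>x. - (Th s * k (x - s)) + - C) x" if "x \<in> Om - S" for x
        using that s by (intro sub_at_add_const k_dual Th) auto
      show "w x + (- (Th s * k (x - s)) + - C) \<le> 0" if "x \<in> frontier Om" for x
        using W_D(3)[OF w that] C[OF that] by (simp add: abs_le_iff)
      fix s' assume s': "s' \<in> S"
      show "\<exists>r>0. \<exists>M. \<forall>x\<in>ball s' r - {s'}. - (Th s * k (x - s)) + - C \<le> - (Th s' * k (x - s')) + M"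
      proof (cases "s' = s")
        case True
        then show ?thesis by (intro exI[of _ 1] conjI exI[of _ "- C"]) auto
      next
        case False
        have "isCont (\<lambda>y. k (y - s)) s'" using k_shift_cont[of s] False by (simp add: continuous_on_eq_continuous_at open_Compl)
        then obtain r1 where r1: "0 < r1" "\<And>y. dist y s' < r1 \<Longrightarrow> dist (k (y - s)) (k (s' - s)) < 1"
          unfolding continuous_at_eps_delta using zero_less_one by blast
        obtain r2 where r2: "0 < r2" "\<And>x. 0 < norm x \<Longrightarrow> norm x < r2 \<Longrightarrow> k x \<le> 0" using k_pole by blast
        show ?thesis
        proof (rule exI[of _ "min r1 r2"], rule conjI)
          show "0 < min r1 r2" using r1 r2 by simp
          have "- (Th s * k (x - s)) + - C \<le> - (Th s' * k (x - s')) + (Th s * (\<bar>k (s' - s)\<bar> + 1) - C)"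
            if x: "x \<in> ball s' (min r1 r2) - {s'}" for x
          proof -
            have "k (x - s') \<le> 0" using x by (intro r2) (auto simp: dist_norm norm_minus_commute)
            then have "Th s' * k (x - s') \<le> 0" using Th[OF s'] by (simp add: mult_le_0_iff)
            moreover have "- k (x - s) \<le> \<bar>k (s' - s)\<bar> + 1" using r1(2)[of x] x by (auto simp: dist_real_def dist_commute)
            then have "Th s * - k (x - s) \<le> Th s * (\<bar>k (s' - s)\<bar> + 1)" using Th[OF s] by (intro mult_left_mono) auto
            ultimately show ?thesis by simp
          qed
          then show "\<exists>M. \<forall>x\<in>ball s' (min r1 r2) - {s'}. - (Th s * k (x - s)) + - C \<le> - (Th s' * k (x - s')) + M" by blast
        qed
      qed
    qed
    moreover have "w x \<le> Th s * k (x - s) + C" if "x \<in> frontier Om"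
      using W_D(3)[OF w that] C[OF that] by (simp add: abs_le_iff)
    ultimately show "w x \<le> Th s * k (x - s) + C" using x frontier_facts(4) by auto
  qed
qed

lemma W_local_bound:
  assumes y: "y \<in> frontier Om" and \<delta>: "S \<inter> cball y \<delta> = {}"
  obtains M where "\<And>w x. w \<in> W \<Longrightarrow> x \<in> closure Om \<inter> cball y \<delta> \<Longrightarrow> w x \<le> M"
    "\<And>x. x \<in> closure Om \<inter> cball y \<delta> \<Longrightarrow> - M \<le> b x"
proof -
  obtain s where s: "s \<in> S" using S(3) by blast
  obtain C where C: "\<And>w x. w \<in> W \<Longrightarrow> x \<in> X \<Longrightarrow> w x \<le> Th s * k (x - s) + C" using W_upper_bound[OF s] by blast
  let ?K = "closure Om \<inter> cball y \<delta>"
  have K: "compact ?K" by (intro closed_Int_compact closed_closure compact_cball)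
  have KX: "?K \<subseteq> X" using \<delta> by auto
  have "continuous_on ?K (\<lambda>x. Th s * k (x - s) + C)"
    by (intro continuous_intros continuous_on_subset[OF k_shift_cont]) (use KX s in auto)
  then have "bounded ((\<lambda>x. Th s * k (x - s) + C) ` ?K)" using K compact_continuous_image compact_imp_bounded by blast
  then obtain M1 where "\<forall>z\<in>(\<lambda>x. Th s * k (x - s) + C) ` ?K. norm z \<le> M1" unfolding bounded_iff by blast
  then have M1: "\<And>x. x \<in> ?K \<Longrightarrow> \<bar>Th s * k (x - s) + C\<bar> \<le> M1" by auto
  have "bounded (b ` ?K)" using K continuous_on_subset[OF b_cont KX] compact_continuous_image compact_imp_bounded by blast
  then obtain M2 where "\<forall>z\<in>b ` ?K. norm z \<le> M2" unfolding bounded_iff by blast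
  then have M2: "\<And>x. x \<in> ?K \<Longrightarrow> \<bar>b x\<bar> \<le> M2" by auto
  show thesis
  proof (rule that[of "max M1 M2"])
    show "w x \<le> max M1 M2" if "w \<in> W" "x \<in> ?K" for w x
      using C[OF that(1), of x] M1[OF that(2)] that KX by (auto simp: abs_le_iff le_max_iff_disj)
    show "- max M1 M2 \<le> b x" if "x \<in> ?K" for x using M2[OF that] by (auto simp: abs_le_iff)
  qed
qed

section \<open>Behaviour at the boundary\<close>

lemma frontier_radius:
  assumes y: "y \<in> frontier Om" and r: "0 < r" and e: "0 < e"
  obtains \<delta> where "0 < \<delta>" "\<delta> < r" "S \<inter> cball y \<delta> = {}"
    "\<And>x. x \<in> frontier Om \<Longrightarrow> dist x y \<le> \<delta> \<Longrightarrow> \<bar>\<phi> x - \<phi> y\<bar> < e"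
proof -
  have "y \<in> - S" "open (- S)" using y frontier_facts(2) S(1) by (auto simp: finite_imp_closed)
  then obtain d1 where d1: "0 < d1" "ball y d1 \<subseteq> - S" using open_contains_ball by blast
  obtain d2 where d2: "0 < d2" "\<And>x. x \<in> frontier Om \<Longrightarrow> dist x y < d2 \<Longrightarrow> dist (\<phi> x) (\<phi> y) < e"
    using phi y e unfolding continuous_on_iff by blast
  show thesis
  proof (rule that[of "min r (min d1 d2) / 2"])
    have "cball y (min r (min d1 d2) / 2) \<subseteq> ball y d1" using d1(1) d2(1) r by auto
    then show "S \<inter> cball y (min r (min d1 d2) / 2) = {}" using d1(2) by blast
    show "\<bar>\<phi> x - \<phi> y\<bar> < e" if "x \<in> frontier Om" "dist x y \<le> min r (min d1 d2) / 2" for x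
      using d2(2)[OF that(1)] that(2) d1(1) d2(1) r by (auto simp: dist_real_def)
  qed (use d1 d2 r in auto)
qed

text \<open>A member of the family that nearly attains the boundary value: a large multiple of the
  barrier falls below \<open>b\<close> from distance \<open>\<delta> / 2\<close> on and can be
  pasted into it.\<close>

lemma lower_barrier:
  assumes y: "y \<in> frontier Om" and e: "0 < e"
  obtains w \<delta> \<beta> where "w \<in> W" "0 < \<delta>" "continuous_on (ball y \<delta>) \<beta>" "\<beta> y = \<phi> y - e" "\<And>x. x \<in> ball y \<delta> \<Longrightarrow> \<beta> x \<le> w x"
proof -
  obtain r c \<beta> where beta: "0 < r" "0 < c" "\<beta> y = 0" "continuous_on (ball y r) \<beta>"
    "\<And>C x. 0 < C \<Longrightarrow> x \<in> ball y r \<Longrightarrow> sub_at F (\<lambda>z. C * \<beta> z) x"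
    "\<And>x. x \<in> closure Om \<Longrightarrow> x \<in> ball y r \<Longrightarrow> \<beta> x \<le> - (c * (norm (x - y))\<^sup>2)"
    using barrier[OF y] has_barrierE by metis
  obtain \<delta> where d: "0 < \<delta>" "\<delta> < r" "S \<inter> cball y \<delta> = {}"
    "\<And>x. x \<in> frontier Om \<Longrightarrow> dist x y \<le> \<delta> \<Longrightarrow> \<bar>\<phi> x - \<phi> y\<bar> < e" using frontier_radius[OF y beta(1) e] by blast
  obtain M where M: "\<And>x. x \<in> closure Om \<inter> cball y \<delta> \<Longrightarrow> - M \<le> b x" using W_local_bound[OF y d(3)] by metis
  define C where "C = (\<bar>\<phi> y\<bar> + \<bar>M\<bar> + 1) / (c * (\<delta> / 2)\<^sup>2)"
  have cd: "0 < c * (\<delta> / 2)\<^sup>2" using beta d by simp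
  have C: "0 < C" "C * (c * (\<delta> / 2)\<^sup>2) = \<bar>\<phi> y\<bar> + \<bar>M\<bar> + 1"
  proof -
    show "0 < C" unfolding C_def using cd by (intro divide_pos_pos) auto
    show "C * (c * (\<delta> / 2)\<^sup>2) = \<bar>\<phi> y\<bar> + \<bar>M\<bar> + 1" unfolding C_def using cd by (metis less_irrefl nonzero_eq_divide_eq)
  qed
  define \<gamma> where "\<gamma> x = C * \<beta> x + (\<phi> y - e)" for x
  have neg: "\<beta> x \<le> 0" if "x \<in> closure Om" "x \<in> ball y r" for x
  proof -
    have "0 \<le> c * (norm (x - y))\<^sup>2" using beta(2) by simp
    then show ?thesis using beta(6)[OF that] by linarith
  qed
  have cg: "continuous_on (ball y \<delta>) \<gamma>" unfolding \<gamma>_def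
    using d(2) by (intro continuous_intros continuous_on_subset[OF beta(4)]) auto
  let ?w = "\<lambda>x. if dist y x < \<delta> then max (b x) (\<gamma> x) else b x"
  show thesis
  proof (rule that[of ?w \<delta> \<gamma>])
    show "?w \<in> W"
    proof (rule glue_in_W[OF b_in_W cg _ _ _ _ d(3), of "\<delta> / 2"])
      fix x assume x: "x \<in> X" "\<delta> / 2 \<le> dist y x" "dist y x < \<delta>"
      have "(\<delta> / 2)\<^sup>2 \<le> (norm (x - y))\<^sup>2" using x d by (intro power_mono) (auto simp: dist_norm norm_minus_commute)
      then have "c * (\<delta> / 2)\<^sup>2 \<le> c * (norm (x - y))\<^sup>2" using beta(2) by simp
      moreover have "\<beta> x \<le> - (c * (norm (x - y))\<^sup>2)" using x d by (intro beta) auto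
      ultimately have "\<beta> x \<le> - (c * (\<delta> / 2)\<^sup>2)" by linarith
      then have "C * \<beta> x \<le> C * - (c * (\<delta> / 2)\<^sup>2)" using C(1) by (intro mult_left_mono) auto
      then have "\<gamma> x \<le> - M" unfolding \<gamma>_def using C(2) e by simp
      also have "\<dots> \<le> b x" using x by (intro M) auto
      finally show "\<gamma> x \<le> b x" .
    next
      fix x assume "x \<in> Om - S" "x \<in> ball y \<delta>"
      then show "sub_at F \<gamma> x" unfolding \<gamma>_def using C(1) d(2) by (intro sub_at_add_const beta(5)) auto
    next
      fix x assume x: "x \<in> frontier Om" "x \<in> ball y \<delta>"
      have "C * \<beta> x \<le> 0" using neg[of x] x frontier_facts(2) C(1) d(2) by (auto simp: mult_le_0_iff)
      then show "\<gamma> x \<le> \<phi> x" using d(4)[OF x(1)] x(2) unfolding \<gamma>_def by (simp add: dist_commute abs_less_iff)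
    qed (use d in auto)
  qed (use d cg beta(3) in \<open>auto simp: \<gamma>_def\<close>)
qed

text \<open>Comparison on \<open>Om \<inter> ball y \<delta>\<close> with the dual barrier gives one
  majorant for the whole family; \<open>C\<close> lifts it above the uniform bound \<open>M\<close>
  on the sphere.\<close>

lemma upper_barrier:
  assumes y: "y \<in> frontier Om" and e: "0 < e"
  obtains \<delta> \<beta> where "0 < \<delta>" "continuous_on (ball y \<delta>) \<beta>" "\<beta> y = \<phi> y + e"
    "\<And>w x. w \<in> W \<Longrightarrow> x \<in> X \<Longrightarrow> x \<in> ball y \<delta> \<Longrightarrow> w x \<le> \<beta> x"
proof -
  obtain r c \<beta> where beta: "0 < r" "0 < c" "\<beta> y = 0" "continuous_on (ball y r) \<beta>"
    "\<And>C x. 0 < C \<Longrightarrow> x \<in> ball y r \<Longrightarrow> sub_at (dual_subeq F) (\<lambda>z. C * \<beta> z) x"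
    "\<And>x. x \<in> closure Om \<Longrightarrow> x \<in> ball y r \<Longrightarrow> \<beta> x \<le> - (c * (norm (x - y))\<^sup>2)"
    using dual_barrier[OF y] has_barrierE by metis
  obtain \<delta> where d: "0 < \<delta>" "\<delta> < r" "S \<inter> cball y \<delta> = {}"
    "\<And>x. x \<in> frontier Om \<Longrightarrow> dist x y \<le> \<delta> \<Longrightarrow> \<bar>\<phi> x - \<phi> y\<bar> < e" using frontier_radius[OF y beta(1) e] by blast
  obtain M where M: "\<And>w x. w \<in> W \<Longrightarrow> x \<in> closure Om \<inter> cball y \<delta> \<Longrightarrow> w x \<le> M" using W_local_bound[OF y d(3)] by metis
  define C where "C = (\<bar>\<phi> y\<bar> + \<bar>M\<bar> + 1) / (c * \<delta>\<^sup>2)"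
  have cd: "0 < c * \<delta>\<^sup>2" using beta d by simp
  have C: "0 < C" "C * (c * \<delta>\<^sup>2) = \<bar>\<phi> y\<bar> + \<bar>M\<bar> + 1"
  proof -
    show "0 < C" unfolding C_def using cd by (intro divide_pos_pos) auto
    show "C * (c * \<delta>\<^sup>2) = \<bar>\<phi> y\<bar> + \<bar>M\<bar> + 1" unfolding C_def using cd by (metis less_irrefl nonzero_eq_divide_eq)
  qed
  have neg: "C * \<beta> x \<le> 0" if "x \<in> closure Om" "x \<in> ball y r" for x
  proof -
    have "0 \<le> c * (norm (x - y))\<^sup>2" using beta(2) by simp
    then have "\<beta> x \<le> 0" using beta(6)[OF that] by linarith
    then show ?thesis using C(1) by (simp add: mult_le_0_iff)
  qed
  define v where "v x = C * \<beta> x + (- \<phi> y - e)" for x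
  have cv: "continuous_on (ball y r) v" unfolding v_def by (intro continuous_intros beta(4))
  show thesis
  proof (rule that[of \<delta> "\<lambda>x. - v x"])
    show "continuous_on (ball y \<delta>) (\<lambda>x. - v x)"
      using d(2) by (intro continuous_intros continuous_on_subset[OF cv]) auto
    fix w x assume w: "w \<in> W" and x: "x \<in> X" "x \<in> ball y \<delta>"
    have bdle: "w z + v z \<le> 0" if "z \<in> frontier Om" "dist y z \<le> \<delta>" for z
      using W_D(3)[OF w that(1)] d(4)[OF that(1)] neg[of z] that d(2) frontier_facts(2)
      unfolding v_def by (auto simp: dist_commute abs_less_iff)
    define U where "U = Om \<inter> ball y \<delta>"
    have U: "open U" "bounded U" unfolding U_def using Om by (auto intro: bounded_Int)
    have clU: "closure U \<subseteq> closure Om \<inter> cball y \<delta>"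
    proof (rule Int_greatest)
      show "closure U \<subseteq> closure Om" by (rule closure_mono) (auto simp: U_def)
      show "closure U \<subseteq> cball y \<delta>" by (rule closure_minimal) (auto simp: U_def)
    qed
    have clX: "closure U \<subseteq> X" "closure U \<subseteq> ball y r" using clU d(2,3) by auto
    have "w x + v x \<le> 0" if xU: "x \<in> U"
    proof (rule comparison[where u=w and v=v, OF F U _ _ _ _ _ xU])
      show "usc (closure U) w" by (rule usc_subset[OF W_D(1)[OF w] clX(1)])
      show "usc (closure U) v" by (intro continuous_imp_usc continuous_on_subset[OF cv clX(2)])
      show "sub_at F w z" if "z \<in> U" for z using that d(3) by (intro W_D(2)[OF w]) (auto simp: U_def)
      show "sub_at (dual_subeq F) v z" if "z \<in> U" for z
        unfolding v_def using that C(1) d(2) by (intro sub_at_add_const beta(5)) (auto simp: U_def)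
      fix z assume "z \<in> frontier U"
      then have z: "z \<in> closure U" "z \<notin> U" using U(1) by (auto simp: frontier_def interior_open)
      have zK: "z \<in> closure Om \<inter> cball y \<delta>" using z clU by blast
      show "w z + v z \<le> 0"
      proof (cases "z \<in> Om")
        case True
        then have dz: "dist y z = \<delta>" using z(2) zK by (auto simp: U_def)
        then have "norm (z - y) = \<delta>" by (simp add: dist_norm norm_minus_commute)
        then have "\<beta> z \<le> - (c * \<delta>\<^sup>2)" using beta(6)[of z] zK dz d(2) by simp
        then have "C * \<beta> z \<le> C * - (c * \<delta>\<^sup>2)" using C(1) by (intro mult_left_mono) auto
        then show ?thesis using M[OF w zK] C(2) e unfolding v_def by simp
      next
        case False
        then have "z \<in> frontier Om" using zK Om(1) by (auto simp: frontier_def interior_open)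
        then show ?thesis using bdle zK by simp
      qed
    qed
    moreover have "x \<in> frontier Om \<or> x \<in> U" using x frontier_facts(4) by (auto simp: U_def)
    ultimately show "w x \<le> - v x" using bdle[of x] x(2) by (auto simp: U_def)
  qed (use d beta(3) in \<open>auto simp: v_def\<close>)
qed

section \<open>Existence and uniqueness of the solution\<close>

definition solution :: "(real^'n \<Rightarrow> real) \<Rightarrow> bool" where
  "solution H \<longleftrightarrow> continuous_on X H \<and> F_harmonic F (Om - S) H \<and> (\<forall>x\<in>frontier Om. H x = \<phi> x) \<and>
     (\<forall>s\<in>S. \<exists>r>0. \<exists>M. \<forall>x\<in>ball s r - {s}. \<bar>H x - Th s * k (x - s)\<bar> \<le> M)"

lemma solution_exists: "\<exists>H. solution H"
proof -
  obtain s0 where s0: "s0 \<in> S" using S(3) by blast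
  obtain C0 where C0: "\<And>w x. w \<in> W \<Longrightarrow> x \<in> X \<Longrightarrow> w x \<le> Th s0 * k (x - s0) + C0" using W_upper_bound[OF s0] by blast
  have W0: "W \<noteq> {}" using b_in_W by blast
  \<comment> \<open>The supremum itself need not be semicontinuous. Its upper envelope
    \<open>H\<close>, taken over \<open>X\<close> with the frontier included, turns out to belong to
    \<open>W\<close> again.\<close>
  define h where "h x = (SUP w\<in>W. w x)" for x
  have bdd: "bdd_above ((\<lambda>w. w x) ` W)" if "x \<in> X" for x
    by (rule bdd_aboveI2[of _ _ "Th s0 * k (x - s0) + C0"]) (use C0 that in blast)
  have up: "w x \<le> h x" if "w \<in> W" "x \<in> X" for w x unfolding h_def by (rule cSUP_upper[OF that(1) bdd[OF that(2)]])
  have least: "h x \<le> c" if "\<And>w. w \<in> W \<Longrightarrow> w x \<le> c" for x c unfolding h_def by (rule cSUP_least[OF W0 that])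
  have locb: "\<exists>d>0. \<exists>c. \<forall>y\<in>X. dist y x < d \<longrightarrow> h y \<le> c" if x: "x \<in> X" for x
  proof -
    have "x \<in> - {s0}" using x s0 by auto
    then have "isCont (\<lambda>y. k (y - s0)) x" using k_shift_cont[of s0] by (simp add: continuous_on_eq_continuous_at open_Compl)
    then obtain d where d: "0 < d" "\<And>y. dist y x < d \<Longrightarrow> dist (k (y - s0)) (k (x - s0)) < 1"
      unfolding continuous_at_eps_delta using zero_less_one by blast
    have "h y \<le> Th s0 * (k (x - s0) + 1) + C0" if y: "y \<in> X" "dist y x < d" for y
    proof -
      have "k (y - s0) \<le> k (x - s0) + 1" using d(2)[OF y(2)] by (auto simp: dist_real_def)
      then have "Th s0 * k (y - s0) \<le> Th s0 * (k (x - s0) + 1)" using Th[OF s0] by (intro mult_left_mono) auto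
      then show ?thesis using C0[OF _ y(1)] by (intro least) (meson add_right_mono order_trans)
    qed
    then show ?thesis using d(1) by blast
  qed
  obtain H where H: "\<And>x. x \<in> X \<Longrightarrow> h x \<le> H x" "usc X H"
    "\<And>x c d. x \<in> X \<Longrightarrow> 0 < d \<Longrightarrow> (\<And>y. y \<in> X \<Longrightarrow> dist y x < d \<Longrightarrow> h y \<le> c) \<Longrightarrow> H x \<le> c"
    using usc_envelope[OF locb] by blast
  have WH: "w x \<le> H x" if "w \<in> W" "x \<in> X" for w x using up[OF that] H(1)[OF that(2)] by simp
  have HW: "H \<in> W" unfolding W_def
  proof (intro CollectI conjI ballI)
    show "usc X H" by (rule H(2))
  next
    fix x assume x: "x \<in> Om - S"
    show "sub_at F H x"
    proof (rule sub_at_envelope[OF F open_diff x diff_subset W0])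
      show "H x \<le> c" if "0 < d" "\<And>y w. y \<in> X \<Longrightarrow> dist y x < d \<Longrightarrow> w \<in> W \<Longrightarrow> w y \<le> c" for c d
        by (rule H(3)[OF _ that(1)]) (use x diff_subset in blast, use that(2) in \<open>auto intro: least\<close>)
    qed (use W_D WH in auto)
  next
    fix x assume x: "x \<in> frontier Om"
    show "H x \<le> \<phi> x"
    proof (rule field_le_epsilon)
      fix e :: real assume e: "0 < e"
      obtain \<delta> \<beta> where b: "0 < \<delta>" "continuous_on (ball x \<delta>) \<beta>" "\<beta> x = \<phi> x + e"
        "\<And>w y. w \<in> W \<Longrightarrow> y \<in> X \<Longrightarrow> y \<in> ball x \<delta> \<Longrightarrow> w y \<le> \<beta> y" using upper_barrier[OF x e] by blast
      have "H x \<le> \<beta> x"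
      proof (rule envelope_le_continuous[where f=h and X=X and U="ball x \<delta>"])
        show "continuous_on (X \<inter> ball x \<delta>) \<beta>" by (rule continuous_on_subset[OF b(2)]) auto
        show "x \<in> X" using x frontier_facts(2) by blast
        show "h y \<le> \<beta> y" if "y \<in> X" "y \<in> ball x \<delta>" for y using b(4) that by (intro least) auto
      qed (use H(3) b(1) in auto)
      then show "H x \<le> \<phi> x + e" using b(3) by simp
    qed
  next
    fix s assume s: "s \<in> S"
    obtain C where C: "\<And>w x. w \<in> W \<Longrightarrow> x \<in> X \<Longrightarrow> w x \<le> Th s * k (x - s) + C" using W_upper_bound[OF s] by blast
    have le: "H x \<le> Th s * k (x - s) + C" if x: "x \<in> X" for x
    proof (rule envelope_le_continuous[where f=h and X=X and U=UNIV and h="\<lambda>x. Th s * k (x - s) + C"])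
      show "continuous_on (X \<inter> UNIV) (\<lambda>x. Th s * k (x - s) + C)"
        by (intro continuous_intros continuous_on_subset[OF k_shift_cont]) (use s in auto)
      show "h y \<le> Th s * k (y - s) + C" if "y \<in> X" for y using C that by (intro least) auto
    qed (use H(3) x in auto)
    obtain r where r: "0 < r" "ball s r \<subseteq> - (S - {s}) \<inter> Om"
    proof -
      have "open (- (S - {s}) \<inter> Om)" by (intro open_Int open_Compl finite_imp_closed finite_Diff S(1) Om(1))
      moreover have "s \<in> - (S - {s}) \<inter> Om" using s S(2) by auto
      ultimately show thesis using that open_contains_ball by blast
    qed
    have "x \<in> X" if "x \<in> ball s r - {s}" for x using that r(2) diff_subset by blast
    then show "\<exists>r>0. \<exists>M. \<forall>x\<in>ball s r - {s}. H x \<le> Th s * k (x - s) + M" using r(1) le by blast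
  qed
  have bH: "b x \<le> H x" if "x \<in> X" for x by (rule WH[OF b_in_W that])
  have locb': "\<exists>d>0. \<exists>c. \<forall>y\<in>X. dist y x < d \<longrightarrow> - H y \<le> c" if x: "x \<in> X" for x
  proof -
    obtain d where "0 < d" "\<And>y. y \<in> X \<Longrightarrow> dist y x < d \<Longrightarrow> dist (b y) (b x) < 1"
      using b_cont x unfolding continuous_on_iff by (metis zero_less_one)
    then have "\<forall>y\<in>X. dist y x < d \<longrightarrow> - H y \<le> 1 - b x" using bH by (force simp: dist_real_def)
    then show ?thesis using \<open>0 < d\<close> by blast
  qed
  \<comment> \<open>\<open>- G\<close> is the lower envelope of \<open>H\<close>. Continuity and
    dual subharmonicity of \<open>- H\<close> both follow once \<open>H = - G\<close> is
    known.\<close>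
  obtain G where G: "\<And>x. x \<in> X \<Longrightarrow> - H x \<le> G x" "usc X G"
    "\<And>x c d. x \<in> X \<Longrightarrow> 0 < d \<Longrightarrow> (\<And>y. y \<in> X \<Longrightarrow> dist y x < d \<Longrightarrow> - H y \<le> c) \<Longrightarrow> G x \<le> c"
    using usc_envelope[of X "\<lambda>x. - H x", OF locb'] by blast
  have Gb: "G x \<le> - b x" if x: "x \<in> X" for x
  proof (rule envelope_le_continuous[where f="\<lambda>x. - H x" and X=X and U=UNIV and h="\<lambda>x. - b x"])
    show "continuous_on (X \<inter> UNIV) (\<lambda>x. - b x)" using b_cont by (auto intro: continuous_intros)
  qed (use G(3) x bH in auto)
  have Gphi: "G x \<le> - \<phi> x" if x: "x \<in> frontier Om" for x
  proof (rule field_le_epsilon)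
    fix e :: real assume e: "0 < e"
    obtain w \<delta> \<beta> where b: "w \<in> W" "0 < \<delta>" "continuous_on (ball x \<delta>) \<beta>" "\<beta> x = \<phi> x - e"
        "\<And>y. y \<in> ball x \<delta> \<Longrightarrow> \<beta> y \<le> w y" using lower_barrier[OF x e] by blast
    have "G x \<le> - \<beta> x"
    proof (rule envelope_le_continuous[where f="\<lambda>x. - H x" and X=X and U="ball x \<delta>" and h="\<lambda>x. - \<beta> x"])
      show "continuous_on (X \<inter> ball x \<delta>) (\<lambda>x. - \<beta> x)" by (intro continuous_intros continuous_on_subset[OF b(3)]) auto
      show "x \<in> X" using x frontier_facts(2) by blast
      show "- H y \<le> - \<beta> y" if "y \<in> X" "y \<in> ball x \<delta>" for y using WH[OF b(1) that(1)] b(5)[OF that(2)] by simp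
    qed (use G(3) b(2) in auto)
    then show "G x \<le> - \<phi> x + e" using b(4) by simp
  qed
  \<comment> \<open>The bump argument. If a test Hessian \<open>A\<close> of \<open>G\<close> at
    \<open>x\<close> were outside the dual, \<open>- A\<close> would be interior to
    \<open>F\<close>, and \<open>- psi\<close> minus a small quadratic plus a constant would be
    subharmonic near \<open>x\<close>. Pasted into \<open>H\<close> it stays in the family, yet it
    lifts \<open>- G\<close> by that constant at \<open>x\<close>.\<close>
  have Gsub: "sub_at (dual_subeq F) G x" if x: "x \<in> Om - S" for x
    unfolding sub_at_def
  proof (intro allI impI, elim conjE exE)
    fix psi A r1 assume psi: "C2_hessian_at psi x A" and eq: "G x = psi x" and r1: "0 < r1" "\<forall>y\<in>ball x r1. G y \<le> psi y"
    show "A \<in> dual_subeq F"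
    proof (rule ccontr)
      assume "A \<notin> dual_subeq F"
      moreover have "A \<in> Sym" using C2_hessian_symmetric[OF psi] by (simp add: Sym_iff)
      ultimately have int: "- A \<in> sym_interior F" by (simp add: dual_subeq_def)
      obtain e where e: "0 < e" "\<And>B. B \<in> Sym \<Longrightarrow> dist B (- A) < e \<Longrightarrow> B \<in> sym_interior F"
        using sym_interior_open[OF int] by metis
      obtain r2 gr K where K: "0 < r2" "K x = A" "continuous_on (ball x r2) K"
        "\<And>y. y \<in> ball x r2 \<Longrightarrow> (psi has_derivative (\<lambda>h. gr y \<bullet> h)) (at y)"
        "\<And>y. y \<in> ball x r2 \<Longrightarrow> C2_hessian_at psi y (K y)"
        using C2_hessian_at_nearby[OF psi] by metis
      obtain r3 where r3: "0 < r3" "ball x r3 \<subseteq> Om - S" using open_diff x open_contains_ball by blast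
      have "isCont K x" using K(1,3) by (simp add: continuous_on_eq_continuous_at)
      then obtain r4 where r4: "0 < r4" "\<And>y. dist y x < r4 \<Longrightarrow> dist (K y) A < e / 2"
        unfolding continuous_at_eps_delta K(2) using e(1) by (metis half_gt_zero)
      define \<delta> where "\<delta> = min (min r1 r2) (min r3 r4) / 2"
      have d0: "0 < \<delta>" using r1 K(1) r3 r4 by (simp add: \<delta>_def)
      have "2 * \<delta> \<le> r1" "2 * \<delta> \<le> r2" "2 * \<delta> \<le> r3" "2 * \<delta> \<le> r4" by (auto simp: \<delta>_def)
      then have d: "0 < \<delta>" "\<delta> < r1" "\<delta> < r2" "\<delta> < r3" "\<delta> < r4" using d0 by linarith+
      obtain c where c: "0 < c" "norm ((2 * c) *\<^sub>R mat 1 :: real^'n^'n) \<le> e / 2" using mat_1_perturbation[OF e(1)] by blast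
      define q where "q y = - c * (norm (y - x))\<^sup>2" for y
      \<comment> \<open>Balanced so that \<open>q + \<eta>\<close> is nonpositive from radius
        \<open>\<delta> / 2\<close> on and equals \<open>\<eta>\<close> at \<open>x\<close>.\<close>
      define \<eta> where "\<eta> = c * (\<delta> / 2)\<^sup>2"
      have eta: "0 < \<eta>" using c d by (simp add: \<eta>_def)
      define bump where "bump y = - psi y + q y + \<eta>" for y
      have qC: "C2_hessian_at q z ((- 2 * c) *\<^sub>R mat 1)" for z
      proof -
        have t: "transpose ((- 2 * c) *\<^sub>R mat 1 :: real^'n^'n) = (- 2 * c) *\<^sub>R mat 1" by (simp only: transpose_linear transpose_mat)
        have "q = (\<lambda>y. 0 + (0 \<bullet> (y - x) + (y - x) \<bullet> (((- 2 * c) *\<^sub>R mat 1) *v (y - x)) / 2))"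
          by (simp only: q_def fun_eq_iff scaleR_matrix_vector_assoc[symmetric]) (simp add: power2_norm_eq_inner)
        then show ?thesis using C2_hessian_at_quadratic[OF t, of 0 0 x z] by simp
      qed
      have chiC: "C2_hessian_at bump y (- K y + (- 2 * c) *\<^sub>R mat 1 + 0)" if "y \<in> ball x \<delta>" for y
        unfolding bump_def[abs_def] using that d by (intro C2_hessian_at_add C2_hessian_at_minus K(5) qC C2_hessian_at_const) auto
      have chiF: "sub_at F bump y" if y: "y \<in> ball x \<delta>" for y
      proof (rule sub_at_smooth[OF F chiC[OF y]])
        have "- K y + (- 2 * c) *\<^sub>R mat 1 + 0 \<in> Sym" using C2_hessian_symmetric[OF chiC[OF y]] by (simp add: Sym_iff)
        moreover have "dist (- K y + (- 2 * c) *\<^sub>R mat 1 + 0) (- A) < e"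
        proof -
          have "dist (- K y + (- 2 * c) *\<^sub>R mat 1 + 0) (- A) = norm ((A - K y) - (2 * c) *\<^sub>R mat 1)" by (simp add: dist_norm algebra_simps)
          also have "\<dots> \<le> norm (A - K y) + norm ((2 * c) *\<^sub>R mat 1 :: real^'n^'n)" by (rule norm_triangle_ineq4)
          also note c(2)
          also have "norm (A - K y) < e / 2" using r4(2)[of y] y d by (simp add: dist_norm norm_minus_commute dist_commute)
          finally show ?thesis by simp
        qed
        ultimately show "- K y + (- 2 * c) *\<^sub>R mat 1 + 0 \<in> F" using e(2) sym_interior_subset by blast
      qed
      have cont: "isCont bump y" if "y \<in> ball x r2" for y
        unfolding bump_def q_def using has_derivative_continuous[OF K(4)[OF that]] by (intro continuous_intros)
      let ?w = "\<lambda>y. if dist x y < \<delta> then max (H y) (bump y) else H y"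
      have "?w \<in> W"
      proof (rule glue_in_W[OF HW, of _ _ _ "\<delta> / 2"])
        show "continuous_on (ball x \<delta>) bump" using cont d by (intro continuous_at_imp_continuous_on) auto
        have "cball x \<delta> \<subseteq> ball x r3" using d by auto
        then have sub: "cball x \<delta> \<subseteq> Om - S" using r3(2) by blast
        show "S \<inter> cball x \<delta> = {}" using sub by blast
        show "bump y \<le> \<phi> y" if "y \<in> frontier Om" "y \<in> ball x \<delta>" for y
        proof -
          have "y \<in> cball x \<delta>" using that(2) by simp
          then show ?thesis using sub that(1) frontier_facts(3) by blast
        qed
        fix y assume y: "y \<in> X" "\<delta> / 2 \<le> dist x y" "dist x y < \<delta>"
        have "(\<delta> / 2)\<^sup>2 \<le> (norm (y - x))\<^sup>2" using y d by (intro power_mono) (auto simp: dist_norm norm_minus_commute)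
        then have "q y + \<eta> \<le> 0" using c(1) by (simp add: q_def \<eta>_def)
        moreover have "G y \<le> psi y" using r1(2) y d by auto
        ultimately show "bump y \<le> H y" using G(1)[OF y(1)] by (simp add: bump_def)
      qed (use d chiF in auto)
      then have wH: "bump y \<le> H y" if "y \<in> X" "dist x y < \<delta>" for y using WH[of ?w y] that by simp
      have xX: "x \<in> X" using x diff_subset by blast
      have "G x \<le> - bump x"
      proof (rule envelope_le_continuous[where f="\<lambda>x. - H x" and X=X and U="ball x \<delta>" and h="\<lambda>x. - bump x"])
        show "continuous_on (X \<inter> ball x \<delta>) (\<lambda>x. - bump x)"
          using cont d by (intro continuous_intros continuous_at_imp_continuous_on) auto
        show "- H y \<le> - bump y" if "y \<in> X" "y \<in> ball x \<delta>" for y using wH that by simp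
      qed (use G(3) d xX in auto)
      then show False using eq eta by (simp add: bump_def q_def)
    qed
  qed
  have Gpole: "\<exists>r>0. \<exists>M. \<forall>x\<in>ball s r - {s}. G x \<le> - (Th s * k (x - s)) + M" and
    Hpole: "\<exists>r>0. \<exists>M. \<forall>x\<in>ball s r - {s}. \<bar>H x - Th s * k (x - s)\<bar> \<le> M" if s: "s \<in> S" for s
  proof -
    obtain r1 M1 where 1: "0 < r1" "\<And>x. x \<in> ball s r1 - {s} \<Longrightarrow> \<bar>b x - Th s * k (x - s)\<bar> \<le> M1" using b_pole[OF s] by blast
    obtain r2 M2 where 2: "0 < r2" "\<And>x. x \<in> ball s r2 - {s} \<Longrightarrow> H x \<le> Th s * k (x - s) + M2" using W_D(4)[OF HW s] by blast
    have "open (- (S - {s}) \<inter> Om)" by (intro open_Int open_Compl finite_imp_closed finite_Diff S(1) Om(1))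
    moreover have "s \<in> - (S - {s}) \<inter> Om" using s S(2) by auto
    ultimately obtain r3 where 3: "0 < r3" "ball s r3 \<subseteq> - (S - {s}) \<inter> Om" using open_contains_ball by blast
    have inX: "x \<in> X" if "x \<in> ball s r3 - {s}" for x using that 3(2) diff_subset by blast
    have a: "G x \<le> - (Th s * k (x - s)) + M1" if "x \<in> ball s (min r1 (min r2 r3)) - {s}" for x
      using Gb[OF inX, of x] 1(2)[of x] that by (auto simp: abs_le_iff)
    have c: "\<bar>H x - Th s * k (x - s)\<bar> \<le> max M1 M2" if x: "x \<in> ball s (min r1 (min r2 r3)) - {s}" for x
    proof -
      have "b x \<le> H x" using x by (intro bH inX) auto
      moreover have "\<bar>b x - Th s * k (x - s)\<bar> \<le> M1" "H x \<le> Th s * k (x - s) + M2" using 1(2)[of x] 2(2)[of x] x by auto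
      ultimately show ?thesis by linarith
    qed
    have p: "0 < min r1 (min r2 r3)" using 1 2 3 by simp
    show "\<exists>r>0. \<exists>M. \<forall>x\<in>ball s r - {s}. G x \<le> - (Th s * k (x - s)) + M" using p a by blast
    show "\<exists>r>0. \<exists>M. \<forall>x\<in>ball s r - {s}. \<bar>H x - Th s * k (x - s)\<bar> \<le> M" using p c by blast
  qed
  \<comment> \<open>\<open>H\<close> and \<open>G\<close> are comparable: the barriers give opposite
    bounds on the frontier; at the poles the bound for \<open>H\<close> comes from
    \<open>W_upper_bound\<close> and the one for \<open>G\<close> from \<open>b\<close>.\<close>
  have HG: "H x = - G x" if x: "x \<in> Om - S" for x
  proof -
    have "H x + G x \<le> 0"
    proof (rule poles_comparison[where u=H and v=G, OF _ _ G(2) _ _ _ _ x])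
      show "usc X H" by (rule W_D(1)[OF HW])
      show "sub_at F H x" if "x \<in> Om - S" for x using that by (rule W_D(2)[OF HW])
      show "\<exists>r>0. \<exists>M. \<forall>x\<in>ball s r - {s}. H x \<le> Th s * k (x - s) + M" if "s \<in> S" for s
        using that by (rule W_D(4)[OF HW])
      show "H x + G x \<le> 0" if "x \<in> frontier Om" for x using W_D(3)[OF HW that] Gphi[OF that] by simp
    qed (use Gsub Gpole in auto)
    then show ?thesis using G(1)[of x] x diff_subset by force
  qed
  have HG': "H x = - G x \<and> H x = \<phi> x" if x: "x \<in> frontier Om" for x
  proof -
    have "- H x \<le> G x" using x frontier_facts(2) by (intro G(1)) auto
    then show ?thesis using W_D(3)[OF HW x] Gphi[OF x] by linarith
  qed
  have HGX: "- H x = G x" if "x \<in> X" for x using HG HG' that frontier_facts(4) by force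
  have usc': "usc X (\<lambda>x. - H x)"
    unfolding usc_def
  proof (intro ballI allI impI)
    fix x c assume x: "x \<in> X" "- H x < c"
    then have "\<forall>\<^sub>F y in at x within X. G y < c" using G(2) HGX by (auto simp: usc_def)
    moreover have "\<forall>\<^sub>F y in at x within X. y \<in> X" by (simp add: eventually_at_filter)
    ultimately show "\<forall>\<^sub>F y in at x within X. - H y < c" by eventually_elim (use HGX in auto)
  qed
  have cH: "continuous_on X H" by (rule usc_imp_continuous[OF H(2) usc'])
  have dualH: "sub_at (dual_subeq F) (\<lambda>x. - H x) x" if x: "x \<in> Om - S" for x
  proof -
    obtain r where "0 < r" "ball x r \<subseteq> Om - S" using open_diff x open_contains_ball by blast
    then show ?thesis
      by (intro sub_at_lower[OF Gsub[OF x], of r]) (use HGX diff_subset x in \<open>auto simp: subset_iff\<close>)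
  qed
  have "F_harmonic F (Om - S) H"
    unfolding F_harmonic_def F_subharmonic_iff[OF open_diff]
    using continuous_on_subset[OF cH diff_subset] usc_subset[OF H(2) diff_subset] usc_subset[OF usc' diff_subset] W_D(2)[OF HW] dualH
    by blast
  moreover have "\<forall>x\<in>frontier Om. H x = \<phi> x" using HG' by blast
  moreover have "\<forall>s\<in>S. \<exists>r>0. \<exists>M. \<forall>x\<in>ball s r - {s}. \<bar>H x - Th s * k (x - s)\<bar> \<le> M" using Hpole by blast
  ultimately have "solution H" using cH unfolding solution_def by blast
  then show ?thesis by blast
qed

lemma solution_le:
  assumes H: "solution H" and H': "solution H'" and x: "x \<in> X"
  shows "H x \<le> H' x"
proof (cases "x \<in> frontier Om")
  case True
  then show ?thesis using H H' by (simp add: solution_def)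
next
  case False
  then have x: "x \<in> Om - S" using x frontier_facts(4) by blast
  have "H x + - H' x \<le> 0"
  proof (rule poles_comparison[where u=H and v="\<lambda>x. - H' x", OF _ _ _ _ _ _ _ x])
    show "usc X H" "usc X (\<lambda>x. - H' x)" using H H' by (auto simp: solution_def intro!: continuous_imp_usc continuous_intros)
    show "sub_at F H x" "sub_at (dual_subeq F) (\<lambda>x. - H' x) x" if "x \<in> Om - S" for x
      using H H' that unfolding solution_def F_harmonic_def F_subharmonic_iff[OF open_diff] by auto
    show "H x + - H' x \<le> 0" if "x \<in> frontier Om" for x using H H' that by (simp add: solution_def)
    fix s assume s: "s \<in> S"
    obtain r M where 1: "0 < r" "\<And>x. x \<in> ball s r - {s} \<Longrightarrow> \<bar>H x - Th s * k (x - s)\<bar> \<le> M" using H s unfolding solution_def by blast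
    then have "H x \<le> Th s * k (x - s) + M" if "x \<in> ball s r - {s}" for x using that by (force simp: abs_le_iff)
    then show "\<exists>r>0. \<exists>M. \<forall>x\<in>ball s r - {s}. H x \<le> Th s * k (x - s) + M" using 1(1) by blast
    obtain r' M' where 2: "0 < r'" "\<And>x. x \<in> ball s r' - {s} \<Longrightarrow> \<bar>H' x - Th s * k (x - s)\<bar> \<le> M'" using H' s unfolding solution_def by blast
    then have "- H' x \<le> - (Th s * k (x - s)) + M'" if "x \<in> ball s r' - {s}" for x using that by (force simp: abs_le_iff)
    then show "\<exists>r>0. \<exists>M. \<forall>x\<in>ball s r - {s}. - H' x \<le> - (Th s * k (x - s)) + M" using 2(1) by blast
  qed
  then show ?thesis by simp
qed

theorem solution_exists_unique: "\<exists>H. solution H \<and> (\<forall>H'. solution H' \<longrightarrow> (\<forall>x\<in>X. H' x = H x))"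
  using solution_exists solution_le by (meson antisym)

end

section \<open>Riesz kernels and boundary barriers\<close>

lemma proj_line_mult: "proj_line y *v h = (y \<bullet> h) *\<^sub>R y"
  by (simp add: proj_line_def matrix_vector_mult_def inner_vec_def vec_eq_iff sum_distrib_left sum_distrib_right mult_ac)

lemma proj_line_scaleR: "proj_line (c *\<^sub>R y) = c\<^sup>2 *\<^sub>R proj_line y"
  by (simp add: proj_line_def vec_eq_iff power2_eq_square)

lemma proj_line_Sym: "proj_line e \<in> Sym"
  by (simp add: Sym_def transpose_def proj_line_def vec_eq_iff mult.commute)

lemma continuous_on_proj_line:
  assumes "continuous_on U g"
  shows "continuous_on U (\<lambda>x. proj_line (g x))"
  unfolding proj_line_def by (intro continuous_intros assms)

lemma sym_interior_scaleR:
  fixes F :: "(real^'n^'n) set"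
  assumes F: "cone_subequation F" and A: "A \<in> sym_interior F" and t: "0 < t"
  shows "t *\<^sub>R A \<in> sym_interior F"
proof -
  obtain e where e: "0 < e" "\<And>B. B \<in> Sym \<Longrightarrow> dist B A < e \<Longrightarrow> B \<in> F" and AS: "A \<in> Sym"
    using A by (auto simp: sym_interior_def)
  have "B \<in> F" if B: "B \<in> Sym" "dist B (t *\<^sub>R A) < t * e" for B
  proof -
    have "dist ((1 / t) *\<^sub>R B) A = (1 / t) * dist B (t *\<^sub>R A)"
    proof -
      have "(1 / t) *\<^sub>R B - A = (1 / t) *\<^sub>R (B - t *\<^sub>R A)" using t by (simp add: scaleR_diff_right)
      then show ?thesis using t by (simp add: dist_norm)
    qed
    also have "\<dots> < e" using B(2) t by (simp add: pos_divide_less_eq mult.commute)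
    finally have "(1 / t) *\<^sub>R B \<in> F" using B(1) by (intro e(2) Sym_intros) auto
    then have "t *\<^sub>R ((1 / t) *\<^sub>R B) \<in> F" using F t unfolding cone_subequation_def by blast
    then show ?thesis using t by simp
  qed
  then show ?thesis using AS e(1) t unfolding sym_interior_def by (auto intro!: Sym_intros exI[of _ "t * e"])
qed

lemma cone_scaleR:
  assumes "cone_subequation F" "A \<in> F" "0 < t"
  shows "t *\<^sub>R A \<in> F"
  using assms unfolding cone_subequation_def by blast

lemma dual_scaleR:
  fixes F :: "(real^'n^'n) set"
  assumes F: "cone_subequation F" and A: "A \<in> dual_subeq F" and t: "0 < t"
  shows "t *\<^sub>R A \<in> dual_subeq F"
proof -
  have "- A \<in> sym_interior F" if "- (t *\<^sub>R A) \<in> sym_interior F"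
    using sym_interior_scaleR[OF F that, of "1 / t"] t by simp
  then show ?thesis using A by (auto simp: dual_subeq_def Sym_intros)
qed

lemma cone_convex_add:
  assumes F: "cone_subequation F" "convex F" and A: "A \<in> F" "B \<in> F"
  shows "A + B \<in> F"
proof -
  have "(1/2) *\<^sub>R A + (1/2) *\<^sub>R B \<in> F" using F(2) A by (intro convexD) auto
  then have "2 *\<^sub>R ((1/2) *\<^sub>R A + (1/2) *\<^sub>R B) \<in> F" by (intro cone_scaleR[OF F(1)]) auto
  then show ?thesis by (simp add: scaleR_add_right)
qed

lemma norm_powr_eq: "norm y powr q = (y \<bullet> y) powr (q / 2)"
  by (cases "y = 0") (simp_all add: power2_norm_eq_inner[symmetric] powr_powr[symmetric] powr_numeral[symmetric] powr_powr del: powr_numeral)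

lemma has_derivative_norm_sq: "((\<lambda>y. y \<bullet> y) has_derivative (\<lambda>h. 2 * (y \<bullet> h))) (at (y::'a::real_inner))"
  by (auto intro!: derivative_eq_intros simp: inner_commute)

lemma has_derivative_norm_powr:
  fixes y :: "'a::real_inner"
  assumes "y \<noteq> 0"
  shows "((\<lambda>y. norm y powr q) has_derivative (\<lambda>h. q * norm y powr (q - 2) * (y \<bullet> h))) (at y)"
proof -
  have "((\<lambda>t. t powr (q / 2)) has_real_derivative (q / 2 * (y \<bullet> y) powr (q / 2 - 1))) (at (y \<bullet> y))"
    using assms by (intro has_real_derivative_powr) simp
  from DERIV_compose_FDERIV[OF this has_derivative_norm_sq] show ?thesis
    unfolding norm_powr_eq by (simp add: diff_divide_distrib mult_ac)
qed

lemma has_derivative_ln_norm: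
  fixes y :: "'a::real_inner"
  assumes "y \<noteq> 0"
  shows "((\<lambda>y. ln (norm y)) has_derivative (\<lambda>h. norm y powr - 2 * (y \<bullet> h))) (at y)"
proof -
  have "((\<lambda>t. ln t / 2) has_real_derivative (1 / (y \<bullet> y) / 2)) (at (y \<bullet> y))"
    using assms by (auto intro!: derivative_eq_intros simp: divide_simps)
  from DERIV_compose_FDERIV[OF this has_derivative_norm_sq]
  have "((\<lambda>y. ln (y \<bullet> y) / 2) has_derivative (\<lambda>h. 2 * (y \<bullet> h) * (1 / (y \<bullet> y) / 2))) (at y)" .
  moreover have "ln (y \<bullet> y) / 2 = ln (norm y)" for y :: 'a
    by (cases "y = 0") (simp_all add: power2_norm_eq_inner[symmetric] ln_realpow)
  moreover have "2 * (y \<bullet> h) * (1 / (y \<bullet> y) / 2) = norm y powr - 2 * (y \<bullet> h)" for h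
    using assms by (simp add: norm_powr_eq powr_minus divide_simps)
  ultimately show ?thesis by simp
qed

text \<open>The normalisation of the kernel gives the logarithm and the powers the same form of
  gradient, so second derivatives need no case distinction.\<close>

lemma has_derivative_riesz_kernel:
  assumes p: "2 \<le> p" and y: "y \<noteq> 0"
  shows "(riesz_kernel p has_derivative (\<lambda>h. (norm y powr - p *\<^sub>R y) \<bullet> h)) (at y)"
proof (cases "p = 2")
  case True
  then show ?thesis using has_derivative_ln_norm[OF y] by (simp add: riesz_kernel_def[abs_def])
next
  case False
  have "((\<lambda>y. - (1 / (p - 2)) * norm y powr (2 - p)) has_derivative
     (\<lambda>h. - (1 / (p - 2)) * ((2 - p) * norm y powr (2 - p - 2) * (y \<bullet> h)))) (at y)"
    by (intro has_derivative_mult_right has_derivative_norm_powr y)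
  moreover have "- (1 / (p - 2)) * ((2 - p) * norm y powr (2 - p - 2) * (y \<bullet> h)) = (norm y powr - p *\<^sub>R y) \<bullet> h" for h
  proof -
    have "- (1 / (p - 2)) * (2 - p) = 1" using False by (simp add: field_simps)
    then show ?thesis by (simp add: mult.assoc[symmetric])
  qed
  ultimately show ?thesis using False by (simp add: riesz_kernel_def[abs_def])
qed

text \<open>Up to the factor \<open>norm x powr - p\<close>, the derivative of the gradient is the
  identity minus \<open>p\<close> times the radial projection, which is the matrix of
  \<open>finite_riesz_char\<close>.\<close>

lemma riesz_kernel_hessian:
  fixes x :: "real^'n"
  assumes p: "2 \<le> p" and x: "x \<noteq> 0"
  shows "C2_hessian_at (riesz_kernel p) x
    (norm x powr - p *\<^sub>R (proj_perp (x /\<^sub>R norm x) - (p - 1) *\<^sub>R proj_line (x /\<^sub>R norm x)))"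
proof -
  define H where "H y = norm y powr - p *\<^sub>R mat 1 - (p * norm y powr (- p - 2)) *\<^sub>R proj_line y" for y :: "real^'n"
  have n0: "y \<noteq> 0" if "y \<in> ball x (norm x)" for y using that by auto
  have "C2_hessian_at (riesz_kernel p) x (H x)"
    unfolding C2_hessian_at_def
  proof (rule exI[of _ "norm x"], intro conjI exI[of _ "\<lambda>y. norm y powr - p *\<^sub>R y"] exI[of _ H] ballI)
    show "continuous_on (ball x (norm x)) H"
      unfolding H_def by (intro continuous_intros continuous_on_proj_line) (use n0 in auto)
    fix y assume y: "y \<in> ball x (norm x)"
    show "(riesz_kernel p has_derivative (\<lambda>h. (norm y powr - p *\<^sub>R y) \<bullet> h)) (at y)"
      by (rule has_derivative_riesz_kernel[OF p n0[OF y]])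
    have "((\<lambda>y. norm y powr - p *\<^sub>R y) has_derivative
       (\<lambda>h. norm y powr - p *\<^sub>R h + (- p * norm y powr (- p - 2) * (y \<bullet> h)) *\<^sub>R y)) (at y)"
      by (intro has_derivative_scaleR has_derivative_norm_powr n0[OF y] has_derivative_ident)
    then show "((\<lambda>y. norm y powr - p *\<^sub>R y) has_derivative (\<lambda>h. H y *v h)) (at y)"
      by (simp add: H_def matrix_vector_mult_diff_rdistrib scaleR_matrix_vector_assoc[symmetric] proj_line_mult)
  qed (use x in auto)
  moreover have "H x = norm x powr - p *\<^sub>R (proj_perp (x /\<^sub>R norm x) - (p - 1) *\<^sub>R proj_line (x /\<^sub>R norm x))"
  proof -
    have "norm x powr (- p - 2) = norm x powr - p * (inverse (norm x))\<^sup>2"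
      using x by (simp add: powr_diff divide_inverse power_inverse)
    moreover have "N *\<^sub>R M - (p * (N * q)) *\<^sub>R B = N *\<^sub>R (M - q *\<^sub>R B - (p - 1) *\<^sub>R (q *\<^sub>R B))"
      for N q and M B :: "real^'n^'n" by (simp add: algebra_simps)
    ultimately show ?thesis unfolding H_def proj_perp_def proj_line_scaleR by simp
  qed
  ultimately show ?thesis by simp
qed

lemma C2_hessian_at_shift:
  assumes "C2_hessian_at phi (x - s) A"
  shows "C2_hessian_at (\<lambda>y. phi (y - s)) x A"
proof -
  obtain r g H where 1: "0 < r" "H (x - s) = A" "continuous_on (ball (x - s) r) H"
    "\<And>y. y \<in> ball (x - s) r \<Longrightarrow> (phi has_derivative (\<lambda>h. g y \<bullet> h)) (at y)"
    "\<And>y. y \<in> ball (x - s) r \<Longrightarrow> (g has_derivative (\<lambda>h. H y *v h)) (at y)"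
    using C2_hessian_at_nearby[OF assms] by metis
  have b: "y - s \<in> ball (x - s) r" if "y \<in> ball x r" for y using that by (simp add: dist_norm)
  have id: "((\<lambda>y. y - s) has_derivative (\<lambda>h. h)) (at y)" for y by (auto intro!: derivative_eq_intros)
  show ?thesis unfolding C2_hessian_at_def
  proof (rule exI[of _ r], intro conjI exI[of _ "\<lambda>y. g (y - s)"] exI[of _ "\<lambda>y. H (y - s)"] ballI)
    show "continuous_on (ball x r) (\<lambda>y. H (y - s))"
      by (rule continuous_on_compose2[OF 1(3)]) (use b in \<open>auto intro!: continuous_intros\<close>)
    fix y assume y: "y \<in> ball x r"
    show "((\<lambda>y. phi (y - s)) has_derivative (\<lambda>h. g (y - s) \<bullet> h)) (at y)"
      using has_derivative_compose[OF id 1(4)[OF b[OF y]]] by simp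
    show "((\<lambda>y. g (y - s)) has_derivative (\<lambda>h. H (y - s) *v h)) (at y)"
      using has_derivative_compose[OF id 1(5)[OF b[OF y]]] by simp
  qed (use 1 in auto)
qed

text \<open>A boundary matrix belongs to the closed set \<open>F\<close> but not to its interior,
  and the latter says that its negative is in the dual. Both memberships survive positive
  scaling.\<close>

lemma riesz_kernel_in_cone:
  fixes F :: "(real^'n^'n) set"
  assumes F: "cone_subequation F" and riesz: "finite_riesz_char F p" and p: "2 \<le> p" and x: "x \<noteq> s" and t: "0 < t"
  obtains B where "C2_hessian_at (\<lambda>y. t * riesz_kernel p (y - s)) x B" "B \<in> F" "- B \<in> dual_subeq F"
proof -
  define e where "e = (x - s) /\<^sub>R norm (x - s)"
  define A where "A = proj_perp e - (p - 1) *\<^sub>R proj_line e"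
  define c where "c = norm (x - s) powr - p"
  have c: "0 < c" using x by (simp add: c_def)
  have "norm e = 1" using x by (simp add: e_def)
  then have "A \<in> sym_boundary F" using riesz by (simp add: finite_riesz_char_def A_def)
  then have A: "A \<in> F" "A \<notin> sym_interior F" using F by (auto simp: sym_boundary_def cone_subequation_def)
  have C: "C2_hessian_at (\<lambda>y. t * riesz_kernel p (y - s)) x (t *\<^sub>R (c *\<^sub>R A))"
    unfolding A_def c_def e_def using x by (intro C2_hessian_at_scale C2_hessian_at_shift riesz_kernel_hessian p) auto
  have B: "t *\<^sub>R (c *\<^sub>R A) \<in> F" by (intro cone_scaleR[OF F] A t c)
  have "- A \<in> dual_subeq F" using A F by (auto simp: dual_subeq_def cone_subequation_def Sym_intros)
  then have "t *\<^sub>R (c *\<^sub>R - A) \<in> dual_subeq F" by (intro dual_scaleR[OF F] t c)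
  then show thesis using that[OF C B] by simp
qed

text \<open>For \<open>2 \<le> p\<close> the kernel is a logarithm or a negative multiple of a
  negative power, hence tends to minus infinity at the origin.\<close>

lemma riesz_kernel_pole:
  assumes p: "2 \<le> p"
  shows "\<exists>r>0. \<forall>x. 0 < norm x \<and> norm x < r \<longrightarrow> riesz_kernel p x \<le> B"
proof (cases "p = 2")
  case True
  have "ln (norm x) \<le> B" if "0 < norm x" "norm x < exp B" for x :: "real^'a"
    using that by (metis less_imp_le ln_exp ln_less_cancel_iff exp_gt_zero)
  then show ?thesis using True by (intro exI[of _ "exp B"]) (auto simp: riesz_kernel_def)
next
  case False
  then have p2: "0 < p - 2" using p by simp
  define C where "C = max 1 (- B * (p - 2))"
  have C: "0 < C" "- B * (p - 2) \<le> C" by (auto simp: C_def)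
  have "riesz_kernel p x \<le> B" if x: "0 < norm x" "norm x < C powr (1 / (2 - p))" for x :: "real^'a"
  proof -
    have "(C powr (1 / (2 - p))) powr (2 - p) < norm x powr (2 - p)"
      using p2 x by (intro powr_less_mono2_neg) auto
    then have "C < norm x powr (2 - p)" using C p2 by (simp add: powr_powr)
    then have "- B * (p - 2) \<le> norm x powr (2 - p)" using C(2) by linarith
    then have "- B \<le> norm x powr (2 - p) / (p - 2)" using p2 by (simp add: pos_le_divide_eq)
    then show ?thesis using False by (simp add: riesz_kernel_def)
  qed
  then show ?thesis using C(1) by (intro exI[of _ "C powr (1 / (2 - p))"]) auto
qed

section \<open>Boundary barriers from defining functions\<close>

lemma C_inf_on_C2:
  fixes rho :: "real^'n \<Rightarrow> real"
  assumes U: "open U" and C: "C_inf_on U rho"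
  obtains g H where "continuous_on U H" "\<And>x. x \<in> U \<Longrightarrow> (rho has_derivative (\<lambda>h. g x \<bullet> h)) (at x)"
    "\<And>x. x \<in> U \<Longrightarrow> (g has_derivative (\<lambda>h. H x *v h)) (at x)"
proof -
  obtain D where D: "\<And>x. x \<in> U \<Longrightarrow> D [] x = rho x" "\<And>ks. continuous_on U (D ks)"
    "\<And>ks x. x \<in> U \<Longrightarrow> (D ks has_derivative (\<lambda>h. \<Sum>i\<in>UNIV. h$i * D (i # ks) x)) (at x)"
    using C unfolding C_inf_on_def by blast
  define g where "g x = (\<chi> i. D [i] x)" for x
  define H where "H x = (\<chi> i j. D [j, i] x)" for x
  show thesis
  proof (rule that[of H g])
    show "continuous_on U H" unfolding H_def by (intro continuous_intros D(2))
    fix x assume x: "x \<in> U"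
    have "(D [] has_derivative (\<lambda>h. g x \<bullet> h)) (at x)"
      using D(3)[OF x, of "[]"] by (simp add: g_def inner_vec_def mult.commute)
    then show "(rho has_derivative (\<lambda>h. g x \<bullet> h)) (at x)"
      by (rule has_derivative_transform_within_open[OF _ U x]) (use D(1) in auto)
    show "(g has_derivative (\<lambda>h. H x *v h)) (at x)"
      unfolding has_derivative_componentwise_within[of g]
    proof
      fix b :: "real^'n" assume "b \<in> Basis"
      then obtain i where b: "b = axis i 1" by (auto simp: Basis_vec_def)
      show "((\<lambda>x. g x \<bullet> b) has_derivative (\<lambda>h. (H x *v h) \<bullet> b)) (at x)"
        using D(3)[OF x, of "[i]"] by (simp add: b inner_axis g_def H_def matrix_vector_mult_def mult.commute)
    qed
  qed
qed

text \<open>The barrier is rho + \<tau> / 2 rho^2 - c |x - y|^2. At \<open>y\<close>, where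
  \<open>rho\<close> vanishes, the square adds to the Hessian just \<tau> times the square of the
  gradient, which strict convexity puts into the interior. The last term supplies the decay and is
  absorbed by openness.\<close>

lemma barrier_exists:
  fixes G :: "(real^'n^'n) set"
  assumes G: "subeq G" "\<And>A t. A \<in> G \<Longrightarrow> 0 < t \<Longrightarrow> t *\<^sub>R A \<in> G" and Om: "open Om" and y: "y \<in> frontier Om"
    and rho: "local_defining_fn Om y rho"
    and strict: "\<And>g A. grad_at rho y g \<Longrightarrow> hess_at rho y A \<Longrightarrow> A \<in> Sym \<Longrightarrow> g \<noteq> 0 \<Longrightarrow>
      \<exists>T. \<forall>t\<ge>T. A + t *\<^sub>R proj_line (g /\<^sub>R norm g) \<in> sym_interior G"
  shows "has_barrier G Om y"
proof -
  obtain U where U: "open U" "y \<in> U" "C_inf_on U rho" "Om \<inter> U = {x\<in>U. rho x < 0}"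
    "\<And>x g. x \<in> U \<Longrightarrow> grad_at rho x g \<Longrightarrow> g \<noteq> 0"
    using rho unfolding local_defining_fn_def by blast
  obtain g H where H: "continuous_on U H" and dr: "\<And>x. x \<in> U \<Longrightarrow> (rho has_derivative (\<lambda>h. g x \<bullet> h)) (at x)"
    and dg: "\<And>x. x \<in> U \<Longrightarrow> (g has_derivative (\<lambda>h. H x *v h)) (at x)" using C_inf_on_C2[OF U(1,3)] by metis
  have cr: "continuous_on U rho" by (intro continuous_at_imp_continuous_on ballI has_derivative_continuous[OF dr])
  have cg: "continuous_on U g" by (intro continuous_at_imp_continuous_on ballI has_derivative_continuous[OF dg])
  have gr: "grad_at rho x (g x)" if "x \<in> U" for x using dr[OF that] by (simp add: grad_at_def)
  obtain r1 where r1: "0 < r1" "ball y r1 \<subseteq> U" using U open_contains_ball by blast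
  have C2: "C2_hessian_at rho y (H y)" unfolding C2_hessian_at_def
    by (rule exI[of _ r1], intro conjI exI[of _ g] exI[of _ H] ballI)
      (use r1 dr dg continuous_on_subset[OF H] in auto)
  have hs: "hess_at rho y (H y)" unfolding hess_at_def using r1 gr dg[OF U(2)] by blast
  have HS: "H y \<in> Sym" using C2_hessian_symmetric[OF C2] by (simp add: Sym_iff)
  have g0: "g y \<noteq> 0" using U(5)[OF U(2) gr[OF U(2)]] .
  obtain T where T: "\<And>t. T \<le> t \<Longrightarrow> H y + t *\<^sub>R proj_line (g y /\<^sub>R norm (g y)) \<in> sym_interior G"
    using strict[OF gr[OF U(2)] hs HS g0] by blast
  define n where "n = norm (g y)"
  have n: "0 < n" using g0 by (simp add: n_def)
  \<comment> \<open>Strict convexity uses the unit normal, but the square of \<open>rho\<close>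
    yields the unnormalised gradient, hence the division by \<open>n\<^sup>2\<close>;
    \<open>max\<close> keeps \<open>\<tau>\<close> positive.\<close>
  define \<tau> where "\<tau> = max T 1 / n\<^sup>2"
  have tau: "0 < \<tau>" using n by (simp add: \<tau>_def)
  have "H y + (\<tau> * n\<^sup>2) *\<^sub>R proj_line (g y /\<^sub>R n) \<in> sym_interior G" unfolding n_def[symmetric]
    using T[of "\<tau> * n\<^sup>2"] n by (simp add: \<tau>_def n_def)
  moreover have "(\<tau> * n\<^sup>2) *\<^sub>R proj_line (g y /\<^sub>R n) = \<tau> *\<^sub>R proj_line (g y)"
    unfolding proj_line_scaleR using n by (simp add: power_inverse)
  ultimately have int: "H y + \<tau> *\<^sub>R proj_line (g y) \<in> sym_interior G" by simp
  obtain e where e: "0 < e" "\<And>B. B \<in> Sym \<Longrightarrow> dist B (H y + \<tau> *\<^sub>R proj_line (g y)) < e \<Longrightarrow> B \<in> sym_interior G"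
    using sym_interior_open[OF int] by metis
  obtain c where c: "0 < c" "norm ((2 * c) *\<^sub>R mat 1 :: real^'n^'n) \<le> e / 2" using mat_1_perturbation[OF e(1)] by blast
  have rho0: "rho x \<le> 0" if x: "x \<in> closure Om" "x \<in> U" for x
  proof (rule ccontr)
    assume n: "\<not> rho x \<le> 0"
    have op: "open {z \<in> U. 0 < rho z}" using continuous_open_preimage[OF cr U(1), of "{0<..}"] by (simp add: vimage_def Int_def)
    have "x \<in> {z \<in> U. 0 < rho z} \<inter> closure Om" using x n by simp
    then have "{z \<in> U. 0 < rho z} \<inter> Om \<noteq> {}" using open_Int_closure_eq_empty[OF op, of Om] by blast
    then obtain z where z: "z \<in> Om \<inter> U" "0 < rho z" by blast
    then have "rho z < 0" using U(4) by blast
    then show False using z(2) by simp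
  qed
  have rhoy: "rho y = 0"
  proof -
    have "y \<in> closure Om" "y \<notin> Om" using y Om by (auto simp: frontier_def interior_open)
    then have "\<not> rho y < 0" "rho y \<le> 0" using rho0[of y] U(2,4) by blast+
    then show ?thesis by simp
  qed
  \<comment> \<open>The Hessian of \<open>rho\<close> plus \<open>\<tau> / 2\<close> times its
    square.\<close>
  define B where "B x = (1 + \<tau> * rho x) *\<^sub>R H x + \<tau> *\<^sub>R proj_line (g x)" for x
  have cB: "continuous_on U B" unfolding B_def by (intro continuous_intros cr H continuous_on_proj_line cg)
  have By: "B y = H y + \<tau> *\<^sub>R proj_line (g y)" by (simp add: B_def rhoy)
  have "isCont B y" using cB U(1,2) by (simp add: continuous_on_eq_continuous_at)
  then obtain r2 where r2: "0 < r2" "\<And>x. dist x y < r2 \<Longrightarrow> dist (B x) (B y) < e / 2"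
    unfolding continuous_at_eps_delta using e(1) by (metis half_gt_zero)
  \<comment> \<open>Keeps \<open>1 + \<tau> / 2 * rho x\<close> nonnegative near \<open>y\<close>,
    so that the squared term does not spoil the sign of \<open>rho\<close> on the closure.\<close>
  have "isCont (\<lambda>x. \<tau> * rho x) y" using cr U(1,2) by (intro continuous_intros) (simp add: continuous_on_eq_continuous_at)
  then obtain r3 where r3: "0 < r3" "\<And>x. dist x y < r3 \<Longrightarrow> dist (\<tau> * rho x) (\<tau> * rho y) < 1"
    unfolding continuous_at_eps_delta using zero_less_one by blast
  define r where "r = min r1 (min r2 r3)"
  have r: "0 < r" using r1 r2 r3 by (simp add: r_def)
  define \<beta>0 where "\<beta>0 x = rho x + \<tau> / 2 * (rho x)\<^sup>2" for x
  define q where "q x = 0 + (0 \<bullet> (x - y) + (x - y) \<bullet> (((- 2 * c) *\<^sub>R mat 1) *v (x - y)) / 2)" for x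
  have q: "q x = - (c * (norm (x - y))\<^sup>2)" for x
    unfolding q_def by (simp only: scaleR_matrix_vector_assoc[symmetric]) (simp add: power2_norm_eq_inner)
  have "transpose ((- 2 * c) *\<^sub>R mat 1 :: real^'n^'n) = (- 2 * c) *\<^sub>R mat 1" by (simp only: transpose_linear transpose_mat)
  then have qC: "C2_hessian_at q x ((- 2 * c) *\<^sub>R mat 1)" for x
    unfolding q_def by (rule C2_hessian_at_quadratic)
  have d0: "(\<beta>0 has_derivative (\<lambda>h. ((1 + \<tau> * rho x) *\<^sub>R g x) \<bullet> h)) (at x)" if x: "x \<in> U" for x
    unfolding \<beta>0_def power2_eq_square
    by (rule derivative_eq_intros dr[OF x] refl ext)+ (simp add: algebra_simps)
  have d1: "((\<lambda>x. (1 + \<tau> * rho x) *\<^sub>R g x) has_derivative (\<lambda>h. B x *v h)) (at x)" if x: "x \<in> U" for x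
  proof -
    have "((\<lambda>x. 1 + \<tau> * rho x) has_derivative (\<lambda>h. 0 + \<tau> * (g x \<bullet> h))) (at x)"
      by (intro has_derivative_add has_derivative_const has_derivative_mult_right dr x)
    from has_derivative_scaleR[OF this dg[OF x]] show ?thesis
      by (simp add: B_def matrix_vector_mult_add_rdistrib scaleR_matrix_vector_assoc[symmetric] proj_line_mult)
  qed
  have C0: "C2_hessian_at \<beta>0 x (B x)" if x: "x \<in> U" for x
  proof -
    obtain s where s: "0 < s" "ball x s \<subseteq> U" using U(1) x open_contains_ball by blast
    show ?thesis unfolding C2_hessian_at_def
    proof (rule exI[of _ s], intro conjI exI[of _ "\<lambda>x. (1 + \<tau> * rho x) *\<^sub>R g x"] exI[of _ B] ballI)
      show "continuous_on (ball x s) B" by (rule continuous_on_subset[OF cB s(2)])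
      fix z assume "z \<in> ball x s"
      then have z: "z \<in> U" using s(2) by blast
      show "(\<beta>0 has_derivative (\<lambda>h. ((1 + \<tau> * rho z) *\<^sub>R g z) \<bullet> h)) (at z)" by (rule d0[OF z])
      show "((\<lambda>x. (1 + \<tau> * rho x) *\<^sub>R g x) has_derivative (\<lambda>h. B z *v h)) (at z)" by (rule d1[OF z])
    qed (use s in auto)
  qed
  have Cb: "C2_hessian_at (\<lambda>x. \<beta>0 x + q x) x (B x + (- 2 * c) *\<^sub>R mat 1)" if "x \<in> U" for x
    by (intro C2_hessian_at_add C0 qC that)
  have inG: "B x + (- 2 * c) *\<^sub>R mat 1 \<in> G" if x: "x \<in> ball y r" for x
  proof -
    have xU: "x \<in> U" using x r1(2) by (auto simp: r_def)
    have "B x + (- 2 * c) *\<^sub>R mat 1 \<in> Sym" using C2_hessian_symmetric[OF Cb[OF xU]] by (simp add: Sym_iff)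
    moreover have "dist (B x + (- 2 * c) *\<^sub>R mat 1) (B y) < e"
    proof -
      have "dist (B x + (- 2 * c) *\<^sub>R mat 1) (B y) = norm ((B x - B y) + (- 2 * c) *\<^sub>R mat 1)" by (simp add: dist_norm algebra_simps)
      also have "\<dots> \<le> norm (B x - B y) + norm ((- 2 * c) *\<^sub>R mat 1 :: real^'n^'n)" by (rule norm_triangle_ineq)
      also have "norm (B x - B y) < e / 2"
      proof -
        have "dist x y < r2" using x by (simp add: r_def dist_commute)
        then show ?thesis using r2(2)[of x] by (simp add: dist_norm)
      qed
      finally show ?thesis using c(2) by simp
    qed
    ultimately show ?thesis using e(2) By sym_interior_subset by (metis IntD1 subsetD)
  qed
  show ?thesis unfolding has_barrier_def
  proof (rule exI[of _ r], rule conjI[OF r], rule exI[of _ c], rule conjI[OF c(1)], rule exI[of _ "\<lambda>x. \<beta>0 x + q x"], intro conjI allI impI ballI)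
    show "\<beta>0 y + q y = 0" by (simp add: \<beta>0_def q rhoy)
    show "continuous_on (ball y r) (\<lambda>x. \<beta>0 x + q x)" unfolding \<beta>0_def q
      by (intro continuous_intros continuous_on_subset[OF cr]) (use r1(2) in \<open>auto simp: r_def\<close>)
    show "sub_at G (\<lambda>x. C * (\<beta>0 x + q x)) x" if "0 < C" "x \<in> ball y r" for C x
    proof (rule sub_at_smooth[OF G(1)])
      show "C2_hessian_at (\<lambda>x. C * (\<beta>0 x + q x)) x (C *\<^sub>R (B x + (- 2 * c) *\<^sub>R mat 1))"
        using that(2) r1(2) by (intro C2_hessian_at_scale Cb) (auto simp: r_def)
      show "C *\<^sub>R (B x + (- 2 * c) *\<^sub>R mat 1) \<in> G" by (intro G(2) inG that)
    qed
    fix x assume x: "x \<in> closure Om \<inter> ball y r"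
    have xU: "x \<in> U" using x r1(2) by (auto simp: r_def)
    have r0: "rho x \<le> 0" using rho0 x xU by simp
    have "\<bar>\<tau> * rho x\<bar> < 1" using r3(2)[of x] x by (auto simp: r_def rhoy dist_commute)
    then have "0 \<le> 1 + \<tau> / 2 * rho x" by (simp add: abs_less_iff)
    then have "rho x * (1 + \<tau> / 2 * rho x) \<le> 0" using r0 by (simp add: mult_nonpos_nonneg)
    then have "\<beta>0 x \<le> 0" by (simp add: \<beta>0_def power2_eq_square algebra_simps)
    then show "\<beta>0 x + q x \<le> - (c * (norm (x - y))\<^sup>2)" by (simp add: q)
  qed
qed

text \<open>As \<open>F\<close> is closed, a ball around \<open>- proj_line e\<close> misses it, so
  the symmetric matrices near \<open>proj_line e\<close> lie in the dual. Division by a large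
  \<open>t\<close> moves \<open>A + t *\<^sub>R proj_line e\<close> close to
  \<open>proj_line e\<close>.\<close>

lemma dual_strict:
  fixes F :: "(real^'n^'n) set"
  assumes F: "cone_subequation F" and e: "- proj_line e \<notin> F" and A: "A \<in> Sym"
  shows "\<exists>T. \<forall>t\<ge>T. A + t *\<^sub>R proj_line e \<in> sym_interior (dual_subeq F)"
proof -
  have cl: "open (- F)" using F by (simp add: cone_subequation_def open_Compl)
  obtain d where d: "0 < d" "ball (- proj_line e) d \<subseteq> - F" using cl e open_contains_ball by blast
  have near: "B \<in> dual_subeq F" if B: "B \<in> Sym" "dist B (proj_line e) < d" for B
  proof -
    have "- B \<in> ball (- proj_line e) d" using B(2) by (simp add: dist_norm norm_minus_commute)
    then have "- B \<notin> sym_interior F" using d(2) sym_interior_subset by blast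
    then show ?thesis using B(1) by (simp add: dual_subeq_def)
  qed
  \<comment> \<open>The quotient makes \<open>norm A / t\<close> smaller than \<open>d / 2\<close>;
    the summand 1 keeps \<open>t\<close> positive even for \<open>A = 0\<close>.\<close>
  have "A + t *\<^sub>R proj_line e \<in> sym_interior (dual_subeq F)" if t: "2 * norm A / d + 1 \<le> t" for t
  proof -
    have "0 \<le> 2 * norm A / d" using d(1) by simp
    then have t0: "0 < t" using t by linarith
    have "2 * norm A / d < t" using t by simp
    then have tA: "norm A < t * d / 2" using d(1) by (simp add: pos_divide_less_eq)
    have "B \<in> dual_subeq F" if B: "B \<in> Sym" "dist B (A + t *\<^sub>R proj_line e) < t * d / 2" for B
    proof -
      have "norm (B - t *\<^sub>R proj_line e) \<le> norm (B - (A + t *\<^sub>R proj_line e)) + norm A"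
        using norm_triangle_ineq[of "B - (A + t *\<^sub>R proj_line e)" A] by simp
      then have l: "norm (B - t *\<^sub>R proj_line e) < t * d" using B(2) tA by (simp add: dist_norm)
      have "(1 / t) *\<^sub>R B - proj_line e = (1 / t) *\<^sub>R (B - t *\<^sub>R proj_line e)" using t0 by (simp add: scaleR_diff_right)
      then have "dist ((1 / t) *\<^sub>R B) (proj_line e) = norm (B - t *\<^sub>R proj_line e) / t" using t0 by (simp add: dist_norm)
      then have "dist ((1 / t) *\<^sub>R B) (proj_line e) < d" using l t0 by (simp add: pos_divide_less_eq mult.commute)
      then have "(1 / t) *\<^sub>R B \<in> dual_subeq F" using B(1) by (intro near Sym_intros)
      then have "t *\<^sub>R ((1 / t) *\<^sub>R B) \<in> dual_subeq F" by (rule dual_scaleR[OF F _ t0])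
      then show ?thesis using t0 by simp
    qed
    then show ?thesis unfolding sym_interior_def using A t0 d(1) proj_line_Sym
      by (auto intro!: Sym_intros exI[of _ "t * d / 2"])
  qed
  then show ?thesis by blast
qed

lemma domain_barriers:
  fixes F :: "(real^'n^'n) set"
  assumes F: "cone_subequation F" and negPe: "\<forall>e::real^'n. norm e = 1 \<longrightarrow> - proj_line e \<notin> F" and Om: "open Om"
    and smooth: "smooth_boundary Om" and strict: "strictly_F_convex_boundary F Om" and y: "y \<in> frontier Om"
  shows "has_barrier F Om y" "has_barrier (dual_subeq F) Om y"
proof -
  obtain rho where rho: "local_defining_fn Om y rho" using smooth y unfolding smooth_boundary_def by blast
  show "has_barrier F Om y"
    by (rule barrier_exists[OF cone_imp_subeq[OF F] cone_scaleR[OF F] Om y rho])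
      (use strict rho y in \<open>auto simp: strictly_F_convex_boundary_def\<close>)
  show "has_barrier (dual_subeq F) Om y"
  proof (rule barrier_exists[OF subeq_dual[OF cone_imp_subeq[OF F]] dual_scaleR[OF F] Om y rho])
    fix g :: "real^'n" and A :: "real^'n^'n" assume A: "A \<in> Sym" and g: "g \<noteq> 0"
    then have "- proj_line (g /\<^sub>R norm g) \<notin> F" using negPe by simp
    then show "\<exists>T. \<forall>t\<ge>T. A + t *\<^sub>R proj_line (g /\<^sub>R norm g) \<in> sym_interior (dual_subeq F)"
      by (rule dual_strict[OF F _ A])
  qed
qed

lemma riesz_kernel_continuous:
  assumes "2 \<le> p"
  shows "continuous_on (- {0}) (riesz_kernel p :: real^'n \<Rightarrow> real)"
proof (intro continuous_at_imp_continuous_on ballI)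
  fix y :: "real^'n" assume "y \<in> - {0}"
  then show "isCont (riesz_kernel p) y"
    using has_derivative_continuous[OF has_derivative_riesz_kernel[OF assms, of y]] by simp
qed

text \<open>\<open>sum_sub\<close> is what the two parts of the theorem prove differently. The
  starting subsolution is the sum of kernels, lowered by a constant to lie below the boundary data;
  at each pole the other kernels are bounded.\<close>

lemma green_function_exists_unique:
  fixes F :: "(real^'n^'n) set" and Th :: "real^'n \<Rightarrow> real"
  assumes F: "cone_subequation F" and riesz: "finite_riesz_char F p" and p: "2 \<le> p"
    and negPe: "\<forall>e::real^'n. norm e = 1 \<longrightarrow> - proj_line e \<notin> F" and Om: "open Om" "bounded Om"
    and smooth: "smooth_boundary Om" and strict: "strictly_F_convex_boundary F Om"
    and phi: "continuous_on (frontier Om) \<phi>"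
    and S: "finite S" "S \<subseteq> Om" "S \<noteq> {}" and Th: "\<forall>s\<in>S. 0 < Th s"
    and sum_sub: "\<forall>x\<in>Om - S. sub_at F (\<lambda>y. \<Sum>s\<in>S. Th s * riesz_kernel p (y - s)) x"
  shows "\<exists>H. continuous_on (closure Om - S) H \<and> F_harmonic F (Om - S) H \<and> (\<forall>x\<in>frontier Om. H x = \<phi> x) \<and>
      (\<forall>s\<in>S. \<exists>r>0. \<exists>M. \<forall>x\<in>ball s r - {s}. \<bar>H x - Th s * riesz_kernel p (x - s)\<bar> \<le> M) \<and>
      (\<forall>H'. continuous_on (closure Om - S) H' \<and> F_harmonic F (Om - S) H' \<and> (\<forall>x\<in>frontier Om. H' x = \<phi> x) \<and>
         (\<forall>s\<in>S. \<exists>r>0. \<exists>M. \<forall>x\<in>ball s r - {s}. \<bar>H' x - Th s * riesz_kernel p (x - s)\<bar> \<le> M)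
         \<longrightarrow> (\<forall>x\<in>closure Om - S. H' x = H x))"
proof -
  define k where "k = (riesz_kernel p :: real^'n \<Rightarrow> real)"
  define \<psi> where "\<psi> y = (\<Sum>s\<in>S. Th s * k (y - s))" for y
  have kc: "continuous_on (- {s}) (\<lambda>y. k (y - s))" for s
    unfolding k_def by (rule continuous_on_compose2[OF riesz_kernel_continuous[OF p]]) (auto intro!: continuous_intros)
  have psic: "continuous_on (closure Om - S) \<psi>" unfolding \<psi>_def
    by (intro continuous_intros continuous_on_subset[OF kc]) auto
  have fr: "compact (frontier Om)" "frontier Om \<subseteq> closure Om - S"
  proof -
    show "compact (frontier Om)" using Om(2) by (simp add: compact_frontier_bounded)
    show "frontier Om \<subseteq> closure Om - S" using Om(1) S(2) by (auto simp: frontier_def interior_open)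
  qed
  have "continuous_on (frontier Om) (\<lambda>x. \<phi> x - \<psi> x)" by (intro continuous_intros phi continuous_on_subset[OF psic fr(2)])
  then have "bounded ((\<lambda>x. \<phi> x - \<psi> x) ` frontier Om)" using fr(1) compact_continuous_image compact_imp_bounded by blast
  then obtain c where c: "\<forall>z\<in>(\<lambda>x. \<phi> x - \<psi> x) ` frontier Om. norm z \<le> c" unfolding bounded_iff by blast
  interpret singular_dirichlet F Om S Th k \<phi> "\<lambda>x. \<psi> x + - c"
  proof
    show "\<exists>r>0. \<forall>x. 0 < norm x \<and> norm x < r \<longrightarrow> k x \<le> B" for B unfolding k_def by (rule riesz_kernel_pole[OF p])
    show "sub_at (dual_subeq F) (\<lambda>y. - (t * k (y - s))) x" if t: "0 < t" "x \<noteq> s" for t s x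
    proof -
      obtain B where B: "C2_hessian_at (\<lambda>y. t * riesz_kernel p (y - s)) x B" "- B \<in> dual_subeq F"
        using riesz_kernel_in_cone[OF F riesz p t(2) t(1)] by metis
      show ?thesis unfolding k_def
        by (rule sub_at_smooth[OF subeq_dual[OF cone_imp_subeq[OF F]] C2_hessian_at_minus[OF B(1)] B(2)])
    qed
    show "continuous_on (closure Om - S) (\<lambda>x. \<psi> x + - c)" by (intro continuous_intros psic)
    show "sub_at F (\<lambda>x. \<psi> x + - c) x" if "x \<in> Om - S" for x
      using bspec[OF sum_sub that] unfolding \<psi>_def k_def by (rule sub_at_add_const)
    show "\<psi> x + - c \<le> \<phi> x" if "x \<in> frontier Om" for x using c that by (auto simp: abs_le_iff)
    show "\<exists>r>0. \<exists>M. \<forall>x\<in>ball s r - {s}. \<bar>\<psi> x + - c - Th s * k (x - s)\<bar> \<le> M" if s: "s \<in> S" for s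
    proof -
      define R where "R y = (\<Sum>s'\<in>S - {s}. Th s' * k (y - s'))" for y
      have "continuous_on (- (S - {s})) R" unfolding R_def
        by (intro continuous_intros continuous_on_subset[OF kc]) auto
      moreover have "open (- (S - {s}))" by (intro open_Compl finite_imp_closed finite_Diff S(1))
      moreover have "s \<in> - (S - {s})" by simp
      ultimately have "isCont R s" by (simp add: continuous_on_eq_continuous_at)
      then obtain d where d: "0 < d" "\<And>y. dist y s < d \<Longrightarrow> dist (R y) (R s) < 1"
        unfolding continuous_at_eps_delta using zero_less_one by blast
      have eq: "\<psi> y = Th s * k (y - s) + R y" for y unfolding \<psi>_def R_def using S(1) s by (simp add: sum.remove)
      have "\<bar>\<psi> x + - c - Th s * k (x - s)\<bar> \<le> \<bar>R s\<bar> + 1 + \<bar>c\<bar>" if "x \<in> ball s d - {s}" for x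
        using d(2)[of x] that unfolding eq dist_real_def by (simp add: dist_commute)
      then show ?thesis using d(1) by blast
    qed
    show "has_barrier F Om y" "has_barrier (dual_subeq F) Om y" if "y \<in> frontier Om" for y
      using domain_barriers[OF F negPe Om(1) smooth strict that] by auto
  qed (use F Om S Th phi riesz_kernel_continuous[OF p] in \<open>auto simp: k_def\<close>)
  show ?thesis using solution_exists_unique[unfolded solution_def conj_assoc] unfolding k_def .
qed

text \<open>Functions are total, so uniqueness means agreement on the closed domain off the poles.
  Green's functions are the instances with zero boundary data.\<close>

theorem theorem3p5:
  fixes F :: "(real^'n^'n) set" and p :: real and \<Omega> :: "(real^'n) set"
  assumes cone: "cone_subequation F"
    and riesz: "finite_riesz_char F p" and p2: "p \<ge> 2"
    and negPe: "\<forall>e::real^'n. norm e = 1 \<longrightarrow> - proj_line e \<notin> F"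
    and dom: "open \<Omega>" "connected \<Omega>" "\<Omega> \<noteq> {}" "bounded \<Omega>"
    and smooth: "smooth_boundary \<Omega>"
    and strict: "strictly_F_convex_boundary F \<Omega>"
  shows
    "(\<forall>\<phi> x0 \<Theta>. continuous_on (frontier \<Omega>) \<phi> \<and> x0 \<in> \<Omega> \<and> \<Theta> > 0 \<longrightarrow>
       (\<exists>H. continuous_on (closure \<Omega> - {x0}) H \<and> F_harmonic F (\<Omega> - {x0}) H \<and>
            (\<forall>x\<in>frontier \<Omega>. H x = \<phi> x) \<and>
            (\<exists>r>0. \<exists>M. \<forall>x\<in>ball x0 r - {x0}. \<bar>H x - \<Theta> * riesz_kernel p (x - x0)\<bar> \<le> M) \<and>
            (\<forall>H'. continuous_on (closure \<Omega> - {x0}) H' \<and> F_harmonic F (\<Omega> - {x0}) H' \<and>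
                  (\<forall>x\<in>frontier \<Omega>. H' x = \<phi> x) \<and>
                  (\<exists>r>0. \<exists>M. \<forall>x\<in>ball x0 r - {x0}. \<bar>H' x - \<Theta> * riesz_kernel p (x - x0)\<bar> \<le> M)
                  \<longrightarrow> (\<forall>x\<in>closure \<Omega> - {x0}. H' x = H x))))
   \<and>
    (convex F \<longrightarrow>
     (\<forall>\<phi> (k::nat) (xs :: nat \<Rightarrow> real^'n) (\<Theta> :: nat \<Rightarrow> real).
        continuous_on (frontier \<Omega>) \<phi> \<and> k \<ge> 1 \<and> inj_on xs {1..k} \<and>
        (\<forall>j\<in>{1..k}. xs j \<in> \<Omega> \<and> \<Theta> j > 0) \<longrightarrow>
       (\<exists>H. continuous_on (closure \<Omega> - xs ` {1..k}) H \<and>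
            F_harmonic F (\<Omega> - xs ` {1..k}) H \<and>
            (\<forall>x\<in>frontier \<Omega>. H x = \<phi> x) \<and>
            (\<forall>j\<in>{1..k}. \<exists>r>0. \<exists>M. \<forall>x\<in>ball (xs j) r - {xs j}.
                 \<bar>H x - \<Theta> j * riesz_kernel p (x - xs j)\<bar> \<le> M) \<and>
            (\<forall>H'. continuous_on (closure \<Omega> - xs ` {1..k}) H' \<and>
                  F_harmonic F (\<Omega> - xs ` {1..k}) H' \<and>
                  (\<forall>x\<in>frontier \<Omega>. H' x = \<phi> x) \<and>
                  (\<forall>j\<in>{1..k}. \<exists>r>0. \<exists>M. \<forall>x\<in>ball (xs j) r - {xs j}.
                       \<bar>H' x - \<Theta> j * riesz_kernel p (x - xs j)\<bar> \<le> M)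
                  \<longrightarrow> (\<forall>x\<in>closure \<Omega> - xs ` {1..k}. H' x = H x)))))"
proof -
  note solve = green_function_exists_unique[OF cone riesz p2 negPe dom(1,4) smooth strict]
  have smooth_kernel: "\<exists>B\<in>F. C2_hessian_at (\<lambda>y. t * riesz_kernel p (y - s)) x B" if "x \<noteq> s" "0 < t" for x s :: "real^'n" and t
    using riesz_kernel_in_cone[OF cone riesz p2 that] by metis
  show ?thesis
  proof ((intro conjI impI allI; elim conjE), goal_cases)
    case h: (1 \<phi> x0 \<Theta>)
    have sub: "\<forall>x\<in>\<Omega> - {x0}. sub_at F (\<lambda>y. \<Sum>s\<in>{x0}. \<Theta> * riesz_kernel p (y - s)) x"
    proof
      fix x assume x: "x \<in> \<Omega> - {x0}"
      obtain B where "B \<in> F" "C2_hessian_at (\<lambda>y. \<Theta> * riesz_kernel p (y - x0)) x B" using smooth_kernel[of x x0 \<Theta>] x h(3) by auto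
      then have "sub_at F (\<lambda>y. \<Theta> * riesz_kernel p (y - x0)) x" by (intro sub_at_smooth[OF cone_imp_subeq[OF cone]])
      then show "sub_at F (\<lambda>y. \<Sum>s\<in>{x0}. \<Theta> * riesz_kernel p (y - s)) x" by simp
    qed
    have S: "finite {x0}" "{x0} \<subseteq> \<Omega>" "{x0} \<noteq> {}" "\<forall>s\<in>{x0}. 0 < \<Theta>" using h by auto
    have eq: "(\<forall>s\<in>{x0}. P s) \<longleftrightarrow> P x0" for P by simp
    show ?case
      using solve[of \<phi> "{x0}" "\<lambda>_. \<Theta>", OF h(1) S sub] unfolding eq .
  next
    case (2 \<phi> k xs \<Theta>)
    note cvx = 2(1) and h = 2(2,3) and inj = 2(4) and pts = 2(5)
    \<comment> \<open>Strengths are indexed by \<open>j\<close> in the statement and by the pole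
      itself in the general lemma; injectivity of \<open>xs\<close> makes the translation well
      defined.\<close>
    let ?S = "xs ` {1..k}" let ?Th = "\<lambda>s. \<Theta> (the_inv_into {1..k} xs s)"
    have Th: "?Th (xs j) = \<Theta> j" if "j \<in> {1..k}" for j using the_inv_into_f_f[OF inj that] by simp
    have Thpos: "0 < ?Th s" if "s \<in> ?S" for s using that pts Th by auto
    \<comment> \<open>Convexity enters through \<open>cone_convex_add\<close>: Hessians of single
      kernels add up inside \<open>F\<close>. Starting from one pole avoids asking for the zero
      matrix.\<close>
    have "\<exists>B\<in>F. C2_hessian_at (\<lambda>y. \<Sum>s\<in>S'. ?Th s * riesz_kernel p (y - s)) x B"
      if "finite S'" "S' \<noteq> {}" "S' \<subseteq> ?S" "x \<in> \<Omega> - ?S" for S' x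
      using that
    proof (induction S' rule: finite_ne_induct)
      case (singleton s)
      then show ?case using smooth_kernel[of x s "?Th s"] Thpos[of s] by auto
    next
      case (insert s S')
      obtain B where B: "B \<in> F" "C2_hessian_at (\<lambda>y. \<Sum>s\<in>S'. ?Th s * riesz_kernel p (y - s)) x B" using insert by blast
      have "x \<noteq> s" "0 < ?Th s" using insert.prems Thpos by auto
      then obtain B' where B': "B' \<in> F" "C2_hessian_at (\<lambda>y. ?Th s * riesz_kernel p (y - s)) x B'" using smooth_kernel by blast
      show ?case using C2_hessian_at_add[OF B'(2) B(2)] cone_convex_add[OF cone cvx B'(1) B(1)] insert.hyps
        by (auto simp: sum.insert)
    qed
    note hess = this
    have S: "finite ?S" "?S \<subseteq> \<Omega>" "?S \<noteq> {}" using pts h(2) by auto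
    have sub: "\<forall>x\<in>\<Omega> - ?S. sub_at F (\<lambda>y. \<Sum>s\<in>?S. ?Th s * riesz_kernel p (y - s)) x"
    proof
      fix x assume x: "x \<in> \<Omega> - ?S"
      obtain B where "B \<in> F" "C2_hessian_at (\<lambda>y. \<Sum>s\<in>?S. ?Th s * riesz_kernel p (y - s)) x B"
        using hess[OF S(1,3) order_refl x] by blast
      then show "sub_at F (\<lambda>y. \<Sum>s\<in>?S. ?Th s * riesz_kernel p (y - s)) x" by (intro sub_at_smooth[OF cone_imp_subeq[OF cone]])
    qed
    have Thpos': "\<forall>s\<in>?S. 0 < ?Th s" using Thpos by blast
    have eq: "(\<forall>s\<in>?S. \<exists>r>0. \<exists>M. \<forall>x\<in>ball s r - {s}. \<bar>H x - ?Th s * riesz_kernel p (x - s)\<bar> \<le> M) \<longleftrightarrow>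
       (\<forall>j\<in>{1..k}. \<exists>r>0. \<exists>M. \<forall>x\<in>ball (xs j) r - {xs j}. \<bar>H x - \<Theta> j * riesz_kernel p (x - xs j)\<bar> \<le> M)" for H
      using Th by simp
    show ?case
      using solve[of \<phi> ?S ?Th, OF h(1) S Thpos' sub] unfolding eq .
  qed
qed

end
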